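(* Suppose the following Assumptions hold. Assumption 1: $E[\|\psi(W,\gamma_0,\alpha_0,\theta_0)\|^2]<\infty$ and, for each $\ell=1,\dots,L$, i) $\int\|g(w,\hat\gamma_\ell,\theta_0)-g(w,\gamma_0,\theta_0)\|^2F_0(dw)\xrightarrow{p}0$; ii) $\int\|\phi(w,\hat\gamma_\ell,\alpha_0,\theta_0)-\phi(w,\gamma_0,\alpha_0,\theta_0)\|^2F_0(dw)\xrightarrow{p}0$; iii) $\int\|\phi(w,\gamma_0,\hat\alpha_\ell,\tilde\theta_\ell)-\phi(w,\gamma_0,\alpha_0,\theta_0)\|^2F_0(dw)\xrightarrow{p}0$. Assumption 2: For each $\ell=1,\dots,L$, either i) $\sqrt n\int\hat\Delta_\ell(w)F_0(dw)\xrightarrow{p}0$ and $\int\|\hat\Delta_\ell(w)\|^2F_0(dw)\xrightarrow{p}0$; or ii) $\sum_{i\in I_\ell}\|\hat\Delta_\ell(W_i)\|/\sqrt n\xrightarrow{p}0$; or iii) $\sum_{i\in I_\ell}\hat\Delta_\ell(W_i)/\sqrt n\xrightarrow{p}0$. Assumption 3: For each $\ell=1,\dots,L$, i) $\int\phi(w,\gamma_0,\hat\alpha_\ell,\tilde\theta_\ell)F_0(dw)=0$; and either ii) $\bar\psi(\gamma,\alpha_0,\theta_0)$ is affine in $\gamma$; or iii) $\|\hat\gamma_\ell-\gamma_0\|=o_p(n^{-1/4})$ and there is $C$ with $\|\bar\psi(\gamma,\alpha_0,\theta_0)\|\le C\|\gamma-\gamma_0\|^2$ for all $\gamma$ with $\|\gamma-\gamma_0\|$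 small enough; or iv) $\sqrt n\,\bar\psi(\hat\gamma_\ell,\alpha_0,\theta_0)\xrightarrow{p}0$. Assumption 4: $G=E[\partial g(W,\gamma_0,\theta_0)/\partial\theta]$ exists and there is a neighborhood $\mathcal N$ of $\theta_0$ and a norm $\|\cdot\|$ such that i) for each $\ell$, $\|\hat\gamma_\ell-\gamma_0\|\xrightarrow{p}0$; ii) for all $\|\gamma-\gamma_0\|$ small enough, $g(W,\gamma,\theta)$ is differentiable in $\theta$ on $\mathcal N$ with probability approaching $1$, and there are $C>0$ and $d(W,\gamma)$ such that for $\theta\in\mathcal N$ and $\|\gamma-\gamma_0\|$ small enough $$\left\|\frac{\partial g(W,\gamma,\theta)}{\partial\theta}-\frac{\partial g(W,\gamma,\theta_0)}{\partial\theta}\right\|\le d(W,\gamma)\|\theta-\theta_0\|^{1/C},\qquad E[d(W,\gamma)]<C;$$ iii) for each $\ell=1,\dots,L$, $j$, and $k$, $\int|\partial g_j(w,\hat\gamma_\ell,\theta_0)/\partial\theta_k-\partial g_j(w,\gamma_0,\theta_0)/\partial\theta_k|F_0(dw)\xrightarrow{p}0$. Suppose also that $\hat\theta\xrightarrow{p}\theta_0$, $\hat\Upsilon\xrightarrow{p}\Upsilon$, and $G'\Upsilon G$ is nonsingular. Then $$\sqrt n(\hat\theta-\theta_0)\xrightarrow{d}N(0,V),\qquad V=(G'\Upsilon G)^{-1}G'\Upsilon\Psi\Upsilon G(G'\Upsilon G)^{-1}.$$ If also, for each $\ell=1,\dots,L$, $\int\|g(w,\hat\gamma_\ell,\tilde\theta_\ell)-g(w,\hat\gamma_\ell,\theta_0)\|^2F_0(dw)\xrightarrow{p}0$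 and $\int\|\hat\Delta_\ell(w)\|^2F_0(dw)\xrightarrow{p}0$, then $$\hat V=(\hat G'\hat\Upsilon\hat G)^{-1}\hat G'\hat\Upsilon\hat\Psi\hat\Upsilon\hat G(\hat G'\hat\Upsilon\hat G)^{-1}\xrightarrow{p}V.$$
   Context: $W_1,\dots,W_n$ are i.i.d. with distribution $F_0$, and $E$ is expectation under $F_0$. $g(w,\gamma,\theta)$ is a vector of identifying moment functions of a finite dimensional parameter $\theta\in\Theta$ and an unknown function $\gamma$, with $E[g(W,\gamma_0,\theta_0)]=0$ at the true values. $\phi(w,\gamma,\alpha,\theta)$ is the nonparametric influence function, where $\alpha$ is an additional unknown function with true value $\alpha_0$. That is, with $\gamma(F)$ the probability limit of the first step estimator under distribution $F$ and $F_\tau=(1-\tau)F_0+\tau H$, one has $\frac{d}{d\tau}E[g(W,\gamma(F_\tau),\theta)]=\int\phi(w,\gamma_0,\alpha_0,\theta)H(dw)$ (derivative from the right at $\tau=0$) and $E[\phi(W,\gamma_0,\alpha_0,\theta)]=0$. Put $\psi=g+\phi$, $\bar\psi(\gamma,\alpha,\theta)=E[\psi(W,\gamma,\alpha,\theta)]$, and $\Psi=E[\psi(W,\gamma_0,\alpha_0,\theta_0)\psi(W,\gamma_0,\alpha_0,\theta_0)']$. First steps $\gamma$ (including $\gamma_0$ and $\hat\gamma_\ell$) lie in a linear set $\Gamma$, and the moments are Neyman orthogonal: $\frac{d}{d\tau}\bar\psi((1-\tau)\gamma_0+\tau\gamma,\alpha_0,\theta_0)|_{\tau=0}=0$ for all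 $\gamma\in\Gamma$ (relevant only for alternative ii) of Assumption 3). The indices $1,\dots,n$ are partitioned into $L$ groups $I_\ell$. $\hat\gamma_\ell,\hat\alpha_\ell,\tilde\theta_\ell$ are estimators of $\gamma_0,\alpha_0,\theta_0$ constructed using only observations not in $I_\ell$. Define $$\hat\Delta_\ell(w)=\phi(w,\hat\gamma_\ell,\hat\alpha_\ell,\tilde\theta_\ell)-\phi(w,\gamma_0,\hat\alpha_\ell,\tilde\theta_\ell)-\phi(w,\hat\gamma_\ell,\alpha_0,\theta_0)+\phi(w,\gamma_0,\alpha_0,\theta_0),$$ $$\hat\psi(\theta)=\frac1n\sum_{\ell=1}^L\sum_{i\in I_\ell}\{g(W_i,\hat\gamma_\ell,\theta)+\phi(W_i,\hat\gamma_\ell,\hat\alpha_\ell,\tilde\theta_\ell)\}.$$ The debiased GMM estimator is $\hat\theta=\arg\min_{\theta\in\Theta}\hat\psi(\theta)'\hat\Upsilon\hat\psi(\theta)$ with $\hat\Upsilon$ a positive semi-definite weighting matrix. Also $\hat G=\partial\hat\psi(\hat\theta)/\partial\theta$ and $\hat\Psi=\frac1n\sum_{\ell=1}^L\sum_{i\in I_\ell}\hat\psi_{i\ell}\hat\psi_{i\ell}'$ with $\hat\psi_{i\ell}=g(W_i,\hat\gamma_\ell,\tilde\theta_\ell)+\phi(W_i,\hat\gamma_\ell,\hat\alpha_\ell,\tilde\theta_\ell)$. *)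

theory Defs
  imports "HOL-Probability.Probability"
begin

section \<open>Stochastic convergence\<close>

text \<open>Not every event below has to be measurable (for instance
  \<open>nrm (\<gamma> \<omega> - \<gamma>0) < \<epsilon>\<close> for an arbitrary norm, or events about Jacobians at random points),
  and the measure of a non-measurable set is \<open>0\<close> by convention.  Probability statements are
  therefore about inner probabilities of good events; they agree with the usual ones on
  measurable events, see \<open>wpa1_iff\<close> and \<open>tends_in_prob_iff_dist\<close>.\<close>

definition wpa1 :: "'o measure \<Rightarrow> (nat \<Rightarrow> 'o \<Rightarrow> bool) \<Rightarrow> bool" where
  "wpa1 M P \<longleftrightarrow>
     (\<exists>A. (\<forall>n. A n \<in> sets M \<and> (\<forall>\<omega>\<in>A n. P n \<omega>)) \<and> (\<lambda>n. measure M (A n)) \<longlonglongrightarrow> 1)"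

text \<open>Convergence in probability to a constant.  The formulation with open sets also covers
  \<^typ>\<open>ennreal\<close>-valued integrals.\<close>

definition tends_in_prob ::
    "'o measure \<Rightarrow> (nat \<Rightarrow> 'o \<Rightarrow> 'b::topological_space) \<Rightarrow> 'b \<Rightarrow> bool" where
  "tends_in_prob M X c \<longleftrightarrow> (\<forall>S. open S \<longrightarrow> c \<in> S \<longrightarrow> wpa1 M (\<lambda>n \<omega>. X n \<omega> \<in> S))"

lemma wpa1_mono:
  assumes "wpa1 M P" and "\<And>n \<omega>. P n \<omega> \<Longrightarrow> Q n \<omega>"
  shows "wpa1 M Q"
  using assms unfolding wpa1_def by blast

lemma wpa1_iff:
  assumes "prob_space M" and "\<And>n. {\<omega>\<in>space M. P n \<omega>} \<in> sets M"
  shows "wpa1 M P \<longleftrightarrow> (\<lambda>n. measure M {\<omega>\<in>space M. P n \<omega>}) \<longlonglongrightarrow> 1"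
proof
  interpret prob_space M by fact
  assume "wpa1 M P"
  then obtain A where A: "\<And>n. A n \<in> sets M" "\<And>n \<omega>. \<omega> \<in> A n \<Longrightarrow> P n \<omega>"
    and lim: "(\<lambda>n. measure M (A n)) \<longlonglongrightarrow> 1"
    unfolding wpa1_def by blast
  have "A n \<subseteq> {\<omega>\<in>space M. P n \<omega>}" for n
    using A sets.sets_into_space by blast
  then have "measure M (A n) \<le> measure M {\<omega>\<in>space M. P n \<omega>}" for n
    by (intro finite_measure_mono assms)
  then show "(\<lambda>n. measure M {\<omega>\<in>space M. P n \<omega>}) \<longlonglongrightarrow> 1"
    by (intro tendsto_sandwich[OF _ _ lim tendsto_const]) auto
next
  assume "(\<lambda>n. measure M {\<omega>\<in>space M. P n \<omega>}) \<longlonglongrightarrow> 1"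
  then show "wpa1 M P"
    unfolding wpa1_def using assms(2) by (intro exI[of _ "\<lambda>n. {\<omega>\<in>space M. P n \<omega>}"]) auto
qed

lemma tends_in_prob_iff_dist:
  fixes c :: "'b::metric_space"
  shows "tends_in_prob M X c \<longleftrightarrow> (\<forall>\<epsilon>>0. wpa1 M (\<lambda>n \<omega>. dist (X n \<omega>) c < \<epsilon>))"
proof
  assume L: "tends_in_prob M X c"
  show "\<forall>\<epsilon>>0. wpa1 M (\<lambda>n \<omega>. dist (X n \<omega>) c < \<epsilon>)"
  proof (intro allI impI)
    fix \<epsilon> :: real assume "\<epsilon> > 0"
    then have "wpa1 M (\<lambda>n \<omega>. X n \<omega> \<in> ball c \<epsilon>)"
      by (intro L[unfolded tends_in_prob_def, rule_format]) auto
    then show "wpa1 M (\<lambda>n \<omega>. dist (X n \<omega>) c < \<epsilon>)"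
      by (rule wpa1_mono) (simp add: dist_commute)
  qed
next
  assume R: "\<forall>\<epsilon>>0. wpa1 M (\<lambda>n \<omega>. dist (X n \<omega>) c < \<epsilon>)"
  show "tends_in_prob M X c"
    unfolding tends_in_prob_def
  proof (intro allI impI)
    fix S assume "open S" "c \<in> S"
    then obtain \<epsilon> where e: "\<epsilon> > 0" "\<And>y. dist y c < \<epsilon> \<Longrightarrow> y \<in> S"
      unfolding open_dist by blast
    then have "wpa1 M (\<lambda>n \<omega>. dist (X n \<omega>) c < \<epsilon>)" using R by blast
    then show "wpa1 M (\<lambda>n \<omega>. X n \<omega> \<in> S)" by (rule wpa1_mono) (rule e)
  qed
qed

definition converges_weakly ::
    "(nat \<Rightarrow> 'b::topological_space measure) \<Rightarrow> 'b measure \<Rightarrow> bool" where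
  "converges_weakly \<mu> N \<longleftrightarrow>
     (\<forall>f :: 'b \<Rightarrow> real. continuous_on UNIV f \<longrightarrow> bounded (range f) \<longrightarrow>
        (\<lambda>n. \<integral>x. f x \<partial>\<mu> n) \<longlonglongrightarrow> (\<integral>x. f x \<partial>N))"

section \<open>Normal laws, possibly degenerate\<close>

definition pos_semidef :: "real^'n^'n \<Rightarrow> bool" where
  "pos_semidef A \<longleftrightarrow> transpose A = A \<and> (\<forall>x. 0 \<le> x \<bullet> (A *v x))"

definition normal_law :: "real \<Rightarrow> real \<Rightarrow> real measure" where
  "normal_law m v =
     (if v = 0 then return borel m
      else density lborel (\<lambda>x. ennreal (normal_density m (sqrt v) x)))"

text \<open>\<open>N\<close> is the law \<open>N(m, V)\<close>: every linear functional is univariate normal.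
  By Cramer-Wold there is at most one such \<open>N\<close>.\<close>

definition is_multivariate_normal ::
    "(real^'n) measure \<Rightarrow> real^'n \<Rightarrow> real^'n^'n \<Rightarrow> bool" where
  "is_multivariate_normal N m V \<longleftrightarrow>
     prob_space N \<and> sets N = sets borel \<and> pos_semidef V \<and>
     (\<forall>t. distr N borel (\<lambda>x. t \<bullet> x) = normal_law (t \<bullet> m) (t \<bullet> (V *v t)))"

section \<open>First steps and influence functions\<close>

definition norm_on :: "'g::real_vector set \<Rightarrow> ('g \<Rightarrow> real) \<Rightarrow> bool" where
  "norm_on \<Gamma> nrm \<longleftrightarrow>
     (\<forall>x\<in>\<Gamma>. 0 \<le> nrm x \<and> (nrm x = 0 \<longleftrightarrow> x = 0)) \<and>
     (\<forall>x\<in>\<Gamma>. \<forall>c. nrm (c *\<^sub>R x) = \<bar>c\<bar> * nrm x) \<and>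
     (\<forall>x\<in>\<Gamma>. \<forall>y\<in>\<Gamma>. nrm (x + y) \<le> nrm x + nrm y)"

text \<open>\<open>F\<^sub>\<tau> = (1 - \<tau>) F + \<tau> H\<close>\<close>

definition mixture :: "'w measure \<Rightarrow> 'w measure \<Rightarrow> real \<Rightarrow> 'w measure" where
  "mixture F H \<tau> = measure_of (space F) (sets F)
     (\<lambda>A. ennreal (1 - \<tau>) * emeasure F A + ennreal \<tau> * emeasure H A)"

lemma emeasure_mixture:
  assumes "sets H = sets F" and "A \<in> sets F"
  shows "emeasure (mixture F H \<tau>) A = ennreal (1 - \<tau>) * emeasure F A + ennreal \<tau> * emeasure H A"
  unfolding mixture_def
proof (rule emeasure_measure_of_sigma)
  show "countably_additive (sets F)
    (\<lambda>A. ennreal (1 - \<tau>) * emeasure F A + ennreal \<tau> * emeasure H A)"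
  proof (rule countably_additiveI)
    fix B :: "nat \<Rightarrow> _" assume B: "range B \<subseteq> sets F" "disjoint_family B" "\<Union>(range B) \<in> sets F"
    have "range B \<subseteq> sets H" using B assms by simp
    then show "(\<Sum>i. ennreal (1 - \<tau>) * emeasure F (B i) + ennreal \<tau> * emeasure H (B i)) =
        ennreal (1 - \<tau>) * emeasure F (\<Union>(range B)) + ennreal \<tau> * emeasure H (\<Union>(range B))"
      using B by (subst suminf_add[symmetric]) (auto simp: suminf_emeasure)
  qed
qed (auto simp: positive_def assms sets.sigma_algebra_axioms)

text \<open>\<open>\<gamma>\<close> is the probability limit, in the norm \<open>nrm\<close>, of the first step estimator \<open>step\<close>
  computed from an i.i.d. sample of size \<open>n\<close> with distribution \<open>F\<close>.\<close>

definition first_step_plim ::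
    "'g::real_vector set \<Rightarrow> ('g \<Rightarrow> real) \<Rightarrow> (nat \<Rightarrow> (nat \<Rightarrow> 'w) \<Rightarrow> 'g) \<Rightarrow> 'w measure \<Rightarrow> 'g \<Rightarrow> bool" where
  "first_step_plim \<Gamma> nrm step F \<gamma> \<longleftrightarrow>
     \<gamma> \<in> \<Gamma> \<and> (\<forall>n. \<forall>x\<in>space (Pi\<^sub>M {1..n} (\<lambda>_. F)). step n x \<in> \<Gamma>) \<and>
     tends_in_prob (Pi\<^sub>M {1..} (\<lambda>_. F)) (\<lambda>n x. nrm (step n (restrict x {1..n}) - \<gamma>)) 0"

text \<open>\<open>\<phi>(\<cdot>, \<gamma>0, \<alpha>0, \<theta>)\<close> is the influence function of \<open>F \<mapsto> E[g(W, \<gamma>(F), \<theta>)]\<close> at \<open>F0\<close>.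
  \<open>\<gamma>lim\<close> is the map \<open>F \<mapsto> \<gamma>(F)\<close>, \<open>\<H>\<close> the class of alternatives \<open>H\<close> under consideration.\<close>

definition influence_function ::
    "'w measure \<Rightarrow> 'g::real_vector set \<Rightarrow> (real^'p) set \<Rightarrow> 'w measure set \<Rightarrow>
     (nat \<Rightarrow> (nat \<Rightarrow> 'w) \<Rightarrow> 'g) \<Rightarrow> ('w measure \<Rightarrow> 'g) \<Rightarrow>
     ('w \<Rightarrow> 'g \<Rightarrow> real^'p \<Rightarrow> real^'m) \<Rightarrow> ('w \<Rightarrow> 'g \<Rightarrow> 'a \<Rightarrow> real^'p \<Rightarrow> real^'m) \<Rightarrow>
     'g \<Rightarrow> 'a \<Rightarrow> bool" where
  "influence_function F0 \<Gamma> \<Theta> \<H> step \<gamma>lim g \<phi> \<gamma>0 \<alpha>0 \<longleftrightarrow>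
     \<gamma>lim F0 = \<gamma>0 \<and>
     (\<forall>H\<in>\<H>. prob_space H \<and> sets H = sets F0) \<and>
     (\<exists>nrm. norm_on \<Gamma> nrm \<and> first_step_plim \<Gamma> nrm step F0 \<gamma>0 \<and>
        (\<forall>H\<in>\<H>. \<forall>\<^sub>F \<tau> in at_right 0.
           first_step_plim \<Gamma> nrm step (mixture F0 H \<tau>) (\<gamma>lim (mixture F0 H \<tau>)))) \<and>
     (\<forall>\<theta>\<in>\<Theta>. has_bochner_integral F0 (\<lambda>w. \<phi> w \<gamma>0 \<alpha>0 \<theta>) 0) \<and>
     (\<forall>\<theta>\<in>\<Theta>. \<forall>H\<in>\<H>.
        integrable H (\<lambda>w. \<phi> w \<gamma>0 \<alpha>0 \<theta>) \<and>
        (\<forall>\<^sub>F \<tau> in at 0 within {0..1}. integrable F0 (\<lambda>w. g w (\<gamma>lim (mixture F0 H \<tau>)) \<theta>)) \<and>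
        integrable F0 (\<lambda>w. g w \<gamma>0 \<theta>) \<and>
        ((\<lambda>\<tau>. \<integral>w. g w (\<gamma>lim (mixture F0 H \<tau>)) \<theta> \<partial>F0)
           has_vector_derivative (\<integral>w. \<phi> w \<gamma>0 \<alpha>0 \<theta> \<partial>H)) (at 0 within {0..1}))"

section \<open>Estimators\<close>

text \<open>The random element \<open>X\<close> is a (measurable) function of the observations with index in \<open>J\<close>.\<close>

definition uses_only ::
    "'o measure \<Rightarrow> 'w measure \<Rightarrow> (nat \<Rightarrow> 'o \<Rightarrow> 'w) \<Rightarrow> nat set \<Rightarrow> ('o \<Rightarrow> 'b) \<Rightarrow> 'b measure \<Rightarrow> bool" where
  "uses_only M F0 W J X B \<longleftrightarrow>
     (\<exists>f \<in> Pi\<^sub>M J (\<lambda>_. F0) \<rightarrow>\<^sub>M B. \<forall>\<omega>\<in>space M. X \<omega> = f (\<lambda>i\<in>J. W i \<omega>))"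

definition outer_square :: "real^'m \<Rightarrow> real^'m^'m" where
  "outer_square v = (\<chi> i j. v $ i * v $ j)"

text \<open>The asymptotic variance of GMM with Jacobian \<open>G\<close>, weighting matrix \<open>\<Upsilon>\<close> and moment
  variance \<open>\<Psi>\<close>.\<close>

definition gmm_variance :: "real^'p^'m \<Rightarrow> real^'m^'m \<Rightarrow> real^'m^'m \<Rightarrow> real^'p^'p" where
  "gmm_variance G \<Upsilon> \<Psi> =
     matrix_inv (transpose G ** \<Upsilon> ** G) ** transpose G ** \<Upsilon> ** \<Psi> ** \<Upsilon> ** G **
     matrix_inv (transpose G ** \<Upsilon> ** G)"

end

(*
The expansion of the moments. On a fold, the cross-fitted moment minus the moment at the true
values splits into three remainders, each varying one first step, and the interaction Delta. The
first steps do not depend on the fold, so given the other observations the centered remainders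
are sums of independent mean zero terms, and after division by sqrt n their conditional variances
are at most the mean squares in Assumption 1, which vanish. The means of the remainders vanish by
Neyman orthogonality and Assumption 3. Hence sqrt n times the moment at theta_0 is a normalized
i.i.d. sum up to o_p(1).

The estimator. The first-order condition and a mean value expansion, both controlled by the
Hoelder bound on the Jacobian, express sqrt n (theta_hat - theta_0) as a matrix converging in
probability times that sum. The multivariate central limit theorem comes from the univariate one:
the cosines of affine functions span an algebra, so by Stone-Weierstrass their expectations
determine weak limits of tight sequences.

Measurability. The events defined by the norm on first steps need not be measurable, so
conditional arguments only use measurable functions of the first steps, and those events enter
through inner probabilities. The condition that all pairs (W_i, gamma), i <= n, lie in D with
probability tending to 1 forces F_0-almost every w to have (w, gamma) in D.
*)
theory Submission
  imports Defs
begin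

section \<open>Calculus of convergence in probability\<close>

text \<open>The assumptions bound random mean squares in probability only, whereas Markov's
  inequality asks for bounds in expectation. So every fold estimate sets its summands to 0 when the
  integral controlling them exceeds a level \<open>c\<close>. This event is determined by the other
  observations alone, hence centering given them survives, and undoing the truncation costs only
  vanishing probability. No conditional expectation is formed: one observation and those outside its
  fold have a product law, and the theorems of Fubini and Tonelli replace conditioning. The same
  product law lets a statement about \<open>F0\<close>-almost every w, valid for each fixed first
  step near the truth, be applied at the random first step.

  A vector valued map has no single intermediate point in the mean value theorem. A rank one
  correction of the Jacobian yields one matrix that makes the expansion exact; it is merely chosen
  for each sample point, which inner probabilities tolerate.

  The limiting variance may be singular, so the normal law cannot be given by a density. It is
  constructed for every positive semidefinite matrix.\<close>

definition bounded_in_prob :: "'o measure \<Rightarrow> (nat \<Rightarrow> 'o \<Rightarrow> 'b::real_normed_vector) \<Rightarrow> bool" where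
  "bounded_in_prob M X \<longleftrightarrow> (\<forall>\<epsilon>>0. \<exists>B A. (\<forall>n. A n \<in> sets M \<and> (\<forall>\<omega>\<in>A n. norm (X n \<omega>) \<le> B)) \<and>
     (\<forall>\<^sub>F n in sequentially. 1 - \<epsilon> \<le> measure M (A n)))"

context prob_space
begin

lemma prob_Int_ge:
  assumes "A \<in> events" "B \<in> events"
  shows "prob A + prob B - 1 \<le> prob (A \<inter> B)"
proof -
  have "prob (A \<union> B) = prob A + prob B - prob (A \<inter> B)"
    using assms by (intro measure_Un3) (auto simp: fmeasurable_eq_sets)
  then show ?thesis using prob_le_1[of "A \<union> B"] by linarith
qed

text \<open>The given events may change with \<open>\<epsilon>\<close>. A single sequence arises by
  choosing, for every n, a good event whose probability is within 1/(n+1) of the supremum over all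
  good events, since this supremum dominates each given witness.\<close>

lemma wpa1_epsI:
  assumes "\<And>\<epsilon>. \<epsilon> > 0 \<Longrightarrow> \<exists>A. (\<forall>n. A n \<in> sets M \<and> (\<forall>\<omega>\<in>A n. P n \<omega>)) \<and>
     (\<forall>\<^sub>F n in sequentially. 1 - \<epsilon> \<le> measure M (A n))"
  shows "wpa1 M P"
proof -
  define good where "good n = {A\<in>sets M. \<forall>\<omega>\<in>A. P n \<omega>}" for n
  define p where "p n = (SUP A\<in>good n. prob A)" for n
  have ne: "good n \<noteq> {}" for n
    by (auto simp: good_def intro!: exI[of _ "{}"])
  have bdd: "bdd_above (prob ` good n)" for n
    by (auto intro!: bdd_aboveI[of _ 1])
  have "\<exists>A\<in>good n. p n - 1 / real (Suc n) < prob A" for n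
  proof -
    have "p n - 1 / real (Suc n) < (SUP A\<in>good n. prob A)" by (simp add: p_def)
    then show ?thesis using less_cSUP_iff[OF ne bdd] by blast
  qed
  then obtain A where A: "\<And>n. A n \<in> good n" "\<And>n. p n - 1 / real (Suc n) < prob (A n)"
    by metis
  have "(\<lambda>n. prob (A n)) \<longlonglongrightarrow> 1"
  proof (rule metric_LIMSEQ_I)
    fix e :: real assume e: "e > 0"
    obtain B where B: "\<And>n. B n \<in> sets M \<and> (\<forall>\<omega>\<in>B n. P n \<omega>)"
      and ev: "\<forall>\<^sub>F n in sequentially. 1 - e/2 \<le> prob (B n)"
      using assms[of "e/2"] e by auto
    have ev2: "\<forall>\<^sub>F n in sequentially. 1 / real (Suc n) < e/2"
      using e by (intro order_tendstoD[OF LIMSEQ_Suc[OF lim_1_over_n]]) auto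
    have "\<forall>\<^sub>F n in sequentially. dist (prob (A n)) 1 < e"
      using ev ev2
    proof eventually_elim
      case (elim n)
      have "prob (B n) \<le> p n"
        unfolding p_def using B bdd by (intro cSUP_upper) (auto simp: good_def)
      then show ?case using elim A(2)[of n] prob_le_1[of "A n"] by (simp add: dist_real_def)
    qed
    then show "\<exists>no. \<forall>n\<ge>no. dist (prob (A n)) 1 < e"
      by (simp add: eventually_sequentially)
  qed
  then show ?thesis unfolding wpa1_def using A(1) by (auto simp: good_def)
qed

lemma wpa1_mp2:
  assumes "wpa1 M P" "wpa1 M Q"
    and "\<forall>\<^sub>F n in sequentially. \<forall>\<omega>\<in>space M. P n \<omega> \<longrightarrow> Q n \<omega> \<longrightarrow> R n \<omega>"
  shows "wpa1 M R"
proof -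
  obtain A where A: "\<And>n. A n \<in> sets M" "\<And>n \<omega>. \<omega> \<in> A n \<Longrightarrow> P n \<omega>" "(\<lambda>n. prob (A n)) \<longlonglongrightarrow> 1"
    using assms(1) unfolding wpa1_def by blast
  obtain B where B: "\<And>n. B n \<in> sets M" "\<And>n \<omega>. \<omega> \<in> B n \<Longrightarrow> Q n \<omega>" "(\<lambda>n. prob (B n)) \<longlonglongrightarrow> 1"
    using assms(2) unfolding wpa1_def by blast
  define ok where "ok n \<longleftrightarrow> (\<forall>\<omega>\<in>space M. P n \<omega> \<longrightarrow> Q n \<omega> \<longrightarrow> R n \<omega>)" for n
  \<comment> \<open>Where the implication fails, the empty event serves as a vacuous witness; this
    concerns finitely many n and leaves the limit unchanged.\<close>
  define C where "C n = (if ok n then A n \<inter> B n else {})" for n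
  note le = prob_Int_ge[OF A(1) B(1)]
  have "(\<lambda>n. prob (A n \<inter> B n)) \<longlonglongrightarrow> 1"
    by (rule tendsto_sandwich[OF _ _ _ tendsto_const, where f = "\<lambda>n. prob (A n) + prob (B n) - 1"])
       (use le in \<open>auto intro!: tendsto_eq_intros A(3) B(3)\<close>)
  moreover have "\<forall>\<^sub>F n in sequentially. prob (A n \<inter> B n) = prob (C n)"
    using assms(3) by eventually_elim (auto simp: C_def ok_def)
  ultimately have "(\<lambda>n. prob (C n)) \<longlonglongrightarrow> 1"
    by (rule Lim_transform_eventually)
  moreover have "C n \<in> sets M \<and> (\<forall>\<omega>\<in>C n. R n \<omega>)" for n
  proof (cases "ok n")
    case True
    have "R n \<omega>" if "\<omega> \<in> A n \<inter> B n" for \<omega>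
      using True that A(2)[of \<omega> n] B(2)[of \<omega> n] sets.sets_into_space[OF A(1)]
      unfolding ok_def by blast
    then show ?thesis using A(1) B(1) True by (simp add: C_def)
  qed (simp add: C_def)
  ultimately show ?thesis unfolding wpa1_def by blast
qed

lemma wpa1_conj: "wpa1 M P \<Longrightarrow> wpa1 M Q \<Longrightarrow> wpa1 M (\<lambda>n \<omega>. P n \<omega> \<and> Q n \<omega>)"
  by (erule (1) wpa1_mp2) auto

lemma wpa1_mp:
  "wpa1 M P \<Longrightarrow> \<forall>\<^sub>F n in sequentially. \<forall>\<omega>\<in>space M. P n \<omega> \<longrightarrow> Q n \<omega> \<Longrightarrow> wpa1 M Q"
  by (rule wpa1_mp2[of P P]) auto

lemma wpa1_space_mono:
  "wpa1 M P \<Longrightarrow> (\<And>n \<omega>. \<omega> \<in> space M \<Longrightarrow> P n \<omega> \<Longrightarrow> Q n \<omega>) \<Longrightarrow> wpa1 M Q"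
  by (rule wpa1_mp) auto

lemma wpa1_always: "(\<And>n \<omega>. \<omega> \<in> space M \<Longrightarrow> P n \<omega>) \<Longrightarrow> wpa1 M P"
  unfolding wpa1_def by (intro exI[of _ "\<lambda>_. space M"]) (simp add: prob_space)

lemma wpa1_ball:
  assumes "finite S" "\<And>i. i \<in> S \<Longrightarrow> wpa1 M (P i)"
  shows "wpa1 M (\<lambda>n \<omega>. \<forall>i\<in>S. P i n \<omega>)"
  using assms
proof (induction S)
  case empty
  show ?case by (rule wpa1_always) simp
next
  case (insert x F)
  then show ?case using wpa1_conj[of "P x" "\<lambda>n \<omega>. \<forall>i\<in>F. P i n \<omega>"] by simp
qed

text \<open>An almost sure event need not be measurable, but its failure is covered by a measurable
  null set, whose complement is the required witness.\<close>

lemma wpa1_AE: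
  assumes "\<forall>\<^sub>F n in sequentially. AE \<omega> in M. P n \<omega>"
  shows "wpa1 M P"
proof -
  have "\<exists>A\<in>sets M. (\<forall>\<omega>\<in>A. P n \<omega>) \<and> ((AE \<omega> in M. P n \<omega>) \<longrightarrow> prob A = 1)" for n
  proof (cases "AE \<omega> in M. P n \<omega>")
    case True
    then obtain N where N: "{\<omega>\<in>space M. \<not> P n \<omega>} \<subseteq> N" "N \<in> null_sets M"
      using AE_E3 by (metis (no_types, lifting) Diff_iff mem_Collect_eq subsetI)
    then have "prob (space M - N) = 1"
      by (subst prob_compl) (auto simp: null_sets_def measure_def)
    then show ?thesis using N by (intro bexI[of _ "space M - N"]) auto
  qed (auto intro: bexI[of _ "{}"])
  then obtain A where A: "\<And>n. A n \<in> sets M" "\<And>n \<omega>. \<omega> \<in> A n \<Longrightarrow> P n \<omega>"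
    "\<And>n. (AE \<omega> in M. P n \<omega>) \<Longrightarrow> prob (A n) = 1" by metis
  have "(\<lambda>n. prob (A n)) \<longlonglongrightarrow> 1"
    by (rule tendsto_eventually) (use assms A(3) in \<open>auto elim: eventually_mono\<close>)
  then show ?thesis using A(1,2) unfolding wpa1_def by blast
qed

text \<open>Extracts an actual sample point. This is how a closed algebraic property of the
  weighting matrices reaches their limit.\<close>

lemma wpa1_ex:
  assumes "wpa1 M P" shows "\<exists>n. \<exists>\<omega>\<in>space M. P n \<omega>"
proof -
  obtain A where A: "\<And>n. A n \<in> sets M" "\<And>n \<omega>. \<omega> \<in> A n \<Longrightarrow> P n \<omega>" "(\<lambda>n. prob (A n)) \<longlonglongrightarrow> 1"
    using assms unfolding wpa1_def by blast
  have "\<forall>\<^sub>F n in sequentially. 0 < prob (A n)"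
    using order_tendstoD(1)[OF A(3), of 0] by simp
  then obtain n where "0 < prob (A n)" by (auto simp: eventually_sequentially)
  then have "A n \<noteq> {}" by auto
  then show ?thesis using A(1,2) sets.sets_into_space by blast
qed

lemma tends_in_prob_iff_norm:
  fixes c :: "'b::real_normed_vector"
  shows "tends_in_prob M X c \<longleftrightarrow> (\<forall>\<epsilon>>0. wpa1 M (\<lambda>n \<omega>. norm (X n \<omega> - c) < \<epsilon>))"
  by (simp add: tends_in_prob_iff_dist dist_norm)

lemma tends_in_prob_squeeze:
  fixes X :: "nat \<Rightarrow> 'a \<Rightarrow> 'b::real_normed_vector" and Y :: "nat \<Rightarrow> 'a \<Rightarrow> real"
  assumes Y: "tends_in_prob M Y 0" and le: "wpa1 M (\<lambda>n \<omega>. norm (X n \<omega> - c) \<le> Y n \<omega>)"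
  shows "tends_in_prob M X c"
  unfolding tends_in_prob_iff_norm
proof (intro allI impI)
  fix \<epsilon> :: real assume "\<epsilon> > 0"
  then have "wpa1 M (\<lambda>n \<omega>. norm (Y n \<omega> - 0) < \<epsilon>)"
    using Y unfolding tends_in_prob_iff_norm by blast
  from wpa1_conj[OF this le] show "wpa1 M (\<lambda>n \<omega>. norm (X n \<omega> - c) < \<epsilon>)"
    by (rule wpa1_mono) auto
qed

lemma tends_in_prob_cong:
  fixes X :: "nat \<Rightarrow> 'a \<Rightarrow> 'b::topological_space"
  assumes "tends_in_prob M X c" "wpa1 M (\<lambda>n \<omega>. X n \<omega> = Y n \<omega>)"
  shows "tends_in_prob M Y c"
  unfolding tends_in_prob_def
proof (intro allI impI)
  fix S assume "open S" "c \<in> S"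
  with assms(1) have "wpa1 M (\<lambda>n \<omega>. X n \<omega> \<in> S)" unfolding tends_in_prob_def by blast
  from wpa1_conj[OF this assms(2)] show "wpa1 M (\<lambda>n \<omega>. Y n \<omega> \<in> S)"
    by (rule wpa1_mono) auto
qed

lemma tends_in_prob_isCont:
  fixes f :: "'b::t2_space \<Rightarrow> 'c::topological_space"
  assumes "tends_in_prob M X c" and f: "isCont f c"
  shows "tends_in_prob M (\<lambda>n \<omega>. f (X n \<omega>)) (f c)"
  unfolding tends_in_prob_def
proof (intro allI impI)
  fix S assume S: "open S" "f c \<in> S"
  obtain U where U: "open U" "c \<in> U" "\<And>x. x \<in> U \<Longrightarrow> f x \<in> S"
    using f[unfolded continuous_at_open, rule_format, of S] S by auto
  then have "wpa1 M (\<lambda>n \<omega>. X n \<omega> \<in> U)" using assms(1) unfolding tends_in_prob_def by blast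
  then show "wpa1 M (\<lambda>n \<omega>. f (X n \<omega>) \<in> S)" by (rule wpa1_mono) (rule U)
qed

lemma tends_in_prob_Pair:
  fixes X :: "nat \<Rightarrow> 'a \<Rightarrow> 'b::topological_space" and Y :: "nat \<Rightarrow> 'a \<Rightarrow> 'c::topological_space"
  assumes "tends_in_prob M X a" "tends_in_prob M Y b"
  shows "tends_in_prob M (\<lambda>n \<omega>. (X n \<omega>, Y n \<omega>)) (a, b)"
  unfolding tends_in_prob_def
proof (intro allI impI)
  fix S assume S: "open S" "(a, b) \<in> S"
  obtain U V where U: "open U" "open V" "(a, b) \<in> U \<times> V" "U \<times> V \<subseteq> S"
    using open_prod_elim[OF S] by blast
  have "wpa1 M (\<lambda>n \<omega>. X n \<omega> \<in> U)" "wpa1 M (\<lambda>n \<omega>. Y n \<omega> \<in> V)"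
    using assms U unfolding tends_in_prob_def by auto
  from wpa1_conj[OF this] show "wpa1 M (\<lambda>n \<omega>. (X n \<omega>, Y n \<omega>) \<in> S)"
    by (rule wpa1_mono) (use U in auto)
qed

lemma tends_in_prob_const: "tends_in_prob M (\<lambda>n \<omega>. c) c"
  unfolding tends_in_prob_def by (auto intro: wpa1_always)

lemma tends_in_prob_real_seq:
  fixes a :: "nat \<Rightarrow> 'b::topological_space"
  assumes "a \<longlonglongrightarrow> c" shows "tends_in_prob M (\<lambda>n \<omega>. a n) c"
  unfolding tends_in_prob_def
proof (intro allI impI)
  fix S assume "open S" "c \<in> S"
  then have "\<forall>\<^sub>F n in sequentially. a n \<in> S" using assms by (rule topological_tendstoD[rotated])
  then show "wpa1 M (\<lambda>n \<omega>. a n \<in> S)"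
    by (intro wpa1_AE) (auto elim: eventually_mono)
qed

lemma tends_in_prob_add:
  fixes X Y :: "nat \<Rightarrow> 'a \<Rightarrow> 'b::real_normed_vector"
  assumes "tends_in_prob M X a" "tends_in_prob M Y b"
  shows "tends_in_prob M (\<lambda>n \<omega>. X n \<omega> + Y n \<omega>) (a + b)"
  using tends_in_prob_isCont[OF tends_in_prob_Pair[OF assms], of "\<lambda>(x, y). x + y"]
  by (simp add: case_prod_beta')

lemma tends_in_prob_diff:
  fixes X Y :: "nat \<Rightarrow> 'a \<Rightarrow> 'b::real_normed_vector"
  assumes "tends_in_prob M X a" "tends_in_prob M Y b"
  shows "tends_in_prob M (\<lambda>n \<omega>. X n \<omega> - Y n \<omega>) (a - b)"
  using tends_in_prob_isCont[OF tends_in_prob_Pair[OF assms], of "\<lambda>(x, y). x - y"]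
  by (simp add: case_prod_beta')

lemma tends_in_prob_sum:
  fixes X :: "'i \<Rightarrow> nat \<Rightarrow> 'a \<Rightarrow> 'b::real_normed_vector"
  assumes "\<And>i. i \<in> S \<Longrightarrow> tends_in_prob M (X i) (c i)"
  shows "tends_in_prob M (\<lambda>n \<omega>. \<Sum>i\<in>S. X i n \<omega>) (\<Sum>i\<in>S. c i)"
  using assms
proof (induction S rule: infinite_finite_induct)
  case (insert x F)
  then show ?case using tends_in_prob_add[of "X x" "c x" "\<lambda>n \<omega>. \<Sum>i\<in>F. X i n \<omega>"] by simp
qed (simp_all add: tends_in_prob_const)

lemma tends_in_prob_sum_0:
  fixes X :: "'i \<Rightarrow> nat \<Rightarrow> 'a \<Rightarrow> 'b::real_normed_vector"
  assumes "\<And>i. i \<in> S \<Longrightarrow> tends_in_prob M (X i) 0"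
  shows "tends_in_prob M (\<lambda>n \<omega>. \<Sum>i\<in>S. X i n \<omega>) 0"
  using tends_in_prob_sum[of S X "\<lambda>_. 0"] assms by simp

lemma tends_in_prob_norm_iff:
  fixes X :: "nat \<Rightarrow> 'a \<Rightarrow> 'b::real_normed_vector"
  shows "tends_in_prob M (\<lambda>n \<omega>. norm (X n \<omega> - c)) 0 \<longleftrightarrow> tends_in_prob M X c"
  by (simp add: tends_in_prob_iff_norm)

text \<open>The rule that a stochastically bounded factor times a vanishing one vanishes; each
  factor receives half of the exceptional probability.\<close>

lemma bounded_in_prob_mult:
  fixes K Y :: "nat \<Rightarrow> 'a \<Rightarrow> real"
  assumes K: "bounded_in_prob M K" and Y: "tends_in_prob M Y 0"
  shows "tends_in_prob M (\<lambda>n \<omega>. K n \<omega> * Y n \<omega>) 0"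
  unfolding tends_in_prob_iff_norm
proof (intro allI impI wpa1_epsI)
  fix e d :: real assume e: "e > 0" and d: "d > 0"
  obtain B A where A: "\<And>n. A n \<in> sets M" "\<And>n \<omega>. \<omega> \<in> A n \<Longrightarrow> norm (K n \<omega>) \<le> B"
    and evA: "\<forall>\<^sub>F n in sequentially. 1 - d/2 \<le> prob (A n)"
    using K[unfolded bounded_in_prob_def, rule_format, of "d/2"] d by auto
  have "wpa1 M (\<lambda>n \<omega>. norm (Y n \<omega> - 0) < e / (\<bar>B\<bar> + 1))"
    using Y e unfolding tends_in_prob_iff_norm by auto
  then obtain C where C: "\<And>n. C n \<in> sets M" "\<And>n \<omega>. \<omega> \<in> C n \<Longrightarrow> \<bar>Y n \<omega>\<bar> < e / (\<bar>B\<bar> + 1)"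
    "(\<lambda>n. prob (C n)) \<longlonglongrightarrow> 1"
    unfolding wpa1_def by auto
  have evC: "\<forall>\<^sub>F n in sequentially. 1 - d/2 < prob (C n)"
    using d by (intro order_tendstoD[OF C(3)]) auto
  have "norm (K n \<omega> * Y n \<omega> - 0) < e" if "\<omega> \<in> A n \<inter> C n" for n \<omega>
  proof -
    have "\<bar>K n \<omega>\<bar> \<le> \<bar>B\<bar>" using A(2)[of \<omega> n] that by auto
    then have "\<bar>K n \<omega>\<bar> * \<bar>Y n \<omega>\<bar> \<le> \<bar>B\<bar> * \<bar>Y n \<omega>\<bar>" by (rule mult_right_mono) simp
    also have "\<dots> \<le> \<bar>B\<bar> * (e / (\<bar>B\<bar> + 1))"
      using C(2)[of \<omega> n] that by (intro mult_left_mono) auto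
    also have "\<dots> < e" using e by (simp add: field_simps)
    finally show ?thesis by (simp add: abs_mult)
  qed
  moreover have "\<forall>\<^sub>F n in sequentially. 1 - d \<le> prob (A n \<inter> C n)"
    using evA evC
  proof eventually_elim
    case (elim n)
    then show ?case using prob_Int_ge[OF A(1)[of n] C(1)[of n]] by linarith
  qed
  ultimately show "\<exists>A. (\<forall>n. A n \<in> sets M \<and> (\<forall>\<omega>\<in>A n. norm (K n \<omega> * Y n \<omega> - 0) < e)) \<and>
      (\<forall>\<^sub>F n in sequentially. 1 - d \<le> prob (A n))"
    using A(1) C(1) by (intro exI[of _ "\<lambda>n. A n \<inter> C n"]) auto
qed

text \<open>The level \<open>B\<close> is fixed by the boundedness of \<open>K\<close> before the
  second hypothesis is invoked, so the events there may depend on \<open>B\<close>.\<close>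

lemma bounded_in_prob_wpa1:
  assumes K: "bounded_in_prob M K"
    and Y: "\<And>B. wpa1 M (\<lambda>n \<omega>. norm (K n \<omega>) \<le> B \<longrightarrow> norm (Y n \<omega>) \<le> f B)"
  shows "bounded_in_prob M Y"
  unfolding bounded_in_prob_def
proof (intro allI impI)
  fix d :: real assume d: "d > 0"
  obtain B A where A: "\<And>n. A n \<in> sets M" "\<And>n \<omega>. \<omega> \<in> A n \<Longrightarrow> norm (K n \<omega>) \<le> B"
    and evA: "\<forall>\<^sub>F n in sequentially. 1 - d/2 \<le> prob (A n)"
    using K[unfolded bounded_in_prob_def, rule_format, of "d/2"] d by auto
  obtain C where C: "\<And>n. C n \<in> sets M" "\<And>n \<omega>. \<omega> \<in> C n \<Longrightarrow> norm (K n \<omega>) \<le> B \<longrightarrow> norm (Y n \<omega>) \<le> f B"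
    "(\<lambda>n. prob (C n)) \<longlonglongrightarrow> 1"
    using Y[of B] unfolding wpa1_def by auto
  have evC: "\<forall>\<^sub>F n in sequentially. 1 - d/2 < prob (C n)"
    using d by (intro order_tendstoD[OF C(3)]) auto
  have "\<forall>\<^sub>F n in sequentially. 1 - d \<le> prob (A n \<inter> C n)"
    using evA evC
  proof eventually_elim
    case (elim n)
    then show ?case using prob_Int_ge[OF A(1)[of n] C(1)[of n]] by linarith
  qed
  then show "\<exists>B A. (\<forall>n. A n \<in> sets M \<and> (\<forall>\<omega>\<in>A n. norm (Y n \<omega>) \<le> B)) \<and>
      (\<forall>\<^sub>F n in sequentially. 1 - d \<le> prob (A n))"
    using A(1,2) C(1,2) by (intro exI[of _ "f B"] exI[of _ "\<lambda>n. A n \<inter> C n"]) auto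
qed

lemma bounded_in_prob_0: "bounded_in_prob M (\<lambda>n \<omega>. 0)"
  unfolding bounded_in_prob_def
  by (intro allI impI exI[of _ 0] exI[of _ "\<lambda>_. space M"]) (auto simp: prob_space)

lemma tends_in_prob_bounded:
  fixes X :: "nat \<Rightarrow> 'a \<Rightarrow> 'b::real_normed_vector"
  assumes "tends_in_prob M X c"
  shows "bounded_in_prob M X"
proof (rule bounded_in_prob_wpa1[OF bounded_in_prob_0, where f = "\<lambda>_. norm c + 1"])
  have "wpa1 M (\<lambda>n \<omega>. norm (X n \<omega> - c) < 1)"
    using assms unfolding tends_in_prob_iff_norm by simp
  then show "wpa1 M (\<lambda>n \<omega>. norm (0::real) \<le> B \<longrightarrow> norm (X n \<omega>) \<le> norm c + 1)" for B
  proof (rule wpa1_mono, intro impI)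
    fix n \<omega> assume "norm (X n \<omega> - c) < 1"
    then show "norm (X n \<omega>) \<le> norm c + 1"
      using norm_triangle_sub[of "X n \<omega>" c] by linarith
  qed
qed

lemma bounded_in_prob_add:
  fixes X Y :: "nat \<Rightarrow> 'a \<Rightarrow> 'b::real_normed_vector"
  assumes X: "bounded_in_prob M X" and Y: "bounded_in_prob M Y"
  shows "bounded_in_prob M (\<lambda>n \<omega>. X n \<omega> + Y n \<omega>)"
  unfolding bounded_in_prob_def
proof (intro allI impI)
  fix d :: real assume d: "d > 0"
  obtain B A where A: "\<And>n. A n \<in> sets M" "\<And>n \<omega>. \<omega> \<in> A n \<Longrightarrow> norm (X n \<omega>) \<le> B"
    and evA: "\<forall>\<^sub>F n in sequentially. 1 - d/2 \<le> prob (A n)"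
    using X[unfolded bounded_in_prob_def, rule_format, of "d/2"] d by auto
  obtain B' C where C: "\<And>n. C n \<in> sets M" "\<And>n \<omega>. \<omega> \<in> C n \<Longrightarrow> norm (Y n \<omega>) \<le> B'"
    and evC: "\<forall>\<^sub>F n in sequentially. 1 - d/2 \<le> prob (C n)"
    using Y[unfolded bounded_in_prob_def, rule_format, of "d/2"] d by auto
  have "\<forall>\<^sub>F n in sequentially. 1 - d \<le> prob (A n \<inter> C n)"
    using evA evC
  proof eventually_elim
    case (elim n)
    then show ?case using prob_Int_ge[OF A(1)[of n] C(1)[of n]] by linarith
  qed
  moreover have "norm (X n \<omega> + Y n \<omega>) \<le> B + B'" if "\<omega> \<in> A n \<inter> C n" for n \<omega>
    using norm_triangle_ineq[of "X n \<omega>" "Y n \<omega>"] A(2)[of \<omega> n] C(2)[of \<omega> n] that by auto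
  ultimately show "\<exists>B A. (\<forall>n. A n \<in> sets M \<and> (\<forall>\<omega>\<in>A n. norm (X n \<omega> + Y n \<omega>) \<le> B)) \<and>
      (\<forall>\<^sub>F n in sequentially. 1 - d \<le> prob (A n))"
    using A(1) C(1) by (intro exI[of _ "B + B'"] exI[of _ "\<lambda>n. A n \<inter> C n"]) auto
qed

lemma bounded_in_prob_sum:
  fixes X :: "'i \<Rightarrow> nat \<Rightarrow> 'a \<Rightarrow> 'b::real_normed_vector"
  assumes "\<And>i. i \<in> S \<Longrightarrow> bounded_in_prob M (X i)"
  shows "bounded_in_prob M (\<lambda>n \<omega>. \<Sum>i\<in>S. X i n \<omega>)"
  using assms
proof (induction S rule: infinite_finite_induct)
  case (insert x F)
  then show ?case using bounded_in_prob_add[of "X x" "\<lambda>n \<omega>. \<Sum>i\<in>F. X i n \<omega>"] by simp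
qed (simp_all add: bounded_in_prob_0)

end

section \<open>Gaussian laws and the Cramer-Wold device\<close>

text \<open>The norm of a matrix type is the Frobenius norm, and its sum of squares factors for a
  product of a column and a row.\<close>

lemma norm_rank_one: "norm ((\<chi> i j. x $ i * y $ j) :: real^'n^'m) = norm x * norm y"
proof -
  have row: "((\<chi> i j. x $ i * y $ j) :: real^'n^'m) $ i = x $ i *\<^sub>R y" for i
    by (simp add: vec_eq_iff)
  have "norm ((\<chi> i j. x $ i * y $ j) :: real^'n^'m) = L2_set (\<lambda>i. norm (x $ i) * norm y) UNIV"
    unfolding norm_vec_def[of "(\<chi> i j. x $ i * y $ j) :: real^'n^'m"] row by simp
  also have "\<dots> = norm x * norm y"
    unfolding norm_vec_def[of x] by (rule L2_set_left_distrib[symmetric]) simp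
  finally show ?thesis .
qed

lemma outer_square_mult: "outer_square v *v x = (v \<bullet> x) *\<^sub>R v"
  by (simp add: outer_square_def matrix_vector_mult_def inner_vec_def vec_eq_iff sum_distrib_left mult_ac)

text \<open>As an affine image of the standard normal law, the degenerate case \<open>v = 0\<close>
  is on the same footing as the others, so characteristic functions need no case
  distinction.\<close>

lemma normal_law_eq_distr:
  assumes "v \<ge> 0"
  shows "normal_law m v = distr std_normal_distribution borel (\<lambda>x. m + sqrt v * x)"
proof (cases "v = 0")
  case True
  interpret prob_space std_normal_distribution by (rule prob_space_normal_density) simp
  show ?thesis using True by (simp add: normal_law_def distr_const)
next
  case False
  interpret prob_space std_normal_distribution by (rule prob_space_normal_density) simp
  have "distributed std_normal_distribution lborel (\<lambda>x. x) (\<lambda>x. ennreal (std_normal_density x))"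
    unfolding distributed_def by (auto simp: distr_id2)
  from normal_density_affine[OF this, of "sqrt v" m]
  have "distributed std_normal_distribution lborel (\<lambda>x. m + sqrt v * x)
      (\<lambda>x. ennreal (normal_density m (sqrt v) x))"
    using False assms by simp
  then have "distr std_normal_distribution lborel (\<lambda>x. m + sqrt v * x)
      = density lborel (\<lambda>x. ennreal (normal_density m (sqrt v) x))"
    by (simp add: distributed_def)
  then show ?thesis
    using False by (simp add: normal_law_def cong: distr_cong)
qed

lemma real_distribution_normal_law: "v \<ge> 0 \<Longrightarrow> real_distribution (normal_law m v)"
proof -
  assume v: "v \<ge> 0"
  interpret prob_space std_normal_distribution by (rule prob_space_normal_density) simp
  have "prob_space (normal_law m v)"
    unfolding normal_law_eq_distr[OF v] by (rule prob_space_distr) simp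
  then show ?thesis
    unfolding real_distribution_def real_distribution_axioms_def
    by (simp add: normal_law_eq_distr[OF v])
qed

lemma char_normal_law:
  assumes v: "v \<ge> 0"
  shows "char (normal_law 0 v) s = complex_of_real (exp (- (v * s\<^sup>2) / 2))"
proof -
  have "char (normal_law 0 v) s = char std_normal_distribution (s * sqrt v)"
    unfolding char_def normal_law_eq_distr[OF v]
    by (subst integral_distr) (auto simp: mult_ac)
  then show ?thesis using v
    by (simp add: char_std_normal_distribution power_mult_distrib mult_ac)
qed

lemma char_affine_normal:
  "char (distr std_normal_distribution borel (\<lambda>x. c * x)) s = complex_of_real (exp (- (c\<^sup>2 * s\<^sup>2) / 2))"
proof -
  have "char (distr std_normal_distribution borel (\<lambda>x. c * x)) s = char std_normal_distribution (s * c)"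
    unfolding char_def by (subst integral_distr) (auto simp: mult_ac)
  then show ?thesis by (simp add: char_std_normal_distribution power_mult_distrib mult_ac)
qed

lemma pos_semidef_Cauchy_Schwarz:
  fixes V :: "real^'n^'n"
  assumes V: "pos_semidef V"
  shows "(x \<bullet> (V *v y))\<^sup>2 \<le> (x \<bullet> (V *v x)) * (y \<bullet> (V *v y))"
proof -
  have sym: "y \<bullet> (V *v x) = x \<bullet> (V *v y)"
    using V unfolding pos_semidef_def
    by (metis dot_lmul_matrix inner_commute transpose_matrix_vector)
  have pos: "0 \<le> z \<bullet> (V *v z)" for z using V by (simp add: pos_semidef_def)
  define a b c where "a = x \<bullet> (V *v x)" and "b = x \<bullet> (V *v y)" and "c = y \<bullet> (V *v y)"
  have q: "0 \<le> a + 2 * t * b + t\<^sup>2 * c" for t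
    using pos[of "x + t *\<^sub>R y"] sym
    by (simp add: a_def b_def c_def matrix_vector_right_distrib matrix_vector_mult_scaleR
        inner_add_left inner_add_right power2_eq_square algebra_simps)
  have "b\<^sup>2 \<le> a * c"
  proof (cases "c = 0")
    case True
    \<comment> \<open>Here \<open>q\<close> is affine in t and nonnegative on the whole line, which
      forces its slope to vanish: the chosen t would give it the value -1. If c is positive, the
      minimizer -b/c is inserted instead.\<close>
    have "b = 0"
    proof (rule ccontr)
      assume "b \<noteq> 0"
      then show False using q[of "- (a + 1) / (2 * b)"] True by (simp add: field_simps)
    qed
    then show ?thesis using True by simp
  next
    case False
    then have c: "c > 0" using pos[of y] by (simp add: c_def)
    have "0 \<le> a - b\<^sup>2 / c"
      using q[of "- b / c"] c by (simp add: power2_eq_square field_simps)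
    then show ?thesis using c by (simp add: field_simps)
  qed
  then show ?thesis by (simp add: a_def b_def c_def)
qed

text \<open>Induction on the number of nonzero columns: subtracting the rank one part \<open>v v\<^sup>T\<close> that
  matches a nonzero column kills this column and creates no new one.  The law is then that of
  \<open>X + Z v\<close> with \<open>X\<close> Gaussian with the remaining variance and \<open>Z\<close> an independent standard normal.\<close>

lemma multivariate_normal_exists:
  fixes V :: "real^'n^'n"
  assumes "pos_semidef V"
  shows "\<exists>N. is_multivariate_normal N 0 V"
  using assms
proof (induction "card {i. V *v axis i 1 \<noteq> 0}" arbitrary: V rule: less_induct)
  case less
  show ?case
  proof (cases "\<exists>i. V *v axis i 1 \<noteq> 0")
    case False
    have V0: "V = 0"
      using False by (auto simp: matrix_vector_mult_basis column_def vec_eq_iff)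
    have "distr (return borel 0) borel (\<lambda>x. t \<bullet> x) = return borel 0" for t :: "real^'n"
      by (subst distr_return) auto
    then have "is_multivariate_normal (return borel 0) 0 V"
      using less.prems by (simp add: is_multivariate_normal_def V0 prob_space_return normal_law_def)
    then show ?thesis ..
  next
    case True
    then obtain i where i: "V *v axis i 1 \<noteq> 0" by blast
    define e :: "real^'n" where "e = axis i 1"
    define q where "q = e \<bullet> (V *v e)"
    have psd: "\<And>x. 0 \<le> x \<bullet> (V *v x)" and symV: "transpose V = V"
      using less.prems by (auto simp: pos_semidef_def)
    have sym: "x \<bullet> (V *v y) = y \<bullet> (V *v x)" for x y
      using symV by (metis dot_lmul_matrix inner_commute transpose_matrix_vector)
    \<comment> \<open>Cauchy-Schwarz between \<open>V *v e\<close> and \<open>e\<close> shows that a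
      zero diagonal entry makes its whole column vanish.\<close>
    have "q \<noteq> 0"
    proof
      assume "q = 0"
      then have "(V *v e) \<bullet> (V *v e) = 0"
        using pos_semidef_Cauchy_Schwarz[OF less.prems, of "V *v e" e] by (simp add: q_def)
      then show False using i by (simp add: e_def)
    qed
    then have q: "q > 0" using psd[of e] by (simp add: q_def)
    \<comment> \<open>The scaling makes \<open>(v \<bullet> e) *\<^sub>R v\<close> equal to
      \<open>V *v e\<close>, so that \<open>V'\<close> annihilates \<open>e\<close>.\<close>
    define v where "v = (1 / sqrt q) *\<^sub>R (V *v e)"
    define V' where "V' = V - outer_square v"
    have V'v: "V' *v x = V *v x - (v \<bullet> x) *\<^sub>R v" for x
      by (simp add: V'_def matrix_vector_mult_diff_rdistrib outer_square_mult)
    have vx: "v \<bullet> x = (x \<bullet> (V *v e)) / sqrt q" for x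
      by (simp add: v_def inner_commute)
    have quad: "x \<bullet> (V' *v x) = x \<bullet> (V *v x) - (v \<bullet> x)\<^sup>2" for x
      by (simp add: V'v inner_diff_right power2_eq_square inner_commute)
    have psd': "pos_semidef V'"
      unfolding pos_semidef_def
    proof (intro conjI allI)
      show "transpose V' = V'"
        using symV by (simp add: V'_def outer_square_def transpose_def vec_eq_iff mult.commute)
      fix x
      have "(v \<bullet> x)\<^sup>2 = (x \<bullet> (V *v e))\<^sup>2 / q"
        using q by (simp add: vx power_divide)
      also have "\<dots> \<le> ((x \<bullet> (V *v x)) * q) / q"
        using pos_semidef_Cauchy_Schwarz[OF less.prems, of x e] q
        by (intro divide_right_mono) (auto simp: q_def)
      finally show "0 \<le> x \<bullet> (V' *v x)" using q by (simp add: quad)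
    qed
    have "card {j. V' *v axis j 1 \<noteq> 0} < card {j. V *v axis j 1 \<noteq> 0}"
    proof (rule psubset_card_mono)
      have "V' *v e = 0"
        using q by (simp add: V'v vx q_def[symmetric] v_def[symmetric]) (simp add: v_def)
      moreover have "V' *v axis j 1 = 0" if "V *v axis j 1 = 0" for j
      proof -
        have "v \<bullet> axis j 1 = 0" using that sym[of "axis j 1" e] by (simp add: vx)
        then show ?thesis using that by (simp add: V'v)
      qed
      ultimately show "{j. V' *v axis j 1 \<noteq> 0} \<subset> {j. V *v axis j 1 \<noteq> 0}"
        using i by (auto simp: e_def)
    qed simp
    from less.hyps[OF this psd'] obtain N' where N': "is_multivariate_normal N' 0 V'" ..
    interpret N': prob_space N' using N' by (simp add: is_multivariate_normal_def)
    interpret Z: prob_space std_normal_distribution by (rule prob_space_normal_density) simp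
    interpret P: pair_prob_space N' std_normal_distribution ..
    have setsN'[measurable_cong]: "sets N' = sets borel" using N' by (simp add: is_multivariate_normal_def)
    define N where "N = distr (N' \<Otimes>\<^sub>M std_normal_distribution) borel (\<lambda>(x, z). x + z *\<^sub>R v)"
    have "distr N borel (\<lambda>x. t \<bullet> x) = normal_law 0 (t \<bullet> (V *v t))" for t
    proof (rule Levy_uniqueness)
      have N_eq: "distr N borel (\<lambda>x. t \<bullet> x) =
          distr (N' \<Otimes>\<^sub>M std_normal_distribution) borel (\<lambda>p. t \<bullet> fst p + (t \<bullet> v) * snd p)"
        unfolding N_def
        by (subst distr_distr) (auto simp: comp_def case_prod_beta' inner_add_right mult.commute)
      have "prob_space (distr N borel (\<lambda>x. t \<bullet> x))"
        unfolding N_eq by (rule P.prob_space_distr) simp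
      then show "real_distribution (distr N borel (\<lambda>x. t \<bullet> x))"
        by (simp add: real_distribution_def real_distribution_axioms_def)
      show "real_distribution (normal_law 0 (t \<bullet> (V *v t)))"
        by (rule real_distribution_normal_law[OF psd])
      show "char (distr N borel (\<lambda>x. t \<bullet> x)) = char (normal_law 0 (t \<bullet> (V *v t)))"
      proof
        fix s
        have f: "distr (N' \<Otimes>\<^sub>M std_normal_distribution) borel (\<lambda>p. t \<bullet> fst p)
            = normal_law 0 (t \<bullet> (V' *v t))"
        proof -
          have "distr (N' \<Otimes>\<^sub>M std_normal_distribution) borel (\<lambda>p. t \<bullet> fst p)
              = distr (distr (N' \<Otimes>\<^sub>M std_normal_distribution) N' fst) borel (\<lambda>x. t \<bullet> x)"
            by (subst distr_distr) (auto simp: comp_def)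
          also have "distr (N' \<Otimes>\<^sub>M std_normal_distribution) N' fst = N'"
            by (rule Z.distr_pair_fst)
          finally show ?thesis using N' by (simp add: is_multivariate_normal_def)
        qed
        have g: "distr (N' \<Otimes>\<^sub>M std_normal_distribution) borel (\<lambda>p. (t \<bullet> v) * snd p)
            = distr std_normal_distribution borel (\<lambda>x. (t \<bullet> v) * x)"
        proof -
          have "distr (N' \<Otimes>\<^sub>M std_normal_distribution) std_normal_distribution snd = std_normal_distribution"
          proof (rule measure_eqI)
            fix A assume "A \<in> sets (distr (N' \<Otimes>\<^sub>M std_normal_distribution) std_normal_distribution snd)"
            then have A: "A \<in> sets std_normal_distribution" by simp
            have "snd -` A \<inter> space (N' \<Otimes>\<^sub>M std_normal_distribution) = space N' \<times> A"
              using sets.sets_into_space[OF A] by (auto simp: space_pair_measure)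
            then show "emeasure (distr (N' \<Otimes>\<^sub>M std_normal_distribution) std_normal_distribution snd) A
                = emeasure std_normal_distribution A"
              using A by (simp add: emeasure_distr Z.emeasure_pair_measure_Times N'.emeasure_space_1)
          qed simp
          moreover have "distr (N' \<Otimes>\<^sub>M std_normal_distribution) borel (\<lambda>p. (t \<bullet> v) * snd p)
              = distr (distr (N' \<Otimes>\<^sub>M std_normal_distribution) std_normal_distribution snd) borel (\<lambda>x. (t \<bullet> v) * x)"
            by (subst distr_distr) (auto simp: comp_def)
          ultimately show ?thesis by simp
        qed
        have ind: "P.indep_var borel (\<lambda>p. t \<bullet> fst p) borel (\<lambda>p. (t \<bullet> v) * snd p)"
          unfolding P.indep_var_distribution_eq
        proof (intro conjI)
          show "distr (N' \<Otimes>\<^sub>M std_normal_distribution) borel (\<lambda>p. t \<bullet> fst p) \<Otimes>\<^sub>M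
              distr (N' \<Otimes>\<^sub>M std_normal_distribution) borel (\<lambda>p. (t \<bullet> v) * snd p)
            = distr (N' \<Otimes>\<^sub>M std_normal_distribution) (borel \<Otimes>\<^sub>M borel) (\<lambda>p. (t \<bullet> fst p, (t \<bullet> v) * snd p))"
          proof -
            have f': "distr (N' \<Otimes>\<^sub>M std_normal_distribution) borel (\<lambda>p. t \<bullet> fst p) = distr N' borel (\<lambda>x. t \<bullet> x)"
              using N' f by (simp add: is_multivariate_normal_def)
            have "prob_space (distr std_normal_distribution borel (\<lambda>x. (t \<bullet> v) * x))"
              by (rule Z.prob_space_distr) simp
            then interpret Q: prob_space "distr std_normal_distribution borel (\<lambda>x. (t \<bullet> v) * x)" .
            show ?thesis
              unfolding f' g using Q.sigma_finite_measure_axioms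
              by (subst pair_measure_distr) (auto simp: case_prod_beta')
          qed
        qed auto
        have "char (distr N borel (\<lambda>x. t \<bullet> x)) s
            = char (normal_law 0 (t \<bullet> (V' *v t))) s * char (distr std_normal_distribution borel (\<lambda>x. (t \<bullet> v) * x)) s"
          unfolding N_eq P.char_distr_add[OF ind] f g ..
        also have "\<dots> = complex_of_real (exp (- ((t \<bullet> (V' *v t)) * s\<^sup>2) / 2) * exp (- ((t \<bullet> v)\<^sup>2 * s\<^sup>2) / 2))"
          using psd' by (simp add: char_normal_law pos_semidef_def char_affine_normal)
        also have "exp (- ((t \<bullet> (V' *v t)) * s\<^sup>2) / 2) * exp (- ((t \<bullet> v)\<^sup>2 * s\<^sup>2) / 2)
            = exp (- ((t \<bullet> (V *v t)) * s\<^sup>2) / 2)"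
          by (simp add: exp_add[symmetric] quad inner_commute[of t v] field_simps)
        finally show "char (distr N borel (\<lambda>x. t \<bullet> x)) s = char (normal_law 0 (t \<bullet> (V *v t))) s"
          using psd by (simp add: char_normal_law)
      qed
    qed
    moreover have "prob_space N"
      unfolding N_def by (rule P.prob_space_distr) (simp add: case_prod_beta')
    ultimately have "is_multivariate_normal N 0 V"
      using less.prems by (simp add: is_multivariate_normal_def) (simp add: N_def)
    then show ?thesis ..
  qed
qed

section \<open>Trigonometric polynomials and weak convergence\<close>

text \<open>The phase \<open>b\<close> takes the place of sines. The span is closed under products
  by the product formula for cosines and contains the constants (\<open>t = 0\<close>), so it is an
  algebra.\<close>

inductive trig_poly :: "(real^'n \<Rightarrow> real) \<Rightarrow> bool" where
  cos: "trig_poly (\<lambda>x. a * cos (t \<bullet> x + b))"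
| add: "trig_poly f \<Longrightarrow> trig_poly g \<Longrightarrow> trig_poly (\<lambda>x. f x + g x)"

lemma trig_poly_const: "trig_poly (\<lambda>x. c)"
  using trig_poly.cos[of c 0 0] by simp

lemma trig_poly_mult:
  assumes "trig_poly f" "trig_poly g" shows "trig_poly (\<lambda>x. f x * g x)"
  using assms
proof (induction arbitrary: g)
  case (cos a t b)
  note g = \<open>trig_poly g\<close>
  from g show ?case
  proof induction
    case (cos c s d)
    have "a * cos (t \<bullet> x + b) * (c * cos (s \<bullet> x + d)) =
        (a * c / 2) * cos ((t - s) \<bullet> x + (b - d)) + (a * c / 2) * cos ((t + s) \<bullet> x + (b + d))" for x
    proof -
      have "cos (t \<bullet> x + b) * cos (s \<bullet> x + d) =
          (cos ((t - s) \<bullet> x + (b - d)) + cos ((t + s) \<bullet> x + (b + d))) / 2"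
        by (simp add: cos_times_cos inner_diff_left inner_add_left algebra_simps)
      then have "a * c * (cos (t \<bullet> x + b) * cos (s \<bullet> x + d)) =
          a * c * ((cos ((t - s) \<bullet> x + (b - d)) + cos ((t + s) \<bullet> x + (b + d))) / 2)" by simp
      then show ?thesis by (simp add: ring_distribs add_divide_distrib mult_ac)
    qed
    then show ?case by (simp only:) (intro trig_poly.intros)
  next
    case (add f g)
    then show ?case by (simp add: distrib_left trig_poly.add)
  qed
next
  case (add f g)
  then show ?case by (simp add: distrib_right trig_poly.add)
qed

lemma trig_poly_bounded: "trig_poly f \<Longrightarrow> \<exists>B. \<forall>x. \<bar>f x\<bar> \<le> B"
proof (induction rule: trig_poly.induct)
  case (cos a t b)
  have "\<bar>a * cos (t \<bullet> x + b)\<bar> \<le> \<bar>a\<bar>" for x by (simp add: abs_mult mult_left_le)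
  then show ?case by blast
next
  case (add f g)
  then obtain B C where "\<And>x. \<bar>f x\<bar> \<le> B" "\<And>x. \<bar>g x\<bar> \<le> C" by blast
  then have "\<bar>f x + g x\<bar> \<le> B + C" for x by (meson abs_triangle_ineq add_mono order_trans)
  then show ?case by blast
qed

lemma trig_poly_continuous: "trig_poly f \<Longrightarrow> continuous_on S f"
  by (induction rule: trig_poly.induct) (auto intro!: continuous_intros)

lemma trig_poly_compose:
  assumes p: "real_polynomial_function p" and f: "trig_poly f"
  shows "trig_poly (\<lambda>x. p (f x))"
  using p
proof (induction rule: real_polynomial_function.induct)
  case (linear h)
  have "h (f x) = h 1 * f x" for x
    using linear_simps(5)[OF linear, of "f x" 1] by simp
  then show ?case using trig_poly_mult[OF trig_poly_const f] by simp
qed (use trig_poly_const trig_poly.add trig_poly_mult in auto)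

text \<open>The second approximation, by a polynomial of the first one, is what keeps the trigonometric
  polynomial bounded off the ball.\<close>

lemma trig_poly_approx:
  fixes f :: "real^'n \<Rightarrow> real"
  assumes f: "continuous_on UNIV f" and B: "\<And>x. \<bar>f x\<bar> \<le> B" and e: "0 < e"
  obtains g where "trig_poly g" "\<And>x. x \<in> cball 0 K \<Longrightarrow> \<bar>f x - g x\<bar> < e" "\<And>x. \<bar>g x\<bar> \<le> B + e"
proof -
  have fK: "continuous_on (cball 0 K) f" using f continuous_on_subset by blast
  interpret function_ring_on "Collect trig_poly" "cball 0 K :: (real^'n) set"
  proof
    fix x y :: "real^'n" assume xy: "x \<in> cball 0 K" "y \<in> cball 0 K" "x \<noteq> y"
    \<comment> \<open>The scaling gives \<open>t \<bullet> (x - y) = 1\<close>: the phases at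
      \<open>x\<close> and \<open>y\<close> become 1 and 0, where the cosine takes different
      values.\<close>
    define t where "t = (1 / ((x - y) \<bullet> (x - y))) *\<^sub>R (x - y)"
    have "t \<bullet> x - t \<bullet> y = t \<bullet> (x - y)" by (rule inner_diff_right[symmetric])
    also have "\<dots> = 1" using xy(3) by (simp add: t_def)
    finally have "t \<bullet> x - t \<bullet> y = 1" .
    then have "cos (t \<bullet> x + (- (t \<bullet> y))) \<noteq> cos (t \<bullet> y + (- (t \<bullet> y)))"
      using cos_monotone_0_pi[of 0 1] pi_gt3 by simp
    then show "\<exists>f\<in>Collect trig_poly. f x \<noteq> f y"
      using trig_poly.cos[of 1 t "- (t \<bullet> y)"] by (intro bexI) auto
  qed (auto intro: trig_poly_continuous trig_poly.add trig_poly_mult trig_poly_const)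
  obtain h where h: "trig_poly h" "\<And>x. x \<in> cball 0 K \<Longrightarrow> \<bar>f x - h x\<bar> < e / 2"
    using Stone_Weierstrass_basic[OF fK, of "e / 2"] e by auto
  obtain C where C: "\<And>x. \<bar>h x\<bar> \<le> C" using trig_poly_bounded[OF h(1)] by blast
  have B0: "0 \<le> B" using B[of 0] by linarith
  \<comment> \<open>Cutting off at the bounds of \<open>f\<close> brings \<open>h x\<close> no
    farther from \<open>f x\<close>, and it is a continuous function of the single real number
    \<open>h x\<close>, which a polynomial approximates on the range of \<open>h\<close>.\<close>
  define clamp where "clamp y = max (- B) (min B y)" for y
  have "continuous_on {- C..C} clamp" unfolding clamp_def by (intro continuous_intros)
  then obtain p where p: "real_polynomial_function p" "\<And>y. y \<in> {- C..C} \<Longrightarrow> \<bar>clamp y - p y\<bar> < e / 2"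
    using Stone_Weierstrass_real_polynomial_function[of "{- C..C}" clamp "e / 2"] e
    by (auto simp: abs_minus_commute)
  show ?thesis
  proof (rule that[OF trig_poly_compose[OF p(1) h(1)]])
    fix x :: "real^'n"
    have hC: "h x \<in> {- C..C}" using C[of x] by auto
    have "\<bar>clamp (h x)\<bar> \<le> B" using B0 by (auto simp: clamp_def)
    then show "\<bar>p (h x)\<bar> \<le> B + e" using p(2)[OF hC] e by linarith
    assume x: "x \<in> cball 0 K"
    have "\<bar>f x - clamp (h x)\<bar> \<le> \<bar>f x - h x\<bar>"
      using B[of x] B0 by (auto simp: clamp_def min_def max_def)
    then show "\<bar>f x - p (h x)\<bar> < e" using p(2)[OF hC] h(2)[OF x] by linarith
  qed
qed

lemma (in prob_space) trig_poly_expectation_tends: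
  fixes X :: "nat \<Rightarrow> 'a \<Rightarrow> real^'n"
  assumes X[measurable]: "\<And>n. X n \<in> borel_measurable M" and N: "prob_space N" "sets N = sets borel"
    and cos: "\<And>t b. (\<lambda>n. \<integral>\<omega>. cos (t \<bullet> X n \<omega> + b) \<partial>M) \<longlonglongrightarrow> (\<integral>x. cos (t \<bullet> x + b) \<partial>N)"
    and h: "trig_poly h"
  shows "(\<lambda>n. \<integral>\<omega>. h (X n \<omega>) \<partial>M) \<longlonglongrightarrow> (\<integral>x. h x \<partial>N)"
  using h
proof (induction rule: trig_poly.induct)
  case (cos a t b)
  show ?case using assms(4)[of t b] by (simp add: tendsto_mult_left)
next
  case (add f g)
  interpret N: prob_space N by fact
  have "integrable M (\<lambda>\<omega>. p (X n \<omega>))" "integrable N p" if p: "trig_poly p" for p n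
  proof -
    obtain B where B: "\<And>x. \<bar>p x\<bar> \<le> B" using trig_poly_bounded[OF p] by blast
    have [measurable]: "p \<in> borel_measurable borel"
      by (rule borel_measurable_continuous_onI[OF trig_poly_continuous[OF p]])
    show "integrable M (\<lambda>\<omega>. p (X n \<omega>))" by (rule integrable_const_bound[of _ B]) (auto simp: B)
    show "integrable N p" by (rule N.integrable_const_bound[of _ B])
       (auto simp: B measurable_cong_sets[OF N(2) refl])
  qed
  then show ?case using add by (simp add: tendsto_add)
qed

text \<open>Tightness, and continuity of the measure \<open>N\<close> along growing balls, put all
  but \<open>e\<close> of the mass of \<open>N\<close> and of almost all the \<open>X n\<close> into
  one ball. There \<open>f\<close> is close to a trigonometric polynomial, whose expectations
  converge by hypothesis; off the ball only uniform bounds enter.\<close>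

lemma (in prob_space) converges_weakly_if_cos_converges:
  fixes X :: "nat \<Rightarrow> 'a \<Rightarrow> real^'n"
  assumes X[measurable]: "\<And>n. X n \<in> borel_measurable M" and N: "prob_space N" "sets N = sets borel"
    and cos: "\<And>t b. (\<lambda>n. \<integral>\<omega>. cos (t \<bullet> X n \<omega> + b) \<partial>M) \<longlonglongrightarrow> (\<integral>x. cos (t \<bullet> x + b) \<partial>N)"
    and tight: "bounded_in_prob M X"
  shows "converges_weakly (\<lambda>n. distr M borel (X n)) N"
  unfolding converges_weakly_def
proof (intro allI impI)
  fix f :: "real^'n \<Rightarrow> real" assume f: "continuous_on UNIV f" "bounded (range f)"
  interpret N: prob_space N by fact
  note [measurable_cong] = N(2)
  obtain B where B: "\<And>x. \<bar>f x\<bar> \<le> B" using f(2) unfolding bounded_iff by auto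
  then have B0: "0 \<le> B" using abs_ge_zero order_trans by blast
  have [measurable]: "f \<in> borel_measurable borel" using f(1) by (rule borel_measurable_continuous_onI)
  have intf: "integrable M (\<lambda>\<omega>. f (X n \<omega>))" "integrable N f" for n
    by (rule integrable_const_bound[of _ B] N.integrable_const_bound[of _ B]; simp add: B)+
  have "(\<lambda>n. \<integral>\<omega>. f (X n \<omega>) \<partial>M) \<longlonglongrightarrow> (\<integral>x. f x \<partial>N)"
  proof (rule metric_LIMSEQ_I)
    fix r :: real assume r: "r > 0"
    \<comment> \<open>Replacing \<open>f\<close> by \<open>g\<close> happens twice, under
      \<open>X n\<close> and under \<open>N\<close>, at a cost of at most
      \<open>e + (2 * B + 1) * e\<close> each; the quotient keeps the total below \<open>r\<close>.
      The cap at 1 turns the bound \<open>2 * B + e\<close> off the ball into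
      \<open>2 * B + 1\<close>.\<close>
    define e where "e = min 1 (r / (4 * (2 * B + 3)))"
    have e: "0 < e" "e \<le> 1" using r B0 by (auto simp: e_def)
    have re: "2 * (e + (2 * B + 1) * e) < r"
    proof -
      have "2 * (e + (2 * B + 1) * e) = 2 * (2 * B + 2) * e" by (simp add: algebra_simps)
      also have "\<dots> \<le> 2 * (2 * B + 2) * (r / (4 * (2 * B + 3)))"
        using B0 by (intro mult_left_mono) (auto simp: e_def)
      also have "\<dots> < r"
      proof -
        have "0 < r * 8 + B * (r * 4)" using r B0 by (intro add_pos_nonneg) auto
        then show ?thesis using r B0 by (simp add: field_simps)
      qed
      finally show ?thesis .
    qed
    obtain K1 A where A: "\<And>n. A n \<in> sets M" "\<And>n \<omega>. \<omega> \<in> A n \<Longrightarrow> norm (X n \<omega>) \<le> K1"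
      and evA: "\<forall>\<^sub>F n in sequentially. 1 - e \<le> prob (A n)"
      using tight[unfolded bounded_in_prob_def, rule_format, OF e(1)] by auto
    have "(\<lambda>k. measure N (cball 0 (real k))) \<longlonglongrightarrow> measure N (\<Union>k. cball 0 (real k))"
      by (rule N.finite_Lim_measure_incseq) (auto simp: incseq_def N(2))
    moreover have "(\<Union>k. cball 0 (real k)) = (UNIV :: (real^'n) set)"
      using real_arch_simple by (auto simp: dist_norm)
    moreover have spN: "space N = UNIV" using sets_eq_imp_space_eq[OF N(2)] by simp
    ultimately have "(\<lambda>k. measure N (cball 0 (real k))) \<longlonglongrightarrow> 1"
      using N.prob_space by simp
    from order_tendstoD(1)[OF this, of "1 - e"] e(1)
    obtain k where k: "1 - e < measure N (cball 0 (real k))" by (auto simp: eventually_sequentially)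
    define K where "K = max K1 (real k)"
    have NK: "1 - e \<le> measure N (cball 0 K)"
    proof -
      have "measure N (cball 0 (real k)) \<le> measure N (cball 0 K)"
        by (rule N.finite_measure_mono) (auto simp: K_def N(2))
      then show ?thesis using k by linarith
    qed
    obtain g where g: "trig_poly g" "\<And>x. x \<in> cball 0 K \<Longrightarrow> \<bar>f x - g x\<bar> < e" "\<And>x. \<bar>g x\<bar> \<le> B + e"
      using trig_poly_approx[OF f(1) B e(1)] by blast
    have [measurable]: "g \<in> borel_measurable borel"
      by (rule borel_measurable_continuous_onI[OF trig_poly_continuous[OF g(1)]])
    have intg: "integrable M (\<lambda>\<omega>. g (X n \<omega>))" "integrable N g" for n
      by (rule integrable_const_bound[of _ "B + e"] N.integrable_const_bound[of _ "B + e"]; simp add: g)+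
    have bd: "\<bar>f x - g x\<bar> \<le> e + (2 * B + 1) * indicator (- cball 0 K) x" for x
    proof (cases "x \<in> cball 0 K")
      case True
      then show ?thesis using g(2)[OF True] by simp
    next
      case False
      have "\<bar>f x - g x\<bar> \<le> B + (B + e)" using B[of x] g(3)[of x] by linarith
      then show ?thesis using False e by simp
    qed
    have close: "\<bar>(\<integral>x. f x \<partial>Q) - (\<integral>x. g x \<partial>Q)\<bar> \<le> e + (2 * B + 1) * e"
      if Q: "prob_space Q" "sets Q = sets borel" "1 - e \<le> measure Q (cball 0 K)"
        "integrable Q f" "integrable Q g" for Q
    proof -
      interpret Q: prob_space Q by fact
      have spQ: "space Q = UNIV" using sets_eq_imp_space_eq[OF Q(2)] by simp
      have "\<bar>(\<integral>x. f x \<partial>Q) - (\<integral>x. g x \<partial>Q)\<bar> \<le> (\<integral>x. \<bar>f x - g x\<bar> \<partial>Q)"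
        using integral_abs_bound[of Q "\<lambda>x. f x - g x"] Q(4,5) by simp
      also have "\<dots> \<le> (\<integral>x. e + (2 * B + 1) * indicator (- cball 0 K) x \<partial>Q)"
        using Q(2,4,5) bd by (intro integral_mono) (auto intro!: Bochner_Integration.integrable_add
          integrable_mult_right simp: Q.emeasure_eq_measure)
      also have "\<dots> = e + (2 * B + 1) * measure Q (- cball 0 K)"
        using Q(2) by (subst Bochner_Integration.integral_add)
          (use Q.prob_space in \<open>auto simp: Q.emeasure_eq_measure spQ intro!: integrable_mult_right\<close>)
      also have "measure Q (- cball 0 K) \<le> e"
        using Q.prob_compl[of "cball 0 K"] Q(2,3) by (simp add: spQ Compl_eq_Diff_UNIV)
      finally show ?thesis using B0 by (simp add: mult_left_mono)
    qed
    have cN: "\<bar>(\<integral>x. f x \<partial>N) - (\<integral>x. g x \<partial>N)\<bar> \<le> e + (2 * B + 1) * e"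
      by (rule close[OF N NK intf(2) intg(2)])
    have "(\<lambda>n. \<integral>\<omega>. g (X n \<omega>) \<partial>M) \<longlonglongrightarrow> (\<integral>x. g x \<partial>N)"
      by (rule trig_poly_expectation_tends[OF X N cos g(1)])
    then have "\<forall>\<^sub>F n in sequentially. dist (\<integral>\<omega>. g (X n \<omega>) \<partial>M) (\<integral>x. g x \<partial>N) < r - 2 * (e + (2 * B + 1) * e)"
      using re by (intro tendstoD) auto
    with evA have "\<forall>\<^sub>F n in sequentially. dist (\<integral>\<omega>. f (X n \<omega>) \<partial>M) (\<integral>x. f x \<partial>N) < r"
    proof eventually_elim
      case (elim n)
      have "prob (A n) \<le> measure (distr M borel (X n)) (cball 0 K)"
      proof -
        have "A n \<subseteq> X n -` cball 0 K \<inter> space M"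
          using A(2)[of _ n] sets.sets_into_space[OF A(1), of n] by (force simp: K_def)
        then show ?thesis by (subst measure_distr) (auto intro!: finite_measure_mono)
      qed
      then have "\<bar>(\<integral>x. f x \<partial>distr M borel (X n)) - (\<integral>x. g x \<partial>distr M borel (X n))\<bar> \<le> e + (2 * B + 1) * e"
        using elim(1) intf(1) intg(1)
        by (intro close) (auto simp: integrable_distr_eq intro!: prob_space_distr)
      then have "\<bar>(\<integral>\<omega>. f (X n \<omega>) \<partial>M) - (\<integral>\<omega>. g (X n \<omega>) \<partial>M)\<bar> \<le> e + (2 * B + 1) * e"
        by (simp add: integral_distr)
      then show ?case using cN elim(2) unfolding dist_real_def abs_less_iff abs_le_iff by argo
    qed
    then show "\<exists>no. \<forall>n\<ge>no. dist (\<integral>\<omega>. f (X n \<omega>) \<partial>M) (\<integral>x. f x \<partial>N) < r"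
      by (simp add: eventually_sequentially)
  qed
  then show "(\<lambda>n. \<integral>x. f x \<partial>distr M borel (X n)) \<longlonglongrightarrow> (\<integral>x. f x \<partial>N)"
    by (simp add: integral_distr)
qed

text \<open>Slutsky's lemma for a single cosine: it is Lipschitz with constant 1 where
  \<open>X n\<close> and \<open>S n\<close> are close, and bounded by 1 on the unlikely
  rest.\<close>

lemma (in prob_space) cos_expectation_diff_tends_0:
  fixes X S :: "nat \<Rightarrow> 'a \<Rightarrow> real^'n"
  assumes [measurable]: "\<And>n. X n \<in> borel_measurable M" "\<And>n. S n \<in> borel_measurable M"
    and XS: "tends_in_prob M (\<lambda>n \<omega>. X n \<omega> - S n \<omega>) 0"
  shows "(\<lambda>n. (\<integral>\<omega>. cos (t \<bullet> X n \<omega> + b) \<partial>M) - (\<integral>\<omega>. cos (t \<bullet> S n \<omega> + b) \<partial>M)) \<longlonglongrightarrow> 0"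
proof (rule metric_LIMSEQ_I)
  fix r :: real assume r: "r > 0"
  \<comment> \<open>The Lipschitz part \<open>norm t * e\<close> stays below r/2, and the
    exceptional event of probability below r/4 contributes less than the other half;
    \<open>norm t + 1\<close> also covers \<open>t = 0\<close>.\<close>
  define e where "e = r / (4 * (norm t + 1))"
  have nt: "0 < norm t + 1" by (simp add: add_nonneg_pos)
  then have e: "e > 0" using r by (simp add: e_def)
  have te: "norm t * e < r / 2"
  proof -
    have *: "c * (r / (4 * c)) = r / 4" if "c > 0" for c using that by simp
    have "norm t * e \<le> (norm t + 1) * e" using e by (intro mult_right_mono) auto
    also have "\<dots> = r / 4"
      unfolding e_def by (rule *[OF nt])
    finally show ?thesis using r by linarith
  qed
  have "wpa1 M (\<lambda>n \<omega>. norm (X n \<omega> - S n \<omega> - 0) < e)"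
    using XS e unfolding tends_in_prob_iff_norm by blast
  then have "wpa1 M (\<lambda>n \<omega>. norm (X n \<omega> - S n \<omega>) < e)" by simp
  then have lim: "(\<lambda>n. prob {\<omega>\<in>space M. norm (X n \<omega> - S n \<omega>) < e}) \<longlonglongrightarrow> 1"
    by (subst (asm) wpa1_iff) (auto intro: prob_space_axioms)
  have "\<forall>\<^sub>F n in sequentially. 1 - r / 4 < prob {\<omega>\<in>space M. norm (X n \<omega> - S n \<omega>) < e}"
    using r by (intro order_tendstoD[OF lim]) auto
  then have "\<forall>\<^sub>F n in sequentially. dist ((\<integral>\<omega>. cos (t \<bullet> X n \<omega> + b) \<partial>M) - (\<integral>\<omega>. cos (t \<bullet> S n \<omega> + b) \<partial>M)) 0 < r"
  proof eventually_elim
    case (elim n)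
    define U where "U = {\<omega>\<in>space M. \<not> norm (X n \<omega> - S n \<omega>) < e}"
    have [measurable]: "U \<in> sets M" unfolding U_def by measurable
    have "U = space M - {\<omega>\<in>space M. norm (X n \<omega> - S n \<omega>) < e}" by (auto simp: U_def)
    then have pU: "prob U < r / 4" using elim by (simp add: prob_compl)
    have ic: "integrable M (\<lambda>\<omega>. cos (t \<bullet> Y \<omega> + b))" if [measurable]: "Y \<in> borel_measurable M" for Y :: "'a \<Rightarrow> real^'n"
      by (rule integrable_const_bound[of _ 1]) auto
    have pt: "\<bar>cos (t \<bullet> X n \<omega> + b) - cos (t \<bullet> S n \<omega> + b)\<bar> \<le> norm t * e + 2 * indicator U \<omega>" if "\<omega> \<in> space M" for \<omega>
    proof (cases "\<omega> \<in> U")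
      case True
      have "\<bar>cos (t \<bullet> X n \<omega> + b) - cos (t \<bullet> S n \<omega> + b)\<bar> \<le> 1 + 1"
        by (rule order_trans[OF abs_triangle_ineq4 add_mono]) auto
      then show ?thesis using True e by (simp add: add_increasing)
    next
      case False
      have lip: "\<bar>cos x - cos y\<bar> \<le> \<bar>x - y\<bar>" for x y :: real
      proof -
        have "\<bar>cos x - cos y\<bar> = 2 * \<bar>sin ((x + y) / 2)\<bar> * \<bar>sin ((y - x) / 2)\<bar>"
          by (simp add: cos_diff_cos abs_mult)
        also have "\<dots> \<le> 2 * 1 * \<bar>(y - x) / 2\<bar>"
          by (intro mult_mono abs_sin_x_le_abs_x) auto
        finally show ?thesis by simp
      qed
      have "\<bar>cos (t \<bullet> X n \<omega> + b) - cos (t \<bullet> S n \<omega> + b)\<bar> \<le> \<bar>t \<bullet> (X n \<omega> - S n \<omega>)\<bar>"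
        using lip[of "t \<bullet> X n \<omega> + b" "t \<bullet> S n \<omega> + b"] by (simp add: inner_diff_right)
      also have "\<dots> \<le> norm t * norm (X n \<omega> - S n \<omega>)" by (rule Cauchy_Schwarz_ineq2)
      also have "\<dots> \<le> norm t * e" using False that by (intro mult_left_mono) (auto simp: U_def)
      finally show ?thesis using False by simp
    qed
    have "\<bar>(\<integral>\<omega>. cos (t \<bullet> X n \<omega> + b) \<partial>M) - (\<integral>\<omega>. cos (t \<bullet> S n \<omega> + b) \<partial>M)\<bar>
        \<le> (\<integral>\<omega>. \<bar>cos (t \<bullet> X n \<omega> + b) - cos (t \<bullet> S n \<omega> + b)\<bar> \<partial>M)"
      by (subst Bochner_Integration.integral_diff[symmetric]) (auto intro!: ic)
    also have "\<dots> \<le> (\<integral>\<omega>. norm t * e + 2 * indicator U \<omega> \<partial>M)"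
      using pt by (intro integral_mono) (auto intro!: ic integrable_abs Bochner_Integration.integrable_diff
          integrable_mult_right simp: emeasure_eq_measure)
    also have "\<dots> = norm t * e + 2 * prob U"
      by (subst Bochner_Integration.integral_add) (auto simp: emeasure_eq_measure prob_space intro!: integrable_mult_right)
    also have "\<dots> < r" using te pU by linarith
    finally show ?case by simp
  qed
  then show "\<exists>no. \<forall>n\<ge>no. dist ((\<integral>\<omega>. cos (t \<bullet> X n \<omega> + b) \<partial>M) - (\<integral>\<omega>. cos (t \<bullet> S n \<omega> + b) \<partial>M)) 0 < r"
    by (simp add: eventually_sequentially)
qed

section \<open>Cross-fitted sample averages\<close>

context prob_space
begin

text \<open>Phrased through \<open>ennreal (Y \<omega>)\<close>, so that negative values of
  \<open>Y\<close> count as 0 and integrability is implied by the bound itself.\<close>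

lemma markov_prob_less:
  assumes [measurable]: "Y \<in> borel_measurable M" and le: "(\<integral>\<^sup>+\<omega>. ennreal (Y \<omega>) \<partial>M) \<le> ennreal c"
    and "c \<ge> 0" and e: "e > 0"
  shows "1 - c / e \<le> prob {\<omega>\<in>space M. Y \<omega> < e}"
proof -
  have "emeasure M ({\<omega>\<in>space M. 1 \<le> ennreal (1 / e) * ennreal (Y \<omega>)})
      \<le> ennreal (1 / e) * (\<integral>\<^sup>+\<omega>. ennreal (Y \<omega>) \<partial>M)"
    using nn_integral_Markov_inequality[of "\<lambda>\<omega>. ennreal (Y \<omega>)" "space M" M "ennreal (1/e)"] by simp
  also have "\<dots> \<le> ennreal (1 / e) * ennreal c"
    using le by (rule mult_left_mono) simp
  also have "\<dots> = ennreal (c / e)" using e \<open>c \<ge> 0\<close> by (simp add: ennreal_mult[symmetric])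
  also have "{\<omega>\<in>space M. 1 \<le> ennreal (1 / e) * ennreal (Y \<omega>)} = {\<omega>\<in>space M. e \<le> Y \<omega>}"
  proof -
    have "1 \<le> ennreal (1 / e) * ennreal (Y \<omega>) \<longleftrightarrow> e \<le> Y \<omega>" for \<omega>
    proof (cases "Y \<omega> \<ge> 0")
      case True
      then have "ennreal (1 / e) * ennreal (Y \<omega>) = ennreal (Y \<omega> / e)"
        using e by (simp add: ennreal_mult[symmetric])
      then show ?thesis using e True by (simp add: ennreal_1[symmetric] del: ennreal_1)
    next
      case False
      then show ?thesis using e by (simp add: ennreal_neg)
    qed
    then show ?thesis by simp
  qed
  finally have "prob {\<omega>\<in>space M. e \<le> Y \<omega>} \<le> c / e"
    using e \<open>c \<ge> 0\<close> by (simp add: emeasure_eq_measure)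
  moreover have "{\<omega>\<in>space M. Y \<omega> < e} = space M - {\<omega>\<in>space M. e \<le> Y \<omega>}" by auto
  ultimately show ?thesis by (simp add: prob_compl)
qed

text \<open>The dominating variable may depend on the level \<open>c\<close>. In the applications it
  is a truncation at that level, which dominates \<open>X\<close> only with probability tending to
  one.\<close>

lemma tends_in_prob_markov:
  fixes X :: "nat \<Rightarrow> 'a \<Rightarrow> 'b::real_normed_vector"
  assumes "\<And>c::real. c > 0 \<Longrightarrow> \<exists>Y::nat \<Rightarrow> 'a \<Rightarrow> real. wpa1 M (\<lambda>n \<omega>. norm (X n \<omega>) \<le> Y n \<omega>) \<and>
    (\<forall>n. Y n \<in> borel_measurable M \<and> (\<integral>\<^sup>+\<omega>. ennreal (Y n \<omega>) \<partial>M) \<le> ennreal c)"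
  shows "tends_in_prob M X 0"
  unfolding tends_in_prob_iff_norm
proof (intro allI impI wpa1_epsI)
  fix e d :: real assume e: "e > 0" and d: "d > 0"
  obtain Y where Y: "wpa1 M (\<lambda>n \<omega>. norm (X n \<omega>) \<le> Y n \<omega>)"
    "\<And>n. Y n \<in> borel_measurable M" "\<And>n. (\<integral>\<^sup>+\<omega>. ennreal (Y n \<omega>) \<partial>M) \<le> ennreal (e * d / 2)"
    using assms[of "e * d / 2"] e d by auto
  obtain C where C: "\<And>n. C n \<in> sets M" "\<And>n \<omega>. \<omega> \<in> C n \<Longrightarrow> norm (X n \<omega>) \<le> Y n \<omega>"
    "(\<lambda>n. prob (C n)) \<longlonglongrightarrow> 1"
    using Y(1) unfolding wpa1_def by auto
  have evC: "\<forall>\<^sub>F n in sequentially. 1 - d/2 < prob (C n)"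
    using d by (intro order_tendstoD[OF C(3)]) auto
  define A where "A n = {\<omega>\<in>space M. Y n \<omega> < e}" for n
  have [measurable]: "A n \<in> sets M" for n unfolding A_def using Y(2) by measurable
  have "1 - (e * d / 2) / e \<le> prob (A n)" for n
    unfolding A_def by (rule markov_prob_less[OF Y(2,3)]) (use e d in auto)
  then have pA: "1 - d / 2 \<le> prob (A n)" for n using e by simp
  have "\<forall>\<^sub>F n in sequentially. 1 - d \<le> prob (A n \<inter> C n)"
    using evC
  proof eventually_elim
    case (elim n)
    have "A n \<in> events" by measurable
    from prob_Int_ge[OF this C(1)[of n]] show ?case using elim pA[of n] by linarith
  qed
  moreover have "norm (X n \<omega> - 0) < e" if "\<omega> \<in> A n \<inter> C n" for n \<omega>
    using that C(2)[of \<omega> n] by (auto simp: A_def)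
  ultimately show "\<exists>A. (\<forall>n. A n \<in> sets M \<and> (\<forall>\<omega>\<in>A n. norm (X n \<omega> - 0) < e)) \<and>
      (\<forall>\<^sub>F n in sequentially. 1 - d \<le> prob (A n))"
    using C(1) by (intro exI[of _ "\<lambda>n. A n \<inter> C n"]) auto
qed

lemma bounded_in_prob_markov:
  fixes X :: "nat \<Rightarrow> 'a \<Rightarrow> 'b::real_normed_vector" and Y :: "nat \<Rightarrow> 'a \<Rightarrow> real"
  assumes X: "wpa1 M (\<lambda>n \<omega>. norm (X n \<omega>) \<le> Y n \<omega>)"
    and Y: "\<And>n. Y n \<in> borel_measurable M" "\<And>n. (\<integral>\<^sup>+\<omega>. ennreal (Y n \<omega>) \<partial>M) \<le> ennreal c"
    and c: "c \<ge> 0"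
  shows "bounded_in_prob M X"
proof -
  \<comment> \<open>Markov's inequality controls \<open>Y n\<close> from above only, so negative
    values are cut off before a norm is taken. In \<open>e\<close> below, \<open>c + 1\<close>
    instead of \<open>c\<close> keeps the threshold positive when \<open>c = 0\<close>.\<close>
  have "bounded_in_prob M (\<lambda>n \<omega>. max 0 (Y n \<omega>))"
    unfolding bounded_in_prob_def
  proof (intro allI impI)
    fix d :: real assume d: "d > 0"
    define e where "e = (c + 1) / d"
    have e: "e > 0" using c d by (simp add: e_def)
    have cd: "c / e \<le> d" using c d by (simp add: e_def field_simps)
    define A where "A n = {\<omega>\<in>space M. Y n \<omega> < e}" for n
    have "A n \<in> sets M" for n unfolding A_def using Y(1) by measurable
    moreover have "1 - d \<le> prob (A n)" for n
      using markov_prob_less[OF Y c e, of n] cd by (simp add: A_def)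
    moreover have "norm (max 0 (Y n \<omega>)) \<le> e" if "\<omega> \<in> A n" for n \<omega>
      using that e by (auto simp: A_def)
    ultimately show "\<exists>B A. (\<forall>n. A n \<in> sets M \<and> (\<forall>\<omega>\<in>A n. norm (max 0 (Y n \<omega>)) \<le> B)) \<and>
      (\<forall>\<^sub>F n in sequentially. 1 - d \<le> prob (A n))"
      by (intro exI[of _ e] exI[of _ A]) auto
  qed
  then show ?thesis
    by (rule bounded_in_prob_wpa1[where f = "\<lambda>B. B"]) (rule wpa1_mono[OF X], auto)
qed

lemma square_integrable_norm_imp_integrable:
  fixes f :: "'a \<Rightarrow> 'b::euclidean_space"
  assumes [measurable]: "f \<in> borel_measurable M" and fin: "(\<integral>\<^sup>+w. ennreal ((norm (f w))\<^sup>2) \<partial>M) < \<infinity>"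
  shows "integrable M f" "integrable M (\<lambda>w. (norm (f w))\<^sup>2)"
proof -
  show sq: "integrable M (\<lambda>w. (norm (f w))\<^sup>2)"
    using fin by (intro integrableI_bounded) auto
  show "integrable M f"
  proof (rule Bochner_Integration.integrable_bound)
    show "integrable M (\<lambda>w. 1 + (norm (f w))\<^sup>2)" using sq by simp
    show "AE w in M. norm (f w) \<le> norm (1 + (norm (f w))\<^sup>2)"
    proof (rule AE_I2)
      fix w
      have "0 \<le> (norm (f w) - 1/2)\<^sup>2" by simp
      then have "norm (f w) \<le> 1 + (norm (f w))\<^sup>2"
        by (simp add: power2_eq_square algebra_simps)
      also have "\<dots> \<le> norm (1 + (norm (f w))\<^sup>2)" by simp
      finally show "norm (f w) \<le> norm (1 + (norm (f w))\<^sup>2)" .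
    qed
  qed fact
qed

text \<open>The variance is the second moment minus the squared norm of the mean.\<close>

lemma nn_integral_centered_square_le:
  fixes f :: "'a \<Rightarrow> 'b::euclidean_space"
  assumes [measurable]: "f \<in> borel_measurable M" and le: "(\<integral>\<^sup>+w. ennreal ((norm (f w))\<^sup>2) \<partial>M) \<le> ennreal c"
  shows "(\<integral>\<^sup>+w. ennreal ((norm (f w - (\<integral>v. f v \<partial>M)))\<^sup>2) \<partial>M) \<le> ennreal c"
proof -
  define m where "m = (\<integral>v. f v \<partial>M)"
  have fin: "(\<integral>\<^sup>+w. ennreal ((norm (f w))\<^sup>2) \<partial>M) < \<infinity>"
    using le by (rule le_less_trans) simp
  note int = square_integrable_norm_imp_integrable[OF assms(1) fin]
  have eq: "(norm (f w - m))\<^sup>2 = (norm (f w))\<^sup>2 - 2 * (f w \<bullet> m) + (norm m)\<^sup>2" for w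
    by (simp add: power2_norm_eq_inner inner_diff_left inner_diff_right inner_commute)
  have intc: "integrable M (\<lambda>w. (norm (f w - m))\<^sup>2)"
    unfolding eq using int by simp
  have "(\<integral>w. (norm (f w - m))\<^sup>2 \<partial>M) = (\<integral>w. (norm (f w))\<^sup>2 \<partial>M) - 2 * (m \<bullet> m) + (norm m)\<^sup>2"
    unfolding eq using int by (simp add: prob_space m_def)
  also have "\<dots> \<le> (\<integral>w. (norm (f w))\<^sup>2 \<partial>M)"
    by (simp add: power2_norm_eq_inner)
  finally have "(\<integral>\<^sup>+w. ennreal ((norm (f w - m))\<^sup>2) \<partial>M) \<le> (\<integral>\<^sup>+w. ennreal ((norm (f w))\<^sup>2) \<partial>M)"
    by (simp add: nn_integral_eq_integral[OF intc] nn_integral_eq_integral[OF int(2)] ennreal_leI)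
  then show ?thesis using le unfolding m_def by (rule order_trans)
qed

end

section \<open>Independence of an observation from the other folds\<close>

locale iid_sample = prob_space M for M :: "'o measure" +
  fixes F0 :: "'w measure" and W :: "nat \<Rightarrow> 'o \<Rightarrow> 'w"
  assumes prob_F0: "prob_space F0"
    and indep: "indep_vars (\<lambda>_. F0) W {1..}"
    and ident: "\<And>i. i \<ge> 1 \<Longrightarrow> distr M F0 (W i) = F0"
begin

sublocale F0: prob_space F0 by (rule prob_F0)

definition obs :: "nat set \<Rightarrow> 'o \<Rightarrow> nat \<Rightarrow> 'w" where
  "obs J \<omega> = (\<lambda>i\<in>J. W i \<omega>)"

lemma measurable_W: "i \<ge> 1 \<Longrightarrow> W i \<in> measurable M F0"
  using indep by (auto simp: indep_vars_def)

lemma measurable_obs: "J \<subseteq> {1..} \<Longrightarrow> obs J \<in> measurable M (PiM J (\<lambda>_. F0))"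
  unfolding obs_def by (intro measurable_restrict measurable_W) auto

lemma measurable_W_obs:
  "i \<ge> 1 \<Longrightarrow> J \<subseteq> {1..} \<Longrightarrow> (\<lambda>\<omega>. (W i \<omega>, obs J \<omega>)) \<in> measurable M (F0 \<Otimes>\<^sub>M PiM J (\<lambda>_. F0))"
  by (intro measurable_Pair measurable_W measurable_obs)

text \<open>Independence is available for the blocks \<open>{i}\<close> and \<open>J\<close> as
  vectors in product spaces; the first block is then projected to its only coordinate, which has law
  \<open>F0\<close>. This product law stands in for a conditional distribution given the
  observations in \<open>J\<close>.\<close>

lemma distr_W_obs:
  assumes "i \<ge> 1" "J \<subseteq> {1..}" "i \<notin> J"
  shows "distr M (F0 \<Otimes>\<^sub>M PiM J (\<lambda>_. F0)) (\<lambda>\<omega>. (W i \<omega>, obs J \<omega>)) =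
    F0 \<Otimes>\<^sub>M distr M (PiM J (\<lambda>_. F0)) (obs J)"
proof -
  have "indep_var (PiM {i} (\<lambda>_. F0)) (\<lambda>\<omega>. \<lambda>i\<in>{i}. W i \<omega>) (PiM J (\<lambda>_. F0)) (obs J)"
    unfolding obs_def by (rule indep_var_restrict[OF indep]) (use assms in auto)
  then have eq: "distr M (PiM {i} (\<lambda>_. F0)) (obs {i}) \<Otimes>\<^sub>M distr M (PiM J (\<lambda>_. F0)) (obs J)
      = distr M (PiM {i} (\<lambda>_. F0) \<Otimes>\<^sub>M PiM J (\<lambda>_. F0)) (\<lambda>\<omega>. (obs {i} \<omega>, obs J \<omega>))"
    unfolding indep_var_distribution_eq obs_def by simp
  let ?p = "\<lambda>(x, y). (x i, y)"
  have mi: "obs {i} \<in> measurable M (PiM {i} (\<lambda>_. F0))" and mJ: "obs J \<in> measurable M (PiM J (\<lambda>_. F0))"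
    using measurable_obs assms by auto
  have ci: "(\<lambda>x. x i) \<in> measurable (PiM {i} (\<lambda>_. F0)) F0" by (rule measurable_component_singleton) simp
  interpret P: prob_space "distr M (PiM J (\<lambda>_. F0)) (obs J)" by (rule prob_space_distr[OF mJ])
  have "F0 \<Otimes>\<^sub>M distr M (PiM J (\<lambda>_. F0)) (obs J)
      = distr (distr M (PiM {i} (\<lambda>_. F0)) (obs {i})) F0 (\<lambda>x. x i)
        \<Otimes>\<^sub>M distr (distr M (PiM J (\<lambda>_. F0)) (obs J)) (PiM J (\<lambda>_. F0)) (\<lambda>y. y)"
  proof -
    have "distr (distr M (PiM {i} (\<lambda>_. F0)) (obs {i})) F0 (\<lambda>x. x i) = distr M F0 (W i)"
      using ci mi by (subst distr_distr) (auto simp: comp_def obs_def)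
    moreover have "distr (distr M (PiM J (\<lambda>_. F0)) (obs J)) (PiM J (\<lambda>_. F0)) (\<lambda>y. y)
        = distr M (PiM J (\<lambda>_. F0)) (obs J)"
      using mJ by (subst distr_distr) (auto simp: comp_def)
    ultimately show ?thesis using ident[OF assms(1)] by simp
  qed
  also have "\<dots> = distr (distr M (PiM {i} (\<lambda>_. F0)) (obs {i}) \<Otimes>\<^sub>M distr M (PiM J (\<lambda>_. F0)) (obs J))
      (F0 \<Otimes>\<^sub>M PiM J (\<lambda>_. F0)) ?p"
    using ci mJ P.sigma_finite_measure_axioms
    by (intro pair_measure_distr) (auto simp: distr_distr comp_def)
  also have "\<dots> = distr M (F0 \<Otimes>\<^sub>M PiM J (\<lambda>_. F0)) (\<lambda>\<omega>. (W i \<omega>, obs J \<omega>))"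
  proof -
    have mp: "?p \<in> measurable (PiM {i} (\<lambda>_. F0) \<Otimes>\<^sub>M PiM J (\<lambda>_. F0)) (F0 \<Otimes>\<^sub>M PiM J (\<lambda>_. F0))"
      using ci by measurable
    have "?p \<circ> (\<lambda>\<omega>. (obs {i} \<omega>, obs J \<omega>)) = (\<lambda>\<omega>. (W i \<omega>, obs J \<omega>))"
      by (auto simp: obs_def)
    then show ?thesis
      unfolding eq using distr_distr[OF mp measurable_Pair[OF mi mJ]] by simp
  qed
  finally show ?thesis by simp
qed

lemma prob_space_distr_obs: "J \<subseteq> {1..} \<Longrightarrow> prob_space (distr M (PiM J (\<lambda>_. F0)) (obs J))"
  by (intro prob_space_distr measurable_obs)

text \<open>Tonelli under the product law: the inner integral over \<open>F0\<close> acts as the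
  conditional expectation given the observations in \<open>J\<close>.\<close>

lemma nn_integral_W_obs:
  assumes i: "i \<ge> 1" "J \<subseteq> {1..}" "i \<notin> J"
    and f[measurable]: "f \<in> borel_measurable (F0 \<Otimes>\<^sub>M PiM J (\<lambda>_. F0))"
  shows "(\<integral>\<^sup>+\<omega>. f (W i \<omega>, obs J \<omega>) \<partial>M) = (\<integral>\<^sup>+\<omega>. (\<integral>\<^sup>+w. f (w, obs J \<omega>) \<partial>F0) \<partial>M)"
proof -
  let ?P = "distr M (PiM J (\<lambda>_. F0)) (obs J)"
  interpret P: prob_space ?P by (rule prob_space_distr_obs) fact
  interpret pair_sigma_finite F0 ?P ..
  have "(\<integral>\<^sup>+\<omega>. f (W i \<omega>, obs J \<omega>) \<partial>M)
      = integral\<^sup>N (distr M (F0 \<Otimes>\<^sub>M PiM J (\<lambda>_. F0)) (\<lambda>\<omega>. (W i \<omega>, obs J \<omega>))) f"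
    by (rule nn_integral_distr[symmetric]) (use measurable_W_obs i f in auto)
  also have "\<dots> = (\<integral>\<^sup>+x. (\<integral>\<^sup>+w. f (w, x) \<partial>F0) \<partial>?P)"
    unfolding distr_W_obs[OF i] by (rule nn_integral_snd[symmetric]) simp
  also have "\<dots> = (\<integral>\<^sup>+\<omega>. (\<integral>\<^sup>+w. f (w, obs J \<omega>) \<partial>F0) \<partial>M)"
    by (rule nn_integral_distr) (use measurable_obs i in auto)
  finally show ?thesis .
qed

lemma integral_W_obs_eq_0:
  fixes f :: "_ \<Rightarrow> real"
  assumes i: "i \<ge> 1" "J \<subseteq> {1..}" "i \<notin> J"
    and f[measurable]: "f \<in> borel_measurable (F0 \<Otimes>\<^sub>M PiM J (\<lambda>_. F0))"
    and int: "integrable M (\<lambda>\<omega>. f (W i \<omega>, obs J \<omega>))"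
    and 0: "\<And>x. x \<in> space (PiM J (\<lambda>_. F0)) \<Longrightarrow> (\<integral>w. f (w, x) \<partial>F0) = 0"
  shows "(\<integral>\<omega>. f (W i \<omega>, obs J \<omega>) \<partial>M) = 0"
proof -
  let ?P = "distr M (PiM J (\<lambda>_. F0)) (obs J)"
  interpret P: prob_space ?P by (rule prob_space_distr_obs) fact
  interpret pair_sigma_finite F0 ?P ..
  have int': "integrable (F0 \<Otimes>\<^sub>M ?P) f"
    using int unfolding distr_W_obs[OF i, symmetric]
    by (subst integrable_distr_eq) (use measurable_W_obs i in auto)
  have "(\<integral>\<omega>. f (W i \<omega>, obs J \<omega>) \<partial>M)
      = integral\<^sup>L (distr M (F0 \<Otimes>\<^sub>M PiM J (\<lambda>_. F0)) (\<lambda>\<omega>. (W i \<omega>, obs J \<omega>))) f"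
    by (rule integral_distr[symmetric]) (use measurable_W_obs i f in auto)
  also have "\<dots> = (\<integral>x. (\<integral>w. f (w, x) \<partial>F0) \<partial>?P)"
    unfolding distr_W_obs[OF i]
    using integral_snd[of "\<lambda>w x. f (w, x)"] int' by simp
  also have "\<dots> = (\<integral>x. 0 \<partial>?P)"
    by (rule Bochner_Integration.integral_cong) (auto simp: 0)
  finally show ?thesis by simp
qed

text \<open>Given the observations in \<open>J\<close>, the summands are centered and independent,
  so the cross terms vanish and \<open>card I\<close> diagonal terms of size at most
  \<open>c\<close> remain.\<close>

lemma second_moment_sum_le:
  fixes k :: "_ \<Rightarrow> 'b::euclidean_space"
  assumes J: "J \<subseteq> {1..}" and I: "I \<subseteq> {1..}" "finite I" "I \<inter> J = {}"
    and k[measurable]: "k \<in> borel_measurable (F0 \<Otimes>\<^sub>M PiM J (\<lambda>_. F0))"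
    and sq: "\<And>x. x \<in> space (PiM J (\<lambda>_. F0)) \<Longrightarrow> (\<integral>\<^sup>+w. ennreal ((norm (k (w, x)))\<^sup>2) \<partial>F0) \<le> ennreal c"
    and 0: "\<And>x. x \<in> space (PiM J (\<lambda>_. F0)) \<Longrightarrow> (\<integral>w. k (w, x) \<partial>F0) = 0"
    and c: "c \<ge> 0"
  shows "(\<integral>\<^sup>+\<omega>. ennreal ((norm (\<Sum>i\<in>I. k (W i \<omega>, obs J \<omega>)))\<^sup>2) \<partial>M) \<le> ennreal (real (card I) * c)"
proof -
  define K where "K i \<omega> = k (W i \<omega>, obs J \<omega>)" for i \<omega>
  have Km[measurable]: "K i \<in> borel_measurable M" if "i \<in> I" for i
    unfolding K_def by (rule measurable_compose[OF measurable_W_obs k]) (use that I J in auto)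
  have Ksq: "(\<integral>\<^sup>+\<omega>. ennreal ((norm (K i \<omega>))\<^sup>2) \<partial>M) \<le> ennreal c" if "i \<in> I" for i
  proof -
    have "(\<integral>\<^sup>+\<omega>. ennreal ((norm (K i \<omega>))\<^sup>2) \<partial>M)
        = (\<integral>\<^sup>+\<omega>. (\<integral>\<^sup>+w. ennreal ((norm (k (w, obs J \<omega>)))\<^sup>2) \<partial>F0) \<partial>M)"
      unfolding K_def using that I J
      by (intro nn_integral_W_obs[where f = "\<lambda>p. ennreal ((norm (k p))\<^sup>2)"]) auto
    also have "\<dots> \<le> (\<integral>\<^sup>+\<omega>. ennreal c \<partial>M)"
      by (intro nn_integral_mono sq measurable_space[OF measurable_obs[OF J]])
    finally show ?thesis by (simp add: emeasure_space_1)
  qed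
  have Kint: "integrable M (\<lambda>\<omega>. (norm (K i \<omega>))\<^sup>2)" if "i \<in> I" for i
    by (rule square_integrable_norm_imp_integrable[OF Km[OF that]])
       (use Ksq[OF that] in \<open>auto intro: le_less_trans\<close>)
  have KE: "(\<integral>\<omega>. (norm (K i \<omega>))\<^sup>2 \<partial>M) \<le> c" if "i \<in> I" for i
    using Ksq[OF that] c by (simp add: nn_integral_eq_integral[OF Kint[OF that]])
  have Kij: "integrable M (\<lambda>\<omega>. K i \<omega> \<bullet> K j \<omega>)" if "i \<in> I" "j \<in> I" for i j
  proof (rule Bochner_Integration.integrable_bound)
    show "integrable M (\<lambda>\<omega>. (norm (K i \<omega>))\<^sup>2 + (norm (K j \<omega>))\<^sup>2)"
      using Kint that by simp
    show "AE \<omega> in M. norm (K i \<omega> \<bullet> K j \<omega>) \<le> norm ((norm (K i \<omega>))\<^sup>2 + (norm (K j \<omega>))\<^sup>2)"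
    proof (rule AE_I2)
      fix \<omega>
      have "0 \<le> norm (K i \<omega>) * norm (K j \<omega>)" by simp
      moreover have "norm (K i \<omega> \<bullet> K j \<omega>) \<le> norm (K i \<omega>) * norm (K j \<omega>)"
        using Cauchy_Schwarz_ineq2[of "K i \<omega>" "K j \<omega>"] by simp
      moreover have "2 * (norm (K i \<omega>) * norm (K j \<omega>)) \<le> (norm (K i \<omega>))\<^sup>2 + (norm (K j \<omega>))\<^sup>2"
        using sum_squares_bound[of "norm (K i \<omega>)" "norm (K j \<omega>)"] by (simp add: mult.assoc)
      ultimately show "norm (K i \<omega> \<bullet> K j \<omega>) \<le> norm ((norm (K i \<omega>))\<^sup>2 + (norm (K j \<omega>))\<^sup>2)"
        by (simp add: abs_of_nonneg)
    qed
  qed (use that in measurable)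
  have cross: "(\<integral>\<omega>. K i \<omega> \<bullet> K j \<omega> \<partial>M) = 0" if ij: "i \<in> I" "j \<in> I" "i \<noteq> j" for i j
  proof -
    \<comment> \<open>For the cross term, \<open>W j\<close> joins the observations held fixed. The
      integral over \<open>W i\<close> alone is then a centered integral against a fixed vector,
      hence 0.\<close>
    define J' where "J' = insert j J"
    define f where "f = (\<lambda>(w, x). k (w, restrict x J) \<bullet> k (x j, restrict x J))"
    have r[measurable]: "(\<lambda>x. restrict x J) \<in> measurable (PiM J' (\<lambda>_. F0)) (PiM J (\<lambda>_. F0))"
      unfolding J'_def by (rule measurable_restrict_subset) auto
    have rj[measurable]: "(\<lambda>x. x j) \<in> measurable (PiM J' (\<lambda>_. F0)) F0"
      unfolding J'_def by (rule measurable_component_singleton) simp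
    have f: "f \<in> borel_measurable (F0 \<Otimes>\<^sub>M PiM J' (\<lambda>_. F0))"
      unfolding f_def by measurable
    have J'1: "J' \<subseteq> {1..}" "i \<ge> 1" "i \<notin> J'" using ij I J by (auto simp: J'_def)
    have eq: "f (W i \<omega>, obs J' \<omega>) = K i \<omega> \<bullet> K j \<omega>" for \<omega>
    proof -
      have "restrict (obs J' \<omega>) J = obs J \<omega>" "obs J' \<omega> j = W j \<omega>"
        by (auto simp: obs_def J'_def fun_eq_iff restrict_def)
      then show ?thesis by (simp add: f_def K_def)
    qed
    have "(\<integral>\<omega>. f (W i \<omega>, obs J' \<omega>) \<partial>M) = 0"
    proof (rule integral_W_obs_eq_0[OF J'1(2,1,3) f])
      show "integrable M (\<lambda>\<omega>. f (W i \<omega>, obs J' \<omega>))" unfolding eq by (rule Kij) fact+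
      fix x assume x: "x \<in> space (PiM J' (\<lambda>_. F0))"
      have rx: "restrict x J \<in> space (PiM J (\<lambda>_. F0))" using measurable_space[OF r x] .
      have "integrable F0 (\<lambda>w. k (w, restrict x J))"
      proof (rule F0.square_integrable_norm_imp_integrable(1))
        show "(\<lambda>w. k (w, restrict x J)) \<in> borel_measurable F0"
          using rx by measurable
        show "(\<integral>\<^sup>+w. ennreal ((norm (k (w, restrict x J)))\<^sup>2) \<partial>F0) < \<infinity>"
          using sq[OF rx] by (rule le_less_trans) simp
      qed
      then show "(\<integral>w. f (w, x) \<partial>F0) = 0"
        unfolding f_def using 0[OF rx] by simp
    qed
    then show ?thesis by (simp add: eq)
  qed
  have expand: "(norm (\<Sum>i\<in>I. K i \<omega>))\<^sup>2 = (\<Sum>i\<in>I. \<Sum>j\<in>I. K i \<omega> \<bullet> K j \<omega>)" for \<omega>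
    by (simp add: power2_norm_eq_inner inner_sum_left inner_sum_right, rule sum.swap)
  have int: "integrable M (\<lambda>\<omega>. (norm (\<Sum>i\<in>I. K i \<omega>))\<^sup>2)"
    unfolding expand using Kij by auto
  have "(\<integral>\<omega>. (norm (\<Sum>i\<in>I. K i \<omega>))\<^sup>2 \<partial>M) = (\<Sum>i\<in>I. \<Sum>j\<in>I. (\<integral>\<omega>. K i \<omega> \<bullet> K j \<omega> \<partial>M))"
    unfolding expand using Kij by (simp add: Bochner_Integration.integral_sum)
  also have "\<dots> = (\<Sum>i\<in>I. \<Sum>j\<in>I. if i = j then (\<integral>\<omega>. (norm (K i \<omega>))\<^sup>2 \<partial>M) else 0)"
    by (intro sum.cong) (auto simp: cross power2_norm_eq_inner)
  also have "\<dots> = (\<Sum>i\<in>I. (\<integral>\<omega>. (norm (K i \<omega>))\<^sup>2 \<partial>M))" using I(2) by simp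
  also have "\<dots> \<le> (\<Sum>i\<in>I. c)" by (intro sum_mono KE)
  finally have "(\<integral>\<omega>. (norm (\<Sum>i\<in>I. K i \<omega>))\<^sup>2 \<partial>M) \<le> real (card I) * c" by simp
  then have "(\<integral>\<^sup>+\<omega>. ennreal ((norm (\<Sum>i\<in>I. K i \<omega>))\<^sup>2) \<partial>M) \<le> ennreal (real (card I) * c)"
    by (subst nn_integral_eq_integral[OF int]) (auto intro: ennreal_leI)
  then show ?thesis by (simp add: K_def)
qed

end

text \<open>\<open>J n\<close> is only disjoint from \<open>I n\<close>. Thus
  \<open>J n = {}\<close> covers plain averages over the sample, and the complement of a fold covers
  cross-fitting.\<close>

locale cross_fit = iid_sample +
  fixes I J :: "nat \<Rightarrow> nat set"
  assumes I_sub: "\<And>n. I n \<subseteq> {1..n}" and J_sub: "\<And>n. J n \<subseteq> {1..}" and IJ: "\<And>n. I n \<inter> J n = {}"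
begin

lemma finite_I: "finite (I n)" using I_sub[of n] finite_subset by blast

lemma card_I: "card (I n) \<le> n"
  using card_mono[OF _ I_sub[of n]] by simp

lemma I_ge_1: "i \<in> I n \<Longrightarrow> i \<ge> 1" using I_sub[of n] by auto

text \<open>The truncated and recentered summands \<open>k n\<close> have conditional mean 0 and
  conditional second moment at most \<open>c\<close>. After division by the square root of n the sum
  has second moment at most \<open>c\<close>, since the fold has at most n elements, and
  \<open>k n\<close> agrees with the centered \<open>h n\<close> as soon as the mean square of
  \<open>h n\<close> is below \<open>c\<close>.\<close>

lemma centered_sum_tends_0:
  fixes h :: "nat \<Rightarrow> 'b \<times> (nat \<Rightarrow> 'b) \<Rightarrow> 'c::euclidean_space"
  assumes h[measurable]: "\<And>n. h n \<in> borel_measurable (F0 \<Otimes>\<^sub>M PiM (J n) (\<lambda>_. F0))"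
    and lim: "tends_in_prob M (\<lambda>n \<omega>. \<integral>\<^sup>+w. ennreal ((norm (h n (w, obs (J n) \<omega>)))\<^sup>2) \<partial>F0) 0"
  shows "tends_in_prob M (\<lambda>n \<omega>. (\<Sum>i\<in>I n. h n (W i \<omega>, obs (J n) \<omega>)
      - (\<integral>w. h n (w, obs (J n) \<omega>) \<partial>F0)) /\<^sub>R sqrt (real n)) 0"
    (is "tends_in_prob M ?X 0")
proof -
  have "tends_in_prob M (\<lambda>n \<omega>. (norm (?X n \<omega>))\<^sup>2) 0"
  proof (rule tends_in_prob_markov)
    fix c :: real assume c: "c > 0"
    define k where "k n p = (if (\<integral>\<^sup>+w. ennreal ((norm (h n (w, snd p)))\<^sup>2) \<partial>F0) \<le> ennreal c
      then h n p - (\<integral>w. h n (w, snd p) \<partial>F0) else 0)" for n p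
    have k[measurable]: "k n \<in> borel_measurable (F0 \<Otimes>\<^sub>M PiM (J n) (\<lambda>_. F0))" for n
      unfolding k_def by measurable
    define Y where "Y n \<omega> = (norm ((\<Sum>i\<in>I n. k n (W i \<omega>, obs (J n) \<omega>)) /\<^sub>R sqrt (real n)))\<^sup>2" for n \<omega>
    have Ym: "Y n \<in> borel_measurable M" for n
      unfolding Y_def
      using measurable_compose[OF measurable_W_obs[OF I_ge_1 J_sub] k]
      by (intro borel_measurable_power borel_measurable_norm borel_measurable_scaleR
          borel_measurable_const borel_measurable_sum) (auto simp: comp_def)
    have slice: "(\<lambda>w. h n (w, x)) \<in> borel_measurable F0" if "x \<in> space (PiM (J n) (\<lambda>_. F0))" for n x
      using that by measurable
    have Yle: "(\<integral>\<^sup>+\<omega>. ennreal (Y n \<omega>) \<partial>M) \<le> ennreal c" for n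
    proof (cases "n = 0")
      case True
      then show ?thesis using c by (simp add: Y_def)
    next
      case False
      have "(\<integral>\<^sup>+\<omega>. ennreal ((norm (\<Sum>i\<in>I n. k n (W i \<omega>, obs (J n) \<omega>)))\<^sup>2) \<partial>M)
          \<le> ennreal (real (card (I n)) * c)"
      proof (rule second_moment_sum_le[OF J_sub _ finite_I IJ k])
        fix x assume x: "x \<in> space (PiM (J n) (\<lambda>_. F0))"
        show "(\<integral>\<^sup>+w. ennreal ((norm (k n (w, x)))\<^sup>2) \<partial>F0) \<le> ennreal c"
          using F0.nn_integral_centered_square_le[OF slice[OF x]]
          by (cases "(\<integral>\<^sup>+w. ennreal ((norm (h n (w, x)))\<^sup>2) \<partial>F0) \<le> ennreal c") (simp_all add: k_def)
        show "(\<integral>w. k n (w, x) \<partial>F0) = 0"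
        proof (cases "(\<integral>\<^sup>+w. ennreal ((norm (h n (w, x)))\<^sup>2) \<partial>F0) \<le> ennreal c")
          case True
          then have "(\<integral>\<^sup>+w. ennreal ((norm (h n (w, x)))\<^sup>2) \<partial>F0) < \<infinity>"
            by (rule le_less_trans) simp
          from F0.square_integrable_norm_imp_integrable(1)[OF slice[OF x] this] True
          show ?thesis by (simp add: k_def F0.prob_space)
        qed (simp add: k_def)
      qed (use I_ge_1 c in auto)
      also have "\<dots> \<le> ennreal (real n * c)"
        using card_I[of n] c by (intro ennreal_leI mult_right_mono) auto
      finally have *: "(\<integral>\<^sup>+\<omega>. ennreal ((norm (\<Sum>i\<in>I n. k n (W i \<omega>, obs (J n) \<omega>)))\<^sup>2) \<partial>M)
        \<le> ennreal (real n * c)" .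
      have "Y n \<omega> = (1 / real n) * (norm (\<Sum>i\<in>I n. k n (W i \<omega>, obs (J n) \<omega>)))\<^sup>2" for \<omega>
        by (simp add: Y_def inverse_eq_divide power_divide)
      then have "(\<integral>\<^sup>+\<omega>. ennreal (Y n \<omega>) \<partial>M)
          = ennreal (1 / real n) * (\<integral>\<^sup>+\<omega>. ennreal ((norm (\<Sum>i\<in>I n. k n (W i \<omega>, obs (J n) \<omega>)))\<^sup>2) \<partial>M)"
      proof -
        assume Y: "\<And>\<omega>. Y n \<omega> = (1 / real n) * (norm (\<Sum>i\<in>I n. k n (W i \<omega>, obs (J n) \<omega>)))\<^sup>2"
        have [measurable]: "(\<lambda>\<omega>. \<Sum>i\<in>I n. k n (W i \<omega>, obs (J n) \<omega>)) \<in> borel_measurable M"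
          using measurable_compose[OF measurable_W_obs[OF I_ge_1 J_sub] k] by (intro borel_measurable_sum)
        have "ennreal (Y n \<omega>)
            = ennreal (1 / real n) * ennreal ((norm (\<Sum>i\<in>I n. k n (W i \<omega>, obs (J n) \<omega>)))\<^sup>2)" for \<omega>
          unfolding Y by (rule ennreal_mult) auto
        then show ?thesis by (simp only:) (rule nn_integral_cmult, measurable)
      qed
      also have "\<dots> \<le> ennreal (1 / real n) * ennreal (real n * c)"
        using * by (rule mult_left_mono) simp
      also have "\<dots> = ennreal c"
        using False c by (simp add: ennreal_mult[symmetric])
      finally show ?thesis .
    qed
    have "wpa1 M (\<lambda>n \<omega>. (\<integral>\<^sup>+w. ennreal ((norm (h n (w, obs (J n) \<omega>)))\<^sup>2) \<partial>F0) \<in> {..<ennreal c})"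
      by (rule lim[unfolded tends_in_prob_def, rule_format]) (use c in auto)
    then have "wpa1 M (\<lambda>n \<omega>. norm ((norm (?X n \<omega>))\<^sup>2) \<le> Y n \<omega>)"
    proof (rule wpa1_mono)
      fix n \<omega> assume "(\<integral>\<^sup>+w. ennreal ((norm (h n (w, obs (J n) \<omega>)))\<^sup>2) \<partial>F0) \<in> {..<ennreal c}"
      then have "k n (w, obs (J n) \<omega>) = h n (w, obs (J n) \<omega>) - (\<integral>w. h n (w, obs (J n) \<omega>) \<partial>F0)" for w
        by (simp add: k_def less_imp_le)
      then show "norm ((norm (?X n \<omega>))\<^sup>2) \<le> Y n \<omega>" by (simp add: Y_def)
    qed
    then show "\<exists>Y. wpa1 M (\<lambda>n \<omega>. norm ((norm (?X n \<omega>))\<^sup>2) \<le> Y n \<omega>) \<and>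
        (\<forall>n. Y n \<in> borel_measurable M \<and> (\<integral>\<^sup>+\<omega>. ennreal (Y n \<omega>) \<partial>M) \<le> ennreal c)"
      using Ym Yle by blast
  qed
  from tends_in_prob_isCont[OF this, of sqrt]
  have "tends_in_prob M (\<lambda>n \<omega>. norm (?X n \<omega> - 0)) 0" by (simp add: isCont_real_sqrt)
  then show ?thesis unfolding tends_in_prob_norm_iff .
qed

text \<open>Truncation for averages of nonnegative terms: by Tonelli the expectation of each
  truncated term is at most \<open>c\<close>, without any centering. A small \<open>c\<close> yields
  convergence to 0, a fixed one stochastic boundedness.\<close>

lemma mean_dominated:
  fixes h :: "nat \<Rightarrow> 'b \<times> (nat \<Rightarrow> 'b) \<Rightarrow> real"
  assumes h[measurable]: "\<And>n. h n \<in> borel_measurable (F0 \<Otimes>\<^sub>M PiM (J n) (\<lambda>_. F0))"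
    and h0: "\<And>n p. 0 \<le> h n p" and c: "c \<ge> 0"
    and le: "wpa1 M (\<lambda>n \<omega>. (\<integral>\<^sup>+w. ennreal (h n (w, obs (J n) \<omega>)) \<partial>F0) \<le> ennreal c)"
  shows "\<exists>Y. wpa1 M (\<lambda>n \<omega>. norm ((\<Sum>i\<in>I n. h n (W i \<omega>, obs (J n) \<omega>)) / real n) \<le> Y n \<omega>) \<and>
        (\<forall>n. Y n \<in> borel_measurable M \<and> (\<integral>\<^sup>+\<omega>. ennreal (Y n \<omega>) \<partial>M) \<le> ennreal c)"
proof -
  define k where "k n p = (if (\<integral>\<^sup>+w. ennreal (h n (w, snd p)) \<partial>F0) \<le> ennreal c
    then h n p else 0)" for n p
  have k[measurable]: "k n \<in> borel_measurable (F0 \<Otimes>\<^sub>M PiM (J n) (\<lambda>_. F0))" for n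
    unfolding k_def by measurable
  have k0: "0 \<le> k n p" for n p by (simp add: k_def h0)
  define Y where "Y n \<omega> = (\<Sum>i\<in>I n. k n (W i \<omega>, obs (J n) \<omega>)) / real n" for n \<omega>
  have km: "(\<lambda>\<omega>. k n (W i \<omega>, obs (J n) \<omega>)) \<in> borel_measurable M" if "i \<in> I n" for i n
    by (rule measurable_compose[OF measurable_W_obs[OF I_ge_1[OF that] J_sub] k])
  have Ym: "Y n \<in> borel_measurable M" for n
    unfolding Y_def using km by (intro borel_measurable_divide borel_measurable_sum) auto
  have one: "(\<integral>\<^sup>+\<omega>. ennreal (k n (W i \<omega>, obs (J n) \<omega>)) \<partial>M) \<le> ennreal c" if "i \<in> I n" for n i
  proof -
    have "(\<integral>\<^sup>+\<omega>. ennreal (k n (W i \<omega>, obs (J n) \<omega>)) \<partial>M)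
        = (\<integral>\<^sup>+\<omega>. (\<integral>\<^sup>+w. ennreal (k n (w, obs (J n) \<omega>)) \<partial>F0) \<partial>M)"
      using I_ge_1[OF that] J_sub IJ[of n] that
      by (intro nn_integral_W_obs[where f = "\<lambda>p. ennreal (k n p)"]) auto
    also have "\<dots> \<le> (\<integral>\<^sup>+\<omega>. ennreal c \<partial>M)"
    proof (rule nn_integral_mono)
      show "(\<integral>\<^sup>+w. ennreal (k n (w, obs (J n) \<omega>)) \<partial>F0) \<le> ennreal c" for \<omega>
        by (cases "(\<integral>\<^sup>+w. ennreal (h n (w, obs (J n) \<omega>)) \<partial>F0) \<le> ennreal c") (simp_all add: k_def)
    qed
    finally show ?thesis by (simp add: emeasure_space_1)
  qed
  have Yle: "(\<integral>\<^sup>+\<omega>. ennreal (Y n \<omega>) \<partial>M) \<le> ennreal c" for n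
  proof (cases "n = 0")
    case False
    have "ennreal (Y n \<omega>) = ennreal (1 / real n) * (\<Sum>i\<in>I n. ennreal (k n (W i \<omega>, obs (J n) \<omega>)))" for \<omega>
      unfolding Y_def
      by (subst sum_ennreal) (auto simp: k0 ennreal_mult[symmetric] sum_nonneg)
    then have "(\<integral>\<^sup>+\<omega>. ennreal (Y n \<omega>) \<partial>M)
        = ennreal (1 / real n) * (\<Sum>i\<in>I n. (\<integral>\<^sup>+\<omega>. ennreal (k n (W i \<omega>, obs (J n) \<omega>)) \<partial>M))"
      using km by (simp add: nn_integral_cmult nn_integral_sum)
    also have "\<dots> \<le> ennreal (1 / real n) * (\<Sum>i\<in>I n. ennreal c)"
      by (intro mult_left_mono sum_mono one) auto
    also have "\<dots> = ennreal (1 / real n) * ennreal (real (card (I n)) * c)"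
      by (simp add: ennreal_mult ennreal_of_nat_eq_real_of_nat c)
    also have "\<dots> \<le> ennreal (1 / real n) * ennreal (real n * c)"
      using card_I[of n] c by (intro mult_left_mono ennreal_leI mult_right_mono) auto
    also have "\<dots> = ennreal c" using False c by (simp add: ennreal_mult[symmetric])
    finally show ?thesis .
  qed (simp add: Y_def)
  have "wpa1 M (\<lambda>n \<omega>. norm ((\<Sum>i\<in>I n. h n (W i \<omega>, obs (J n) \<omega>)) / real n) \<le> Y n \<omega>)"
    using le by (rule wpa1_mono) (simp add: Y_def k_def h0 sum_nonneg)
  then show ?thesis using Ym Yle by blast
qed

lemma mean_tends_0:
  fixes h :: "nat \<Rightarrow> 'b \<times> (nat \<Rightarrow> 'b) \<Rightarrow> real"
  assumes h[measurable]: "\<And>n. h n \<in> borel_measurable (F0 \<Otimes>\<^sub>M PiM (J n) (\<lambda>_. F0))"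
    and h0: "\<And>n p. 0 \<le> h n p"
    and lim: "tends_in_prob M (\<lambda>n \<omega>. \<integral>\<^sup>+w. ennreal (h n (w, obs (J n) \<omega>)) \<partial>F0) 0"
  shows "tends_in_prob M (\<lambda>n \<omega>. (\<Sum>i\<in>I n. h n (W i \<omega>, obs (J n) \<omega>)) / real n) 0"
proof (rule tends_in_prob_markov)
  fix c :: real assume c: "c > 0"
  have "wpa1 M (\<lambda>n \<omega>. (\<integral>\<^sup>+w. ennreal (h n (w, obs (J n) \<omega>)) \<partial>F0) \<in> {..<ennreal c})"
    by (rule lim[unfolded tends_in_prob_def, rule_format]) (use c in auto)
  then have "wpa1 M (\<lambda>n \<omega>. (\<integral>\<^sup>+w. ennreal (h n (w, obs (J n) \<omega>)) \<partial>F0) \<le> ennreal c)"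
    by (rule wpa1_mono) (simp add: less_imp_le)
  from mean_dominated[OF h h0 _ this] c
  show "\<exists>Y. wpa1 M (\<lambda>n \<omega>. norm ((\<Sum>i\<in>I n. h n (W i \<omega>, obs (J n) \<omega>)) / real n) \<le> Y n \<omega>) \<and>
        (\<forall>n. Y n \<in> borel_measurable M \<and> (\<integral>\<^sup>+\<omega>. ennreal (Y n \<omega>) \<partial>M) \<le> ennreal c)"
    by simp
qed

lemma mean_bounded:
  fixes h :: "nat \<Rightarrow> 'b \<times> (nat \<Rightarrow> 'b) \<Rightarrow> real"
  assumes h[measurable]: "\<And>n. h n \<in> borel_measurable (F0 \<Otimes>\<^sub>M PiM (J n) (\<lambda>_. F0))"
    and h0: "\<And>n p. 0 \<le> h n p" and c: "c \<ge> 0"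
    and le: "wpa1 M (\<lambda>n \<omega>. (\<integral>\<^sup>+w. ennreal (h n (w, obs (J n) \<omega>)) \<partial>F0) \<le> ennreal c)"
  shows "bounded_in_prob M (\<lambda>n \<omega>. (\<Sum>i\<in>I n. h n (W i \<omega>, obs (J n) \<omega>)) / real n)"
  using mean_dominated[OF assms] c by (blast intro: bounded_in_prob_markov)

text \<open>The slice of the bad set at the other observations is \<open>F0\<close>-null only with
  probability tending to one. The indicator \<open>b n\<close>, set to 0 wherever its slice is not
  null, has integral 0 by Tonelli and so vanishes almost surely at every sample point of the
  fold.\<close>

lemma wpa1_AE_fold:
  assumes D: "\<And>n. D n \<in> sets (F0 \<Otimes>\<^sub>M PiM (J n) (\<lambda>_. F0))"
    and ae: "wpa1 M (\<lambda>n \<omega>. AE w in F0. (w, obs (J n) \<omega>) \<in> D n)"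
  shows "wpa1 M (\<lambda>n \<omega>. \<forall>i\<in>I n. (W i \<omega>, obs (J n) \<omega>) \<in> D n)"
proof -
  define b :: "nat \<Rightarrow> 'b \<times> (nat \<Rightarrow> 'b) \<Rightarrow> ennreal"
    where "b n = indicator (space (F0 \<Otimes>\<^sub>M PiM (J n) (\<lambda>_. F0)) - D n)" for n
  have [measurable]: "b n \<in> borel_measurable (F0 \<Otimes>\<^sub>M PiM (J n) (\<lambda>_. F0))" for n
    using D[of n] unfolding b_def by measurable
  define k where "k n p = (if (\<integral>\<^sup>+w. b n (w, snd p) \<partial>F0) = 0 then b n p else 0)" for n p
  have k[measurable]: "k n \<in> borel_measurable (F0 \<Otimes>\<^sub>M PiM (J n) (\<lambda>_. F0))" for n
    unfolding k_def by measurable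
  have "AE \<omega> in M. k n (W i \<omega>, obs (J n) \<omega>) = 0" if "i \<in> I n" for n i
  proof -
    have "(\<integral>\<^sup>+\<omega>. k n (W i \<omega>, obs (J n) \<omega>) \<partial>M) = (\<integral>\<^sup>+\<omega>. (\<integral>\<^sup>+w. k n (w, obs (J n) \<omega>) \<partial>F0) \<partial>M)"
      using I_ge_1[OF that] J_sub IJ[of n] that by (intro nn_integral_W_obs) auto
    also have "\<dots> = (\<integral>\<^sup>+\<omega>. 0 \<partial>M)"
    proof (rule nn_integral_cong)
      show "(\<integral>\<^sup>+w. k n (w, obs (J n) \<omega>) \<partial>F0) = 0" for \<omega>
        by (cases "(\<integral>\<^sup>+w. b n (w, obs (J n) \<omega>) \<partial>F0) = 0") (simp_all add: k_def)
    qed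
    finally have "(\<integral>\<^sup>+\<omega>. k n (W i \<omega>, obs (J n) \<omega>) \<partial>M) = 0" by simp
    then show ?thesis
      using measurable_compose[OF measurable_W_obs[OF I_ge_1[OF that] J_sub] k]
      by (subst (asm) nn_integral_0_iff_AE) auto
  qed
  then have "AE \<omega> in M. \<forall>i\<in>I n. k n (W i \<omega>, obs (J n) \<omega>) = 0" for n
    by (intro AE_finite_allI finite_I)
  then have "wpa1 M (\<lambda>n \<omega>. \<forall>i\<in>I n. k n (W i \<omega>, obs (J n) \<omega>) = 0)"
    by (rule wpa1_AE[OF always_eventually, OF allI])
  then show ?thesis
  proof (rule wpa1_mp2[OF ae], intro always_eventually allI ballI impI)
    fix n \<omega> i assume \<omega>: "\<omega> \<in> space M" and a: "AE w in F0. (w, obs (J n) \<omega>) \<in> D n"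
      and k: "\<forall>i\<in>I n. k n (W i \<omega>, obs (J n) \<omega>) = 0" and i: "i \<in> I n"
    have "(\<integral>\<^sup>+w. b n (w, obs (J n) \<omega>) \<partial>F0) = (\<integral>\<^sup>+w. 0 \<partial>F0)"
      by (rule nn_integral_cong_AE) (use a in eventually_elim, simp add: b_def)
    then have "b n (W i \<omega>, obs (J n) \<omega>) = 0" using k i by (auto simp: k_def split: if_splits)
    moreover have "(W i \<omega>, obs (J n) \<omega>) \<in> space (F0 \<Otimes>\<^sub>M PiM (J n) (\<lambda>_. F0))"
      by (rule measurable_space[OF measurable_W_obs[OF I_ge_1[OF i] J_sub] \<omega>])
    ultimately show "(W i \<omega>, obs (J n) \<omega>) \<in> D n"
      by (auto simp: b_def indicator_def split: if_splits)
  qed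
qed

end

section \<open>Sums and averages over the whole sample\<close>

context iid_sample
begin

sublocale full: cross_fit M F0 W "\<lambda>n. {1..n}" "\<lambda>_. {}"
  by standard auto

text \<open>The second moment of the normalized sum is bounded uniformly in n. This gives the
  tightness used for the limit law and the boundedness used in the linearization.\<close>

lemma normalized_sum_bounded:
  fixes f :: "'w \<Rightarrow> 'c::euclidean_space"
  assumes f[measurable]: "f \<in> borel_measurable F0"
    and sq: "integrable F0 (\<lambda>w. (norm (f w))\<^sup>2)" and 0: "(\<integral>w. f w \<partial>F0) = 0"
  shows "bounded_in_prob M (\<lambda>n \<omega>. (\<Sum>i\<in>{1..n}. f (W i \<omega>)) /\<^sub>R sqrt (real n))" (is "bounded_in_prob M ?S")
proof -
  define c where "c = (\<integral>w. (norm (f w))\<^sup>2 \<partial>F0)"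
  have c: "c \<ge> 0" by (simp add: c_def)
  have fW[measurable]: "(\<lambda>\<omega>. \<Sum>i\<in>{1..n}. f (W i \<omega>)) \<in> borel_measurable M" for n
    using measurable_compose[OF measurable_W f] by (intro borel_measurable_sum) simp
  have "(\<integral>\<^sup>+\<omega>. ennreal ((norm (?S n \<omega>))\<^sup>2) \<partial>M) \<le> ennreal c" for n
  proof (cases "n = 0")
    case False
    have *: "(\<integral>\<^sup>+\<omega>. ennreal ((norm (\<Sum>i\<in>{1..n}. f (fst (W i \<omega>, obs {} \<omega>))))\<^sup>2) \<partial>M)
        \<le> ennreal (real (card {1..n}) * c)"
      by (rule second_moment_sum_le[where k = "\<lambda>p. f (fst p)"])
         (auto simp: 0 c c_def nn_integral_eq_integral[OF sq])
    have "(\<integral>\<^sup>+\<omega>. ennreal ((norm (?S n \<omega>))\<^sup>2) \<partial>M)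
        = ennreal (1 / real n) * (\<integral>\<^sup>+\<omega>. ennreal ((norm (\<Sum>i\<in>{1..n}. f (W i \<omega>)))\<^sup>2) \<partial>M)"
    proof -
      have "(norm (?S n \<omega>))\<^sup>2 = 1 / real n * (norm (\<Sum>i\<in>{1..n}. f (W i \<omega>)))\<^sup>2" for \<omega>
        by (simp add: inverse_eq_divide power_divide)
      then have "ennreal ((norm (?S n \<omega>))\<^sup>2)
          = ennreal (1 / real n) * ennreal ((norm (\<Sum>i\<in>{1..n}. f (W i \<omega>)))\<^sup>2)" for \<omega>
        by (simp only:) (rule ennreal_mult, auto)
      then show ?thesis by (simp only:) (rule nn_integral_cmult, measurable)
    qed
    also have "\<dots> \<le> ennreal (1 / real n) * ennreal (real n * c)"
      using * by (intro mult_left_mono) auto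
    also have "\<dots> = ennreal c" using False c by (simp add: ennreal_mult[symmetric])
    finally show ?thesis .
  qed (simp add: c)
  then have "bounded_in_prob M (\<lambda>n \<omega>. (norm (?S n \<omega>))\<^sup>2)"
    using fW c
    by (intro bounded_in_prob_markov[where Y = "\<lambda>n \<omega>. (norm (?S n \<omega>))\<^sup>2" and c = c] wpa1_always)
       auto
  then show ?thesis
    by (rule bounded_in_prob_wpa1[where f = sqrt])
       (auto intro!: wpa1_always real_le_rsqrt simp del: norm_scaleR)
qed

text \<open>Jacobians and outer squares come with a first moment only, so a direct variance bound is
  impossible. The part of \<open>f\<close> beyond the truncation level vanishes in mean; the
  truncated part is handled by the centered sums.\<close>

lemma weak_law_of_large_numbers:
  fixes f :: "'w \<Rightarrow> 'c::euclidean_space"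
  assumes f: "integrable F0 f"
  shows "tends_in_prob M (\<lambda>n \<omega>. (\<Sum>i\<in>{1..n}. f (W i \<omega>)) /\<^sub>R real n) (\<integral>w. f w \<partial>F0)"
proof -
  have [measurable]: "f \<in> borel_measurable F0" using f by auto
  text \<open>Truncation at the level \<open>K n\<close>: slow enough for the truncated variance to be \<open>o(n)\<close>.\<close>
  define K where "K n = sqrt (sqrt (real n))" for n :: nat
  define t where "t n w = (if norm (f w) \<le> K n then f w else 0)" for n w
  have [measurable]: "t n \<in> borel_measurable F0" for n unfolding t_def by measurable
  have K_top: "filterlim K at_top sequentially"
    unfolding K_def
    by (intro filterlim_compose[OF sqrt_at_top] filterlim_real_sequentially)
  have ptw: "(\<lambda>n. t n w) \<longlonglongrightarrow> f w" for w
  proof (rule tendsto_eventually)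
    have "\<forall>\<^sub>F n in sequentially. norm (f w) \<le> K n"
      using K_top by (simp add: filterlim_at_top)
    then show "\<forall>\<^sub>F n in sequentially. t n w = f w"
      by eventually_elim (simp add: t_def)
  qed
  have tint: "integrable F0 (t n)" for n
    by (rule Bochner_Integration.integrable_bound[OF f]) (auto simp: t_def)
  have mean: "(\<lambda>n. \<integral>w. t n w \<partial>F0) \<longlonglongrightarrow> (\<integral>w. f w \<partial>F0)"
    by (rule integral_dominated_convergence[where w = "\<lambda>w. norm (f w)"])
       (use f ptw in \<open>auto simp: t_def\<close>)
  have "(\<lambda>n. \<integral>w. norm (f w - t n w) \<partial>F0) \<longlonglongrightarrow> (\<integral>w. 0 \<partial>F0)"
  proof (rule integral_dominated_convergence[where w = "\<lambda>w. norm (f w)"])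
    show "AE w in F0. (\<lambda>n. norm (f w - t n w)) \<longlonglongrightarrow> 0"
      using ptw by (intro AE_I2) (auto intro!: tendsto_eq_intros)
  qed (use f in \<open>auto simp: t_def\<close>)
  then have l1: "(\<lambda>n. ennreal (\<integral>w. norm (f w - t n w) \<partial>F0)) \<longlonglongrightarrow> 0"
    using tendsto_ennrealI by fastforce
  have "tends_in_prob M (\<lambda>n \<omega>. (\<Sum>i\<in>{1..n}. norm (f (fst (W i \<omega>, obs {} \<omega>)) - t n (fst (W i \<omega>, obs {} \<omega>)))) / real n) 0"
  proof (rule full.mean_tends_0[where h = "\<lambda>n p. norm (f (fst p) - t n (fst p))"])
    have "(\<integral>\<^sup>+w. ennreal (norm (f w - t n w)) \<partial>F0) = ennreal (\<integral>w. norm (f w - t n w) \<partial>F0)" for n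
      using f tint by (intro nn_integral_eq_integral) auto
    then show "tends_in_prob M (\<lambda>n \<omega>. \<integral>\<^sup>+w. ennreal (norm (f (fst (w, obs {} \<omega>)) - t n (fst (w, obs {} \<omega>)))) \<partial>F0) 0"
      using tends_in_prob_real_seq[OF l1] by simp
  qed auto
  then have "tends_in_prob M (\<lambda>n \<omega>. (\<Sum>i\<in>{1..n}. norm (f (W i \<omega>) - t n (W i \<omega>))) / real n) 0" by simp
  then have A: "tends_in_prob M (\<lambda>n \<omega>. (\<Sum>i\<in>{1..n}. f (W i \<omega>) - t n (W i \<omega>)) /\<^sub>R real n) 0"
    by (rule tends_in_prob_squeeze)
       (auto intro!: wpa1_always divide_right_mono norm_sum simp: divide_inverse[symmetric] field_simps)
  \<comment> \<open>Dividing by the square root of n in advance turns the normalization of centered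
    sums into that of averages. With the level n^(1/4) the mean square of \<open>s n\<close> is at
    most the square root of n divided by n.\<close>
  define s where "s n w = t n w /\<^sub>R sqrt (real n)" for n w
  have [measurable]: "s n \<in> borel_measurable F0" for n unfolding s_def by measurable
  have ssq: "(\<integral>\<^sup>+w. ennreal ((norm (s n w))\<^sup>2) \<partial>F0) \<le> ennreal (1 / sqrt (real n))" for n
  proof -
    have "(norm (s n w))\<^sup>2 \<le> 1 / sqrt (real n)" for w
    proof (cases "n = 0")
      case False
      have "norm (t n w) \<le> K n" by (simp add: t_def K_def)
      then have "(norm (t n w))\<^sup>2 \<le> (K n)\<^sup>2" by (rule power_mono) simp
      also have "\<dots> = sqrt (real n)" by (simp add: K_def)
      finally have "(norm (t n w))\<^sup>2 / real n \<le> sqrt (real n) / real n" by (rule divide_right_mono) simp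
      also have "\<dots> = 1 / sqrt (real n)" using False by (simp add: real_div_sqrt field_simps)
      finally show ?thesis
        by (simp add: s_def inverse_eq_divide power_divide)
    qed (simp add: s_def)
    then have "(\<integral>\<^sup>+w. ennreal ((norm (s n w))\<^sup>2) \<partial>F0) \<le> (\<integral>\<^sup>+w. ennreal (1 / sqrt (real n)) \<partial>F0)"
      by (intro nn_integral_mono ennreal_leI)
    then show ?thesis by (simp add: F0.emeasure_space_1)
  qed
  have "(\<lambda>n. 1 / sqrt (real n)) \<longlonglongrightarrow> 0"
    by (intro tendsto_divide_0[OF tendsto_const] filterlim_at_top_imp_at_infinity
        filterlim_compose[OF sqrt_at_top] filterlim_real_sequentially)
  then have "(\<lambda>n. ennreal (1 / sqrt (real n))) \<longlonglongrightarrow> 0"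
    using tendsto_ennrealI by fastforce
  then have lim0: "(\<lambda>n. \<integral>\<^sup>+w. ennreal ((norm (s n w))\<^sup>2) \<partial>F0) \<longlonglongrightarrow> 0"
    by (rule tendsto_sandwich[OF _ _ tendsto_const, rotated 2]) (auto simp: ssq)
  have "tends_in_prob M (\<lambda>n \<omega>. (\<Sum>i\<in>{1..n}. s n (fst (W i \<omega>, obs {} \<omega>))
      - (\<integral>w. s n (fst (w, obs {} \<omega>)) \<partial>F0)) /\<^sub>R sqrt (real n)) 0"
    by (rule full.centered_sum_tends_0[where h = "\<lambda>n p. s n (fst p)"])
       (use tends_in_prob_real_seq[OF lim0] in auto)
  then have B: "tends_in_prob M (\<lambda>n \<omega>. (\<Sum>i\<in>{1..n}. s n (W i \<omega>) - (\<integral>w. s n w \<partial>F0)) /\<^sub>R sqrt (real n)) 0"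
    by simp
  have sum: "tends_in_prob M (\<lambda>n \<omega>. (\<Sum>i\<in>{1..n}. f (W i \<omega>) - t n (W i \<omega>)) /\<^sub>R real n
      + (\<Sum>i\<in>{1..n}. s n (W i \<omega>) - (\<integral>w. s n w \<partial>F0)) /\<^sub>R sqrt (real n) + (\<integral>w. t n w \<partial>F0))
      (0 + 0 + (\<integral>w. f w \<partial>F0))"
    by (intro tends_in_prob_add A B tends_in_prob_real_seq mean)
  have eq: "(\<Sum>i\<in>{1..n}. f (W i \<omega>) - t n (W i \<omega>)) /\<^sub>R real n
      + (\<Sum>i\<in>{1..n}. s n (W i \<omega>) - (\<integral>w. s n w \<partial>F0)) /\<^sub>R sqrt (real n) + (\<integral>w. t n w \<partial>F0)
      = (\<Sum>i\<in>{1..n}. f (W i \<omega>)) /\<^sub>R real n" if "n \<noteq> 0" for n \<omega>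
  proof -
    have "(\<Sum>i\<in>{1..n}. s n (W i \<omega>) - (\<integral>w. s n w \<partial>F0)) /\<^sub>R sqrt (real n)
        = (\<Sum>i\<in>{1..n}. t n (W i \<omega>)) /\<^sub>R real n - (\<integral>w. t n w \<partial>F0)"
    proof -
      have "(\<Sum>i\<in>{1..n}. s n (W i \<omega>) - (\<integral>w. s n w \<partial>F0))
          = ((\<Sum>i\<in>{1..n}. t n (W i \<omega>)) - real n *\<^sub>R (\<integral>w. t n w \<partial>F0)) /\<^sub>R sqrt (real n)"
        by (simp add: s_def sum_subtractf scaleR_sum_right[symmetric] scaleR_diff_right scaleR_left_commute
            sum_constant_scaleR)
      moreover have "inverse (sqrt (real n)) * (inverse (sqrt (real n)) * real n) = 1"
        using that by (simp add: field_simps)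
      ultimately show ?thesis using that
        by (simp add: scaleR_diff_right inverse_mult_distrib[symmetric])
    qed
    then show ?thesis by (simp add: sum_subtractf scaleR_diff_right)
  qed
  have "wpa1 M (\<lambda>n \<omega>. (\<Sum>i\<in>{1..n}. f (W i \<omega>) - t n (W i \<omega>)) /\<^sub>R real n
      + (\<Sum>i\<in>{1..n}. s n (W i \<omega>) - (\<integral>w. s n w \<partial>F0)) /\<^sub>R sqrt (real n) + (\<integral>w. t n w \<partial>F0)
      = (\<Sum>i\<in>{1..n}. f (W i \<omega>)) /\<^sub>R real n)"
    by (rule wpa1_AE, rule eventually_mono[OF eventually_gt_at_top[of 0]]) (use eq in auto)
  from tends_in_prob_cong[OF sum this] show ?thesis by simp
qed

end

section \<open>Central limit theorem\<close>

context iid_sample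
begin

text \<open>Only the projection \<open>t \<bullet> f w\<close> with variance \<open>v\<close>
  matters. For positive \<open>v\<close> the univariate theorem applies to the sum divided by the
  square root of \<open>v\<close>, which the test function multiplies back; for \<open>v = 0\<close>
  the projection vanishes almost surely and both sides equal \<open>cos b\<close>.\<close>

lemma cos_expectation_clt:
  fixes f :: "'w \<Rightarrow> real^'n"
  assumes f[measurable]: "f \<in> borel_measurable F0"
    and sq: "integrable F0 (\<lambda>w. (norm (f w))\<^sup>2)" and 0: "(\<integral>w. f w \<partial>F0) = 0"
    and V: "\<And>t. t \<bullet> (V *v t) = (\<integral>w. (t \<bullet> f w)\<^sup>2 \<partial>F0)"
    and N: "is_multivariate_normal N 0 V"
  shows "(\<lambda>n. \<integral>\<omega>. cos (t \<bullet> ((\<Sum>i\<in>{1..n}. f (W i \<omega>)) /\<^sub>R sqrt (real n)) + b) \<partial>M)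
    \<longlonglongrightarrow> (\<integral>x. cos (t \<bullet> x + b) \<partial>N)"
proof -
  define v where "v = t \<bullet> (V *v t)"
  have v0: "v \<ge> 0" using N by (simp add: is_multivariate_normal_def pos_semidef_def v_def)
  have setsN[measurable_cong]: "sets N = sets borel" using N by (simp add: is_multivariate_normal_def)
  have fin: "(\<integral>\<^sup>+w. ennreal ((norm (f w))\<^sup>2) \<partial>F0) < \<infinity>"
    using nn_integral_eq_integral[OF sq] by simp
  have int: "integrable F0 f" by (rule F0.square_integrable_norm_imp_integrable(1)[OF f fin])
  have int2: "integrable F0 (\<lambda>w. (t \<bullet> f w)\<^sup>2)"
  proof (rule Bochner_Integration.integrable_bound)
    show "integrable F0 (\<lambda>w. (norm t)\<^sup>2 * (norm (f w))\<^sup>2)" using sq by simp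
    show "AE w in F0. norm ((t \<bullet> f w)\<^sup>2) \<le> norm ((norm t)\<^sup>2 * (norm (f w))\<^sup>2)"
    proof (rule AE_I2)
      fix w
      have "\<bar>t \<bullet> f w\<bar>\<^sup>2 \<le> (norm t * norm (f w))\<^sup>2" by (intro power_mono Cauchy_Schwarz_ineq2) simp
      then show "norm ((t \<bullet> f w)\<^sup>2) \<le> norm ((norm t)\<^sup>2 * (norm (f w))\<^sup>2)"
        by (simp add: power_mult_distrib)
    qed
  qed measurable
  have "(\<integral>x. cos (t \<bullet> x + b) \<partial>N) = (\<integral>y. cos (y + b) \<partial>distr N borel (\<lambda>x. t \<bullet> x))"
    by (subst integral_distr) auto
  also have "distr N borel (\<lambda>x. t \<bullet> x) = normal_law 0 v"
    using N by (simp add: is_multivariate_normal_def v_def)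
  also have "(\<integral>y. cos (y + b) \<partial>normal_law 0 v) = (\<integral>y. cos (sqrt v * y + b) \<partial>std_normal_distribution)"
    unfolding normal_law_eq_distr[OF v0] by (subst integral_distr) auto
  finally have rhs: "(\<integral>x. cos (t \<bullet> x + b) \<partial>N) = (\<integral>y. cos (sqrt v * y + b) \<partial>std_normal_distribution)" .
  have tsum: "t \<bullet> ((\<Sum>i\<in>{1..n}. f (W i \<omega>)) /\<^sub>R sqrt (real n))
      = (\<Sum>i<n. t \<bullet> f (W (Suc i) \<omega>)) / sqrt (real n)" for n \<omega>
    by (simp add: inner_sum_right sum.atLeast1_atMost_eq divide_inverse mult.commute)
  \<comment> \<open>The sample is indexed from 1, the univariate theorem from 0.\<close>
  define X where "X i \<omega> = t \<bullet> f (W (Suc i) \<omega>)" for i \<omega>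
  show ?thesis
  proof (cases "v = 0")
    case True
    interpret Z: prob_space std_normal_distribution by (rule prob_space_normal_density) simp
    have "AE w in F0. (t \<bullet> f w)\<^sup>2 = 0"
      using V[of t] True int2 integral_nonneg_eq_0_iff_AE[OF int2] by (simp add: v_def)
    then have ae: "AE w in F0. t \<bullet> f w = 0" by simp
    have "AE \<omega> in M. X i \<omega> = 0" for i
    proof -
      have "distr M F0 (W (Suc i)) = F0" by (rule ident) simp
      then have "AE w in distr M F0 (W (Suc i)). t \<bullet> f w = 0" using ae by (simp only:)
      then show ?thesis
        unfolding X_def by (subst (asm) AE_distr_iff) (auto intro: measurable_W)
    qed
    then have aeX: "AE \<omega> in M. \<forall>i. X i \<omega> = 0" by (simp add: AE_all_countable)
    have "(\<integral>\<omega>. cos (t \<bullet> ((\<Sum>i\<in>{1..n}. f (W i \<omega>)) /\<^sub>R sqrt (real n)) + b) \<partial>M) = (\<integral>\<omega>. cos b \<partial>M)" for n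
    proof (rule integral_cong_AE)
      have [measurable]: "(\<lambda>\<omega>. \<Sum>i\<in>{1..n}. f (W i \<omega>)) \<in> borel_measurable M"
        using measurable_compose[OF measurable_W f] by (intro borel_measurable_sum) simp
      show "(\<lambda>\<omega>. cos (t \<bullet> ((\<Sum>i\<in>{1..n}. f (W i \<omega>)) /\<^sub>R sqrt (real n)) + b)) \<in> borel_measurable M"
        by measurable
      show "AE \<omega> in M. cos (t \<bullet> ((\<Sum>i\<in>{1..n}. f (W i \<omega>)) /\<^sub>R sqrt (real n)) + b) = cos b"
        using aeX unfolding tsum by eventually_elim (simp add: X_def)
    qed simp
    then show ?thesis using True Z.prob_space by (simp add: rhs prob_space)
  next
    case False
    then have v: "v > 0" using v0 by simp
    have "indep_vars (\<lambda>j. PiM {Suc j} (\<lambda>_. F0)) (\<lambda>j \<omega>. restrict (\<lambda>i. W i \<omega>) {Suc j}) UNIV"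
      by (rule indep_vars_restrict[OF indep]) (auto simp: disjoint_family_on_def)
    then have "indep_vars (\<lambda>_. borel) (\<lambda>j \<omega>. t \<bullet> f (restrict (\<lambda>i. W i \<omega>) {Suc j} (Suc j))) UNIV"
    proof (rule indep_vars_compose2)
      fix j :: nat
      have [measurable]: "(\<lambda>x. x (Suc j)) \<in> measurable (PiM {Suc j} (\<lambda>_. F0)) F0"
        by (rule measurable_component_singleton) simp
      show "(\<lambda>x. t \<bullet> f (x (Suc j))) \<in> borel_measurable (PiM {Suc j} (\<lambda>_. F0))" by measurable
    qed
    then have ind: "indep_vars (\<lambda>_. borel) X UNIV" by (simp add: X_def[abs_def])
    have WF: "(\<integral>\<omega>. h (W (Suc i) \<omega>) \<partial>M) = (\<integral>w. h w \<partial>F0)"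
      if [measurable]: "h \<in> borel_measurable F0" for h :: "'w \<Rightarrow> real" and i
      using integral_distr[OF measurable_W[of "Suc i"] that] ident[of "Suc i"] by simp
    have mean: "expectation (X i) = 0" for i
      unfolding X_def using WF[of "\<lambda>w. t \<bullet> f w"] int 0 by simp
    have Xsq: "expectation (\<lambda>\<omega>. (X i \<omega>)\<^sup>2) = v" for i
      unfolding X_def using WF[of "\<lambda>w. (t \<bullet> f w)\<^sup>2"] V[of t] by (simp add: v_def)
    have "weak_conv_m (\<lambda>n. distr M borel (\<lambda>x. (\<Sum>i<n. X i x) / sqrt (real n * (sqrt v)\<^sup>2))) std_normal_distribution"
    proof (rule central_limit_theorem_zero_mean[OF ind mean])
      show "0 < sqrt v" using v by simp
      show "integrable M (\<lambda>x. (X n x)\<^sup>2)" for n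
        unfolding X_def using int2 ident[of "Suc n"]
        by (subst integrable_distr_eq[OF measurable_W, symmetric, of "Suc n" "\<lambda>w. (t \<bullet> f w)\<^sup>2"]) auto
      show "variance (X n) = (sqrt v)\<^sup>2" for n
        using v by (simp add: mean Xsq)
      show "distr M borel (X n) = distr F0 borel (\<lambda>w. t \<bullet> f w)" for n
      proof -
        have "distr (distr M F0 (W (Suc n))) borel (\<lambda>w. t \<bullet> f w) = distr M borel (X n)"
          unfolding X_def by (subst distr_distr) (auto intro: measurable_W simp: comp_def)
        then show ?thesis using ident[of "Suc n"] by simp
      qed
    qed
    then have wc: "weak_conv_m (\<lambda>n. distr M borel (\<lambda>x. (\<Sum>i<n. X i x) / sqrt (real n * v))) std_normal_distribution"
      using v by simp
    have Xm: "(\<lambda>x. (\<Sum>i<n. X i x) / sqrt (real n * v)) \<in> borel_measurable M" for n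
      using measurable_compose[OF measurable_W f] unfolding X_def
      by (intro borel_measurable_divide borel_measurable_sum borel_measurable_inner) auto
    have rd: "real_distribution (distr M borel (\<lambda>x. (\<Sum>i<n. X i x) / sqrt (real n * v)))" for n
      using prob_space_distr[OF Xm, of n] by (simp add: real_distribution_def real_distribution_axioms_def)
    have "(\<lambda>n. \<integral>y. cos (sqrt v * y + b) \<partial>distr M borel (\<lambda>x. (\<Sum>i<n. X i x) / sqrt (real n * v)))
        \<longlonglongrightarrow> (\<integral>y. cos (sqrt v * y + b) \<partial>std_normal_distribution)"
      by (rule weak_conv_imp_integral_bdd_continuous_conv[OF rd real_dist_normal_dist wc, where B = 1]) auto
    moreover have "(\<integral>y. cos (sqrt v * y + b) \<partial>distr M borel (\<lambda>x. (\<Sum>i<n. X i x) / sqrt (real n * v)))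
        = (\<integral>\<omega>. cos (t \<bullet> ((\<Sum>i\<in>{1..n}. f (W i \<omega>)) /\<^sub>R sqrt (real n)) + b) \<partial>M)" for n
    proof -
      have "sqrt v * ((\<Sum>i<n. X i \<omega>) / sqrt (real n * v)) = t \<bullet> ((\<Sum>i\<in>{1..n}. f (W i \<omega>)) /\<^sub>R sqrt (real n))" for \<omega>
        unfolding tsum using v by (simp add: X_def real_sqrt_mult)
      then show ?thesis using Xm[of n] by (subst integral_distr) auto
    qed
    ultimately show ?thesis by (simp add: rhs)
  qed
qed

text \<open>Cosine expectations of \<open>X n\<close> and of the normalized sum have the same limit,
  and \<open>X n\<close> inherits tightness from the sum.\<close>

lemma asymptotically_linear_converges_weakly:
  fixes f :: "'w \<Rightarrow> real^'n"
  assumes f[measurable]: "f \<in> borel_measurable F0"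
    and sq: "integrable F0 (\<lambda>w. (norm (f w))\<^sup>2)" and 0: "(\<integral>w. f w \<partial>F0) = 0"
    and V: "\<And>t. t \<bullet> (V *v t) = (\<integral>w. (t \<bullet> f w)\<^sup>2 \<partial>F0)"
    and N: "is_multivariate_normal N 0 V"
    and X[measurable]: "\<And>n. X n \<in> borel_measurable M"
    and lin: "tends_in_prob M (\<lambda>n \<omega>. X n \<omega> - (\<Sum>i\<in>{1..n}. f (W i \<omega>)) /\<^sub>R sqrt (real n)) 0"
  shows "converges_weakly (\<lambda>n. distr M borel (X n)) N"
proof (rule converges_weakly_if_cos_converges[OF X])
  show "prob_space N" "sets N = sets borel" using N by (simp_all add: is_multivariate_normal_def)
  have [measurable]: "(\<lambda>\<omega>. (\<Sum>i\<in>{1..n}. f (W i \<omega>)) /\<^sub>R sqrt (real n)) \<in> borel_measurable M" for n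
    using measurable_compose[OF measurable_W f] by (intro borel_measurable_scaleR borel_measurable_sum) auto
  show "(\<lambda>n. \<integral>\<omega>. cos (t \<bullet> X n \<omega> + b) \<partial>M) \<longlonglongrightarrow> (\<integral>x. cos (t \<bullet> x + b) \<partial>N)" for t b
  proof -
    have "(\<lambda>n. (\<integral>\<omega>. cos (t \<bullet> X n \<omega> + b) \<partial>M)
        - (\<integral>\<omega>. cos (t \<bullet> ((\<Sum>i\<in>{1..n}. f (W i \<omega>)) /\<^sub>R sqrt (real n)) + b) \<partial>M)) \<longlonglongrightarrow> 0"
      by (rule cos_expectation_diff_tends_0[OF X _ lin]) measurable
    from tendsto_add[OF this cos_expectation_clt[OF f sq 0 V N, of t b]] show ?thesis by simp
  qed
  show "bounded_in_prob M X"
    using bounded_in_prob_add[OF tends_in_prob_bounded[OF lin] normalized_sum_bounded[OF f sq 0]] by simp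
qed

end

section \<open>Continuity of matrix operations\<close>

lemma norm_matrix_vector_mult_le: "norm (A *v x) \<le> norm A * norm x" for A :: "real^'n^'m"
proof -
  have "norm (A *v x) \<le> L2_set (\<lambda>i. norm (A $ i) * norm x) UNIV"
    unfolding norm_vec_def[of "A *v x"]
    by (rule L2_set_mono) (auto simp: matrix_vector_mul_component Cauchy_Schwarz_ineq2)
  also have "\<dots> = norm A * norm x"
    by (simp add: norm_vec_def[of A] L2_set_right_distrib mult.commute)
  finally show ?thesis .
qed

lemma tendsto_matrix_mult [tendsto_intros]:
  fixes A :: "'x \<Rightarrow> real^'n^'m" and B :: "'x \<Rightarrow> real^'k^'n"
  assumes "(A \<longlongrightarrow> a) F" "(B \<longlongrightarrow> b) F"
  shows "((\<lambda>x. A x ** B x) \<longlongrightarrow> a ** b) F"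
  unfolding matrix_matrix_mult_def by (intro vec_tendstoI) (auto intro!: tendsto_intros assms)

lemma tendsto_transpose [tendsto_intros]:
  fixes A :: "'x \<Rightarrow> real^'n^'m"
  assumes "(A \<longlongrightarrow> a) F"
  shows "((\<lambda>x. transpose (A x)) \<longlongrightarrow> transpose a) F"
  unfolding transpose_def by (intro vec_tendstoI) (auto intro!: tendsto_intros assms)

lemma tendsto_det [tendsto_intros]:
  fixes A :: "'x \<Rightarrow> real^'n^'n"
  assumes "(A \<longlongrightarrow> a) F"
  shows "((\<lambda>x. det (A x)) \<longlongrightarrow> det a) F"
  unfolding det_def by (auto intro!: tendsto_intros assms)

lemma matrix_vector_mult_minus_left: "(- A) *v x = - (A *v x)" for A :: "real^'n^'m"
  by (simp add: matrix_vector_mult_def vec_eq_iff sum_negf)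

lemma
  assumes "invertible A"
  shows matrix_inv_right: "A ** matrix_inv A = mat 1"
    and matrix_inv_left: "matrix_inv A ** A = mat 1"
  using assms unfolding invertible_def matrix_inv_def by (metis (mono_tags, lifting) someI_ex)+

text \<open>Each entry of the inverse is a quotient of two determinants, so continuity of inversion
  reduces to continuity of determinants.\<close>

lemma matrix_inv_component_cramer:
  fixes A :: "real^'n^'n"
  assumes "det A \<noteq> 0"
  shows "matrix_inv A $ j $ k = det (\<chi> i l. if l = j then axis k 1 $ i else A $ i $ l) / det A"
proof -
  have inv: "invertible A" using assms by (simp add: invertible_det_nz)
  have "A *v (matrix_inv A *v axis k 1) = axis k 1"
    by (simp add: matrix_vector_mul_assoc matrix_inv_right[OF inv])
  then have "matrix_inv A *v axis k 1 =
      (\<chi> j. det (\<chi> i l. if l = j then axis k 1 $ i else A $ i $ l) / det A)"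
    using cramer[OF assms] by blast
  moreover have "matrix_inv A $ j $ k = (matrix_inv A *v axis k 1) $ j"
    by (simp add: matrix_vector_mult_basis column_def)
  ultimately show ?thesis by simp
qed

lemma tendsto_matrix_inv [tendsto_intros]:
  fixes A :: "'x \<Rightarrow> real^'n^'n"
  assumes A: "(A \<longlongrightarrow> a) F" and inv: "invertible a"
  shows "((\<lambda>x. matrix_inv (A x)) \<longlongrightarrow> matrix_inv a) F"
proof (intro vec_tendstoI)
  fix j k
  have nz: "det a \<noteq> 0" using inv by (simp add: invertible_det_nz)
  \<comment> \<open>\<open>matrix_inv\<close> is an arbitrary choice at singular matrices, so the
    formula for its entries is available only eventually.\<close>
  have ev: "\<forall>\<^sub>F x in F. det (A x) \<noteq> 0"
    using tendsto_det[OF A] nz by (rule tendsto_imp_eventually_ne)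
  have "((\<lambda>x. (\<chi> i l. if l = j then axis k 1 $ i else A x $ i $ l) :: real^'n^'n)
      \<longlongrightarrow> (\<chi> i l. if l = j then axis k 1 $ i else a $ i $ l)) F"
  proof (rule vec_tendstoI, rule vec_tendstoI)
    fix i l
    show "((\<lambda>x. ((\<chi> i l. if l = j then axis k 1 $ i else A x $ i $ l) :: real^'n^'n) $ i $ l)
        \<longlongrightarrow> ((\<chi> i l. if l = j then axis k 1 $ i else a $ i $ l) :: real^'n^'n) $ i $ l) F"
      using tendsto_vec_nth[OF tendsto_vec_nth[OF A], of i l] by (cases "l = j") auto
  qed
  from tendsto_divide[OF tendsto_det[OF this] tendsto_det[OF A] nz]
  have "((\<lambda>x. det (\<chi> i l. if l = j then axis k 1 $ i else A x $ i $ l) / det (A x)) \<longlongrightarrow>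
      det (\<chi> i l. if l = j then axis k 1 $ i else a $ i $ l) / det a) F" .
  then show "((\<lambda>x. matrix_inv (A x) $ j $ k) \<longlongrightarrow> matrix_inv a $ j $ k) F"
    unfolding matrix_inv_component_cramer[OF nz, symmetric]
    by (rule Lim_transform_eventually)
       (use ev in eventually_elim, simp add: matrix_inv_component_cramer)
qed

lemma tendsto_gmm_variance:
  assumes "(G \<longlongrightarrow> g) F" "(U \<longlongrightarrow> u) F" "(P \<longlongrightarrow> p) F" "invertible (transpose g ** u ** g)"
  shows "((\<lambda>x. gmm_variance (G x) (U x) (P x)) \<longlongrightarrow> gmm_variance g u p) F"
  unfolding gmm_variance_def by (intro tendsto_intros assms)

lemma dot_matrix_vector_transpose: "(A *v x) \<bullet> y = x \<bullet> (transpose A *v y)" for A :: "real^'n^'m"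
  by (metis dot_lmul_matrix inner_commute transpose_matrix_vector)

section \<open>Linearization of the GMM estimator\<close>

text \<open>The mean value matrix: adding the rank one correction \<open>r u\<^sup>T / (u \<bullet> u)\<close> to the Jacobian at
  \<open>\<theta>0\<close>, with \<open>u = \<theta> - \<theta>0\<close> and \<open>r\<close> the remainder of the linearization, makes the expansion exact.\<close>

lemma mean_value_matrix:
  fixes f :: "real^'p \<Rightarrow> real^'m"
  assumes sub: "cball \<theta>0 (norm (\<theta> - \<theta>0)) \<subseteq> N"
    and diff: "\<And>\<eta>. \<eta> \<in> N \<Longrightarrow> f differentiable (at \<eta>)"
    and bd: "\<And>\<eta>. \<eta> \<in> cball \<theta>0 (norm (\<theta> - \<theta>0)) \<Longrightarrow>
      norm (jacobian f (at \<eta>) - jacobian f (at \<theta>0)) \<le> b"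
  obtains A where "f \<theta> = f \<theta>0 + A *v (\<theta> - \<theta>0)" "norm (A - jacobian f (at \<theta>0)) \<le> b"
proof -
  define J where "J \<eta> = jacobian f (at \<eta>)" for \<eta>
  define u where "u = \<theta> - \<theta>0"
  define r where "r = f \<theta> - f \<theta>0 - J \<theta>0 *v u"
  have b0: "0 \<le> b" using bd[of \<theta>0] by simp
  have "norm r \<le> norm (\<theta> - \<theta>0) * b"
    unfolding r_def u_def
  proof (rule differentiable_bound_linearization)
    show "\<theta>0 + t *\<^sub>R (\<theta> - \<theta>0) \<in> cball \<theta>0 (norm (\<theta> - \<theta>0))" if "t \<in> {0..1}" for t
      using that by (auto simp: dist_norm intro: mult_left_le_one_le)
    show "(f has_derivative (*v) (J x)) (at x within cball \<theta>0 (norm (\<theta> - \<theta>0)))"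
      if "x \<in> cball \<theta>0 (norm (\<theta> - \<theta>0))" for x
    proof -
      have "f differentiable (at x)" using diff that sub by blast
      then show ?thesis unfolding J_def jacobian_works by (rule has_derivative_at_withinI)
    qed
    show "onorm ((*v) (J x) - (*v) (J \<theta>0)) \<le> b" if "x \<in> cball \<theta>0 (norm (\<theta> - \<theta>0))" for x
      unfolding fun_diff_def
    proof (rule onorm_le)
      fix v
      have "norm (J x *v v - J \<theta>0 *v v) \<le> norm (J x - J \<theta>0) * norm v"
        by (metis matrix_vector_mult_diff_rdistrib norm_matrix_vector_mult_le)
      also have "\<dots> \<le> b * norm v" using bd[OF that] by (intro mult_right_mono) (auto simp: J_def)
      finally show "norm (J x *v v - J \<theta>0 *v v) \<le> b * norm v" .
    qed
  qed auto
  then have r: "norm r \<le> norm u * b" by (simp add: u_def)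
  define R :: "real^'p^'m" where "R = (\<chi> i j. r $ i * u $ j / (u \<bullet> u))"
  have R: "R *v u = r"
  proof (cases "u = 0")
    case True
    then show ?thesis using r by simp
  next
    case False
    have "(\<Sum>j\<in>UNIV. r $ i * u $ j / (u \<bullet> u) * u $ j) = r $ i" for i
    proof -
      have "(\<Sum>j\<in>UNIV. r $ i * u $ j / (u \<bullet> u) * u $ j) = r $ i / (u \<bullet> u) * (\<Sum>j\<in>UNIV. u $ j * u $ j)"
        by (simp add: sum_distrib_left mult_ac)
      also have "\<dots> = r $ i" using False by (simp add: inner_vec_def[of u u, simplified, symmetric])
      finally show ?thesis .
    qed
    then show ?thesis by (simp add: R_def vec_eq_iff matrix_vector_mult_def)
  qed
  have "norm R \<le> b"
  proof (cases "u = 0")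
    case False
    have "R = (1 / (u \<bullet> u)) *\<^sub>R (\<chi> i j. r $ i * u $ j)" by (simp add: R_def vec_eq_iff)
    then have "norm R = norm r * (norm u / (u \<bullet> u))" by (simp add: norm_rank_one)
    also have "\<dots> \<le> (norm u * b) * (norm u / (u \<bullet> u))"
      by (intro mult_right_mono r) auto
    also have "\<dots> = b"
      using False by (simp add: dot_square_norm power2_eq_square)
    finally show ?thesis .
  qed (simp add: R_def b0 zero_vec_def[symmetric])
  moreover have "f \<theta> = f \<theta>0 + (J \<theta>0 + R) *v (\<theta> - \<theta>0)"
    using R by (simp add: matrix_vector_mult_add_rdistrib r_def u_def algebra_simps)
  ultimately show ?thesis
    using that[of "J \<theta>0 + R"] by (simp add: J_def)
qed

text \<open>The derivative of the quadratic form vanishes at an interior minimizer. Symmetry of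
  \<open>U\<close> makes the two terms of the product rule equal, so each is 0, and this for every
  direction \<open>h\<close>.\<close>

lemma gmm_first_order_condition:
  fixes f :: "real^'p \<Rightarrow> real^'m"
  assumes min: "is_arg_min (\<lambda>\<theta>. f \<theta> \<bullet> (U *v f \<theta>)) (\<lambda>\<theta>. \<theta> \<in> \<Theta>) \<theta>"
    and N: "open N" "\<theta> \<in> N" "N \<subseteq> \<Theta>" and diff: "f differentiable (at \<theta>)"
    and sym: "transpose U = U"
  shows "transpose (jacobian f (at \<theta>)) *v (U *v f \<theta>) = 0"
proof -
  define J where "J = jacobian f (at \<theta>)"
  have d: "(f has_derivative (\<lambda>h. J *v h)) (at \<theta>)"
    using diff unfolding J_def by (simp add: jacobian_works)
  have dU: "((\<lambda>\<theta>. U *v f \<theta>) has_derivative (\<lambda>h. U *v (J *v h))) (at \<theta>)"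
    by (rule bounded_linear.has_derivative[OF matrix_vector_mul_bounded_linear d])
  have "(\<lambda>h. f \<theta> \<bullet> (U *v (J *v h)) + (J *v h) \<bullet> (U *v f \<theta>)) = (\<lambda>h. 0)"
  proof (rule differential_zero_maxmin[OF N(2,1)])
    show "((\<lambda>\<theta>. f \<theta> \<bullet> (U *v f \<theta>)) has_derivative
        (\<lambda>h. f \<theta> \<bullet> (U *v (J *v h)) + (J *v h) \<bullet> (U *v f \<theta>))) (at \<theta>)"
      by (rule has_derivative_inner[OF d dU])
    show "(\<forall>y\<in>N. f y \<bullet> (U *v f y) \<le> f \<theta> \<bullet> (U *v f \<theta>)) \<or> (\<forall>y\<in>N. f \<theta> \<bullet> (U *v f \<theta>) \<le> f y \<bullet> (U *v f y))"
      using min N(3) unfolding is_arg_min_def by (meson in_mono not_le)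
  qed
  moreover have "f \<theta> \<bullet> (U *v (J *v h)) = (J *v h) \<bullet> (U *v f \<theta>)" for h
    by (metis dot_matrix_vector_transpose inner_commute sym)
  ultimately have "(J *v h) \<bullet> (U *v f \<theta>) = 0" for h
    by (auto simp: fun_eq_iff)
  then have "h \<bullet> (transpose J *v (U *v f \<theta>)) = 0" for h
    by (simp add: dot_matrix_vector_transpose)
  then show ?thesis unfolding J_def by (metis inner_eq_zero_iff)
qed

lemma (in prob_space) tends_in_prob_matrix_vector_bounded:
  fixes A :: "nat \<Rightarrow> 'a \<Rightarrow> real^'n^'m"
  assumes "tends_in_prob M A 0" "bounded_in_prob M X"
  shows "tends_in_prob M (\<lambda>n \<omega>. A n \<omega> *v X n \<omega>) 0"
proof (rule tends_in_prob_squeeze)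
  have "tends_in_prob M (\<lambda>n \<omega>. norm (A n \<omega>)) 0"
    using assms(1) tends_in_prob_norm_iff[of A 0] by simp
  moreover have "bounded_in_prob M (\<lambda>n \<omega>. norm (X n \<omega>))"
    using assms(2) by (simp add: bounded_in_prob_def)
  ultimately show "tends_in_prob M (\<lambda>n \<omega>. norm (X n \<omega>) * norm (A n \<omega>)) 0"
    by (intro bounded_in_prob_mult)
  show "wpa1 M (\<lambda>n \<omega>. norm (A n \<omega> *v X n \<omega> - 0) \<le> norm (X n \<omega>) * norm (A n \<omega>))"
    by (rule wpa1_always) (metis diff_zero mult.commute norm_matrix_vector_mult_le)
qed

text \<open>Inserting the exact expansion into the first-order condition gives a linear equation for
  the estimation error \<open>u\<close>. The Hoelder bound at distance
  \<open>norm (u n \<omega>)\<close> vanishes by consistency, so both the Jacobian at the estimator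
  and the mean value matrix converge to \<open>G\<close>. The coefficient matrix is then invertible
  with probability tending to one, and its inverse converges.\<close>

lemma (in prob_space) gmm_linearization:
  fixes m :: "nat \<Rightarrow> 'a \<Rightarrow> real^'p \<Rightarrow> real^'m" and G :: "real^'p^'m"
  assumes N: "open N" "\<theta>0 \<in> N" "N \<subseteq> \<Theta>" and a: "a > 0"
    and smooth: "wpa1 M (\<lambda>n \<omega>. \<forall>\<theta>\<in>N. m n \<omega> differentiable (at \<theta>) \<and>
        norm (jacobian (m n \<omega>) (at \<theta>) - jacobian (m n \<omega>) (at \<theta>0)) \<le> K n \<omega> * norm (\<theta> - \<theta>0) powr a)"
    and K: "bounded_in_prob M K"
    and J: "tends_in_prob M (\<lambda>n \<omega>. jacobian (m n \<omega>) (at \<theta>0)) G"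
    and score: "tends_in_prob M (\<lambda>n \<omega>. sqrt (real n) *\<^sub>R m n \<omega> \<theta>0 - S n \<omega>) 0"
    and S: "bounded_in_prob M S"
    and weights: "\<And>n \<omega>. \<omega> \<in> space M \<Longrightarrow> transpose (U n \<omega>) = U n \<omega>"
    and argmin: "\<And>n \<omega>. \<omega> \<in> space M \<Longrightarrow>
        is_arg_min (\<lambda>\<theta>. m n \<omega> \<theta> \<bullet> (U n \<omega> *v m n \<omega> \<theta>)) (\<lambda>\<theta>. \<theta> \<in> \<Theta>) (\<theta>h n \<omega>)"
    and cons: "tends_in_prob M \<theta>h \<theta>0"
    and U: "tends_in_prob M U \<Upsilon>"
    and inv: "invertible (transpose G ** \<Upsilon> ** G)"
  shows "tends_in_prob M (\<lambda>n \<omega>. jacobian (m n \<omega>) (at (\<theta>h n \<omega>))) G"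
    and "tends_in_prob M (\<lambda>n \<omega>. sqrt (real n) *\<^sub>R (\<theta>h n \<omega> - \<theta>0)
        - (- (matrix_inv (transpose G ** \<Upsilon> ** G) ** transpose G ** \<Upsilon>)) *v S n \<omega>) 0"
proof -
  define u where "u n \<omega> = \<theta>h n \<omega> - \<theta>0" for n \<omega>
  define J0 where "J0 n \<omega> = jacobian (m n \<omega>) (at \<theta>0)" for n \<omega>
  define Jh where "Jh n \<omega> = jacobian (m n \<omega>) (at (\<theta>h n \<omega>))" for n \<omega>
  define b where "b n \<omega> = \<bar>K n \<omega>\<bar> * norm (u n \<omega>) powr a" for n \<omega>
  have "isCont (\<lambda>x. norm (x - \<theta>0) powr a) \<theta>0"
    unfolding isCont_def using a
    by (auto intro!: tendsto_zero_powrI[where b = a] tendsto_eq_intros)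
  from tends_in_prob_isCont[OF cons this] have "tends_in_prob M (\<lambda>n \<omega>. norm (u n \<omega>) powr a) 0"
    by (simp add: u_def)
  moreover have "bounded_in_prob M (\<lambda>n \<omega>. \<bar>K n \<omega>\<bar>)" using K by (simp add: bounded_in_prob_def)
  ultimately have b: "tends_in_prob M b 0"
    unfolding b_def by (rule bounded_in_prob_mult[rotated])
  obtain r where r: "r > 0" "ball \<theta>0 r \<subseteq> N" using N open_contains_ball by blast
  have near: "wpa1 M (\<lambda>n \<omega>. norm (\<theta>h n \<omega> - \<theta>0) < r)"
    using cons r unfolding tends_in_prob_iff_norm by blast
  have ex: "wpa1 M (\<lambda>n \<omega>. norm (Jh n \<omega> - J0 n \<omega>) \<le> b n \<omega> \<and>
      (\<exists>A. m n \<omega> (\<theta>h n \<omega>) = m n \<omega> \<theta>0 + A *v u n \<omega> \<and> norm (A - J0 n \<omega>) \<le> b n \<omega>) \<and>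
      transpose (Jh n \<omega>) *v (U n \<omega> *v m n \<omega> (\<theta>h n \<omega>)) = 0)"
  proof (rule wpa1_mp2[OF near smooth], intro always_eventually allI ballI impI)
    fix n \<omega> assume \<omega>: "\<omega> \<in> space M" and nr: "norm (\<theta>h n \<omega> - \<theta>0) < r"
      and sm: "\<forall>\<theta>\<in>N. m n \<omega> differentiable (at \<theta>) \<and>
        norm (jacobian (m n \<omega>) (at \<theta>) - jacobian (m n \<omega>) (at \<theta>0)) \<le> K n \<omega> * norm (\<theta> - \<theta>0) powr a"
    have sub: "cball \<theta>0 (norm (\<theta>h n \<omega> - \<theta>0)) \<subseteq> N"
      using nr r(2) by (auto simp: subset_iff)
    have bd: "norm (jacobian (m n \<omega>) (at \<eta>) - jacobian (m n \<omega>) (at \<theta>0)) \<le> b n \<omega>"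
      if "\<eta> \<in> cball \<theta>0 (norm (\<theta>h n \<omega> - \<theta>0))" for \<eta>
    proof -
      have "norm (jacobian (m n \<omega>) (at \<eta>) - jacobian (m n \<omega>) (at \<theta>0)) \<le> K n \<omega> * norm (\<eta> - \<theta>0) powr a"
        using sm sub that by blast
      also have "\<dots> \<le> \<bar>K n \<omega>\<bar> * norm (\<eta> - \<theta>0) powr a" by (intro mult_right_mono) auto
      also have "\<dots> \<le> b n \<omega>" unfolding b_def u_def using that a
        by (intro mult_left_mono powr_mono2) (auto simp: dist_norm norm_minus_commute)
      finally show ?thesis .
    qed
    obtain A where A: "m n \<omega> (\<theta>h n \<omega>) = m n \<omega> \<theta>0 + A *v (\<theta>h n \<omega> - \<theta>0)"
        "norm (A - jacobian (m n \<omega>) (at \<theta>0)) \<le> b n \<omega>"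
      by (rule mean_value_matrix[of \<theta>0 "\<theta>h n \<omega>" N "m n \<omega>" "b n \<omega>", OF sub _ bd]) (use sm in auto)
    have hN: "\<theta>h n \<omega> \<in> N" using sub by (auto simp: dist_norm norm_minus_commute)
    have "transpose (Jh n \<omega>) *v (U n \<omega> *v m n \<omega> (\<theta>h n \<omega>)) = 0"
      unfolding Jh_def using hN sm
      by (intro gmm_first_order_condition[OF argmin[OF \<omega>] N(1) _ N(3) _ weights[OF \<omega>]]) auto
    then show "norm (Jh n \<omega> - J0 n \<omega>) \<le> b n \<omega> \<and>
      (\<exists>A. m n \<omega> (\<theta>h n \<omega>) = m n \<omega> \<theta>0 + A *v u n \<omega> \<and> norm (A - J0 n \<omega>) \<le> b n \<omega>) \<and>
      transpose (Jh n \<omega>) *v (U n \<omega> *v m n \<omega> (\<theta>h n \<omega>)) = 0"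
      using A bd[of "\<theta>h n \<omega>"] unfolding u_def Jh_def J0_def
      by (auto simp: dist_norm norm_minus_commute)
  qed
  define P where "P n \<omega> A \<longleftrightarrow> m n \<omega> (\<theta>h n \<omega>) = m n \<omega> \<theta>0 + A *v u n \<omega> \<and> norm (A - J0 n \<omega>) \<le> b n \<omega>"
    for n \<omega> A
  \<comment> \<open>A mean value matrix is picked separately for every n and sample point, with no
    regard to measurability. It is meaningful only on the event \<open>ex\<close>, which has inner
    probability tending to one.\<close>
  define Gb where "Gb n \<omega> = (SOME A. P n \<omega> A)" for n \<omega>
  have Gb: "P n \<omega> (Gb n \<omega>)" if "\<exists>A. P n \<omega> A" for n \<omega>
    unfolding Gb_def using that by (rule someI_ex)
  have J: "tends_in_prob M J0 G" using J by (simp add: J0_def[abs_def])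
  have "tends_in_prob M (\<lambda>n \<omega>. Jh n \<omega> - J0 n \<omega>) 0"
    using b by (rule tends_in_prob_squeeze) (rule wpa1_mono[OF ex], simp)
  from tends_in_prob_add[OF this J] have Jh: "tends_in_prob M Jh G" by simp
  then show "tends_in_prob M (\<lambda>n \<omega>. jacobian (m n \<omega>) (at (\<theta>h n \<omega>))) G"
    by (simp add: Jh_def[abs_def])
  have "tends_in_prob M (\<lambda>n \<omega>. Gb n \<omega> - J0 n \<omega>) 0"
    using b by (rule tends_in_prob_squeeze) (rule wpa1_mono[OF ex], use Gb in \<open>auto simp: P_def\<close>)
  from tends_in_prob_add[OF this J] have Gb_lim: "tends_in_prob M Gb G" by simp
  define A where "A n \<omega> = transpose (Jh n \<omega>) ** U n \<omega> ** Gb n \<omega>" for n \<omega>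
  define B where "B n \<omega> = - (matrix_inv (A n \<omega>) ** transpose (Jh n \<omega>) ** U n \<omega>)" for n \<omega>
  define B0 where "B0 = - (matrix_inv (transpose G ** \<Upsilon> ** G) ** transpose G ** \<Upsilon>)"
  have trip: "tends_in_prob M (\<lambda>n \<omega>. (Jh n \<omega>, U n \<omega>, Gb n \<omega>)) (G, \<Upsilon>, G)"
    by (intro tends_in_prob_Pair Jh U Gb_lim)
  have "isCont (\<lambda>(j, u, g). det (transpose j ** u ** g)) (G, \<Upsilon>, G)"
    unfolding isCont_def case_prod_beta' by (auto intro!: tendsto_eq_intros)
  from tends_in_prob_isCont[OF trip this]
  have "tends_in_prob M (\<lambda>n \<omega>. det (A n \<omega>)) (det (transpose G ** \<Upsilon> ** G))"
    by (simp add: A_def)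
  then have invA: "wpa1 M (\<lambda>n \<omega>. det (A n \<omega>) \<in> - {0})"
    using inv unfolding tends_in_prob_def by (auto simp: invertible_det_nz)
  have "isCont (\<lambda>(j, u, g). - (matrix_inv (transpose j ** u ** g) ** transpose j ** u)) (G, \<Upsilon>, G)"
    unfolding isCont_def case_prod_beta' using inv
    by (auto intro!: tendsto_intros tendsto_fst[OF tendsto_ident_at, THEN tendsto_eq_rhs]
        tendsto_fst[OF tendsto_snd[OF tendsto_ident_at], THEN tendsto_eq_rhs]
        tendsto_snd[OF tendsto_snd[OF tendsto_ident_at], THEN tendsto_eq_rhs])
  from tends_in_prob_isCont[OF trip this] have "tends_in_prob M B B0"
    by (simp add: B_def[abs_def] A_def B0_def)
  from tends_in_prob_diff[OF this tends_in_prob_const[of B0]]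
  have B: "tends_in_prob M (\<lambda>n \<omega>. B n \<omega> - B0) 0" by simp
  have key: "wpa1 M (\<lambda>n \<omega>. u n \<omega> = B n \<omega> *v m n \<omega> \<theta>0)"
  proof (rule wpa1_mono[OF wpa1_conj[OF ex invA]])
    fix n \<omega>
    assume *: "(norm (Jh n \<omega> - J0 n \<omega>) \<le> b n \<omega> \<and>
      (\<exists>A. m n \<omega> (\<theta>h n \<omega>) = m n \<omega> \<theta>0 + A *v u n \<omega> \<and> norm (A - J0 n \<omega>) \<le> b n \<omega>) \<and>
      transpose (Jh n \<omega>) *v (U n \<omega> *v m n \<omega> (\<theta>h n \<omega>)) = 0) \<and> det (A n \<omega>) \<in> - {0}"
    then have mv: "m n \<omega> (\<theta>h n \<omega>) = m n \<omega> \<theta>0 + Gb n \<omega> *v u n \<omega>"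
      using Gb[of n \<omega>] by (auto simp: P_def)
    have iA: "invertible (A n \<omega>)" using * by (simp add: invertible_det_nz)
    have "(transpose (Jh n \<omega>) ** U n \<omega>) *v m n \<omega> \<theta>0 + A n \<omega> *v u n \<omega> = 0"
      using * unfolding mv A_def
      by (simp add: matrix_vector_mul_assoc matrix_vector_right_distrib matrix_mul_assoc)
    then have "A n \<omega> *v u n \<omega> = - ((transpose (Jh n \<omega>) ** U n \<omega>) *v m n \<omega> \<theta>0)"
      by (simp add: eq_neg_iff_add_eq_0 add.commute)
    then have "matrix_inv (A n \<omega>) *v (A n \<omega> *v u n \<omega>)
        = matrix_inv (A n \<omega>) *v - ((transpose (Jh n \<omega>) ** U n \<omega>) *v m n \<omega> \<theta>0)" by simp
    then show "u n \<omega> = B n \<omega> *v m n \<omega> \<theta>0"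
      by (simp add: matrix_vector_mul_assoc matrix_inv_left[OF iA] B_def matrix_mul_assoc
          matrix_vector_mult_minus_left linear_neg[OF matrix_vector_mul_linear])
  qed
  define X where "X n \<omega> = sqrt (real n) *\<^sub>R m n \<omega> \<theta>0" for n \<omega>
  have Xb: "bounded_in_prob M X"
    using bounded_in_prob_add[OF tends_in_prob_bounded[OF score] S] by (simp add: X_def[abs_def])
  \<comment> \<open>\<open>B n \<omega> *v X n \<omega> - B0 *v S n \<omega>\<close> is split into a
    vanishing matrix applied to a bounded vector and the fixed \<open>B0\<close> applied to a
    vanishing vector.\<close>
  have "tends_in_prob M (\<lambda>n \<omega>. (B n \<omega> - B0) *v X n \<omega>) 0"
    by (rule tends_in_prob_matrix_vector_bounded[OF B Xb])
  moreover have "tends_in_prob M (\<lambda>n \<omega>. B0 *v (X n \<omega> - S n \<omega>)) (B0 *v 0)"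
    using score unfolding X_def
    by (rule tends_in_prob_isCont)
       (rule linear_continuous_at, rule matrix_vector_mul_bounded_linear)
  ultimately have "tends_in_prob M (\<lambda>n \<omega>. (B n \<omega> - B0) *v X n \<omega> + B0 *v (X n \<omega> - S n \<omega>)) (0 + B0 *v 0)"
    by (rule tends_in_prob_add)
  then have lim: "tends_in_prob M (\<lambda>n \<omega>. B n \<omega> *v X n \<omega> - B0 *v S n \<omega>) 0"
    by (simp add: matrix_vector_mult_diff_rdistrib matrix_vector_mult_diff_distrib)
  have "wpa1 M (\<lambda>n \<omega>. B n \<omega> *v X n \<omega> - B0 *v S n \<omega>
      = sqrt (real n) *\<^sub>R (\<theta>h n \<omega> - \<theta>0) - B0 *v S n \<omega>)"
    by (rule wpa1_mono[OF key])
       (simp add: u_def X_def matrix_vector_mult_scaleR scaleR_matrix_vector_assoc)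
  from tends_in_prob_cong[OF lim this]
  show "tends_in_prob M (\<lambda>n \<omega>. sqrt (real n) *\<^sub>R (\<theta>h n \<omega> - \<theta>0)
        - (- (matrix_inv (transpose G ** \<Upsilon> ** G) ** transpose G ** \<Upsilon>)) *v S n \<omega>) 0"
    by (simp add: B0_def)
qed

section \<open>Cross-fitted first steps\<close>

lemma uses_only_Pair:
  assumes "uses_only M F W J X A" "uses_only M F W J Y B"
  shows "uses_only M F W J (\<lambda>\<omega>. (X \<omega>, Y \<omega>)) (A \<Otimes>\<^sub>M B)"
proof -
  obtain f h where f: "f \<in> Pi\<^sub>M J (\<lambda>_. F) \<rightarrow>\<^sub>M A" "\<And>\<omega>. \<omega> \<in> space M \<Longrightarrow> X \<omega> = f (\<lambda>i\<in>J. W i \<omega>)"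
    and h: "h \<in> Pi\<^sub>M J (\<lambda>_. F) \<rightarrow>\<^sub>M B" "\<And>\<omega>. \<omega> \<in> space M \<Longrightarrow> Y \<omega> = h (\<lambda>i\<in>J. W i \<omega>)"
    using assms unfolding uses_only_def by metis
  show ?thesis
    unfolding uses_only_def
    by (rule bexI[of _ "\<lambda>x. (f x, h x)"]) (use f h in auto)
qed

lemma open_ennreal_0:
  fixes S :: "ennreal set"
  assumes "open S" "0 \<in> S"
  shows "\<exists>c::real. c > 0 \<and> (\<forall>x < ennreal c. x \<in> S)"
proof -
  obtain b where b: "b > 0" "{0..<b} \<subseteq> S"
    using open_right[OF assms, of 1] by auto
  have "\<exists>c::real. c > 0 \<and> ennreal c \<le> b"
  proof (cases b)
    case (real r)
    then show ?thesis using b by (intro exI[of _ r]) auto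
  qed (auto intro: exI[of _ 1])
  then obtain c :: real where "c > 0" "ennreal c \<le> b" by blast
  then show ?thesis using b(2) by (intro exI[of _ c]) (auto simp: subset_iff intro: less_le_trans)
qed

context prob_space
begin

text \<open>Mean squares may be infinite and are therefore kept in \<open>ennreal\<close>, where the
  criterion by distances does not apply; real levels take its place.\<close>

lemma tends_in_prob_ennreal_0_iff:
  fixes X :: "nat \<Rightarrow> 'a \<Rightarrow> ennreal"
  shows "tends_in_prob M X 0 \<longleftrightarrow> (\<forall>c::real. c > 0 \<longrightarrow> wpa1 M (\<lambda>n \<omega>. X n \<omega> < ennreal c))"
proof (intro iffI allI impI)
  fix c :: real assume "tends_in_prob M X 0" "c > 0"
  then have "wpa1 M (\<lambda>n \<omega>. X n \<omega> \<in> {..<ennreal c})"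
    unfolding tends_in_prob_def by (elim allE[of _ "{..<ennreal c}"]) auto
  then show "wpa1 M (\<lambda>n \<omega>. X n \<omega> < ennreal c)" by simp
next
  assume R: "\<forall>c::real. c > 0 \<longrightarrow> wpa1 M (\<lambda>n \<omega>. X n \<omega> < ennreal c)"
  show "tends_in_prob M X 0"
    unfolding tends_in_prob_def
  proof (intro allI impI)
    fix S :: "ennreal set" assume "open S" "0 \<in> S"
    then obtain c :: real where c: "c > 0" "\<And>x. x < ennreal c \<Longrightarrow> x \<in> S"
      using open_ennreal_0 by blast
    then have "wpa1 M (\<lambda>n \<omega>. X n \<omega> < ennreal c)" using R by blast
    then show "wpa1 M (\<lambda>n \<omega>. X n \<omega> \<in> S)" by (rule wpa1_mono) (rule c)
  qed
qed

lemma tends_in_prob_mean_square_add: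
  fixes X Y :: "nat \<Rightarrow> 'a \<Rightarrow> 'w \<Rightarrow> 'b::euclidean_space"
  assumes meas: "\<And>n \<omega>. \<omega> \<in> space M \<Longrightarrow> X n \<omega> \<in> borel_measurable F"
      "\<And>n \<omega>. \<omega> \<in> space M \<Longrightarrow> Y n \<omega> \<in> borel_measurable F"
    and X: "tends_in_prob M (\<lambda>n \<omega>. \<integral>\<^sup>+w. ennreal ((norm (X n \<omega> w))\<^sup>2) \<partial>F) 0"
    and Y: "tends_in_prob M (\<lambda>n \<omega>. \<integral>\<^sup>+w. ennreal ((norm (Y n \<omega> w))\<^sup>2) \<partial>F) 0"
  shows "tends_in_prob M (\<lambda>n \<omega>. \<integral>\<^sup>+w. ennreal ((norm (X n \<omega> w + Y n \<omega> w))\<^sup>2) \<partial>F) 0"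
  unfolding tends_in_prob_ennreal_0_iff
proof (intro allI impI)
  fix c :: real assume c: "c > 0"
  \<comment> \<open>A quarter for each term, because the squared norm of a sum is at most twice the
    sum of the squared norms.\<close>
  have "wpa1 M (\<lambda>n \<omega>. (\<integral>\<^sup>+w. ennreal ((norm (X n \<omega> w))\<^sup>2) \<partial>F) < ennreal (c / 4))"
    "wpa1 M (\<lambda>n \<omega>. (\<integral>\<^sup>+w. ennreal ((norm (Y n \<omega> w))\<^sup>2) \<partial>F) < ennreal (c / 4))"
    using X Y c unfolding tends_in_prob_ennreal_0_iff by auto
  from wpa1_conj[OF this] show "wpa1 M (\<lambda>n \<omega>. (\<integral>\<^sup>+w. ennreal ((norm (X n \<omega> w + Y n \<omega> w))\<^sup>2) \<partial>F) < ennreal c)"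
  proof (rule wpa1_space_mono)
    fix n \<omega> assume \<omega>: "\<omega> \<in> space M"
      and *: "(\<integral>\<^sup>+w. ennreal ((norm (X n \<omega> w))\<^sup>2) \<partial>F) < ennreal (c / 4) \<and>
          (\<integral>\<^sup>+w. ennreal ((norm (Y n \<omega> w))\<^sup>2) \<partial>F) < ennreal (c / 4)"
    note [measurable] = meas[OF \<omega>]
    have pt: "ennreal ((norm (X n \<omega> w + Y n \<omega> w))\<^sup>2)
        \<le> ennreal 2 * ennreal ((norm (X n \<omega> w))\<^sup>2) + ennreal 2 * ennreal ((norm (Y n \<omega> w))\<^sup>2)" for w
    proof -
      have "(norm (X n \<omega> w + Y n \<omega> w))\<^sup>2 \<le> (norm (X n \<omega> w) + norm (Y n \<omega> w))\<^sup>2"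
        by (intro power_mono norm_triangle_ineq) simp
      also have "\<dots> \<le> 2 * (norm (X n \<omega> w))\<^sup>2 + 2 * (norm (Y n \<omega> w))\<^sup>2"
        using sum_squares_bound[of "norm (X n \<omega> w)" "norm (Y n \<omega> w)"] by (simp add: power2_sum)
      finally have "ennreal ((norm (X n \<omega> w + Y n \<omega> w))\<^sup>2)
          \<le> ennreal (2 * (norm (X n \<omega> w))\<^sup>2 + 2 * (norm (Y n \<omega> w))\<^sup>2)"
        by (rule ennreal_leI)
      then show ?thesis by (simp add: ennreal_mult)
    qed
    have "(\<integral>\<^sup>+w. ennreal ((norm (X n \<omega> w + Y n \<omega> w))\<^sup>2) \<partial>F)
        \<le> (\<integral>\<^sup>+w. ennreal 2 * ennreal ((norm (X n \<omega> w))\<^sup>2) + ennreal 2 * ennreal ((norm (Y n \<omega> w))\<^sup>2) \<partial>F)"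
      by (intro nn_integral_mono pt)
    also have "\<dots> = ennreal 2 * (\<integral>\<^sup>+w. ennreal ((norm (X n \<omega> w))\<^sup>2) \<partial>F)
        + ennreal 2 * (\<integral>\<^sup>+w. ennreal ((norm (Y n \<omega> w))\<^sup>2) \<partial>F)"
      by (simp add: nn_integral_add nn_integral_cmult)
    also have "\<dots> < ennreal 2 * ennreal (c / 4) + ennreal 2 * ennreal (c / 4)"
      using * by (intro add_strict_mono ennreal_mult_strict_left_mono) auto
    also have "\<dots> = ennreal c"
      using c by (subst (1 2) ennreal_mult[symmetric], auto, subst ennreal_plus[symmetric], auto)
    finally show "(\<integral>\<^sup>+w. ennreal ((norm (X n \<omega> w + Y n \<omega> w))\<^sup>2) \<partial>F) < ennreal c" .
  qed
qed

end

locale fitted_fold = cross_fit M F0 W I J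
  for M :: "'o measure" and F0 :: "'w measure" and W I J +
  fixes E :: "'e measure" and \<beta>h :: "nat \<Rightarrow> 'o \<Rightarrow> 'e"
  assumes uses: "\<And>n. uses_only M F0 W (J n) (\<beta>h n) E"
begin

text \<open>One measurable function of the other observations is fixed for each n, so that an
  integrand evaluated at the estimates becomes a measurable function on the product of
  \<open>F0\<close> and the sample space of \<open>J n\<close>.\<close>

definition est :: "nat \<Rightarrow> (nat \<Rightarrow> 'w) \<Rightarrow> 'e" where
  "est n = (SOME f. f \<in> Pi\<^sub>M (J n) (\<lambda>_. F0) \<rightarrow>\<^sub>M E \<and> (\<forall>\<omega>\<in>space M. \<beta>h n \<omega> = f (obs (J n) \<omega>)))"

lemma est: "est n \<in> Pi\<^sub>M (J n) (\<lambda>_. F0) \<rightarrow>\<^sub>M E" "\<omega> \<in> space M \<Longrightarrow> \<beta>h n \<omega> = est n (obs (J n) \<omega>)"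
proof -
  have "\<exists>f. f \<in> Pi\<^sub>M (J n) (\<lambda>_. F0) \<rightarrow>\<^sub>M E \<and> (\<forall>\<omega>\<in>space M. \<beta>h n \<omega> = f (obs (J n) \<omega>))"
    using uses[of n] unfolding uses_only_def obs_def by blast
  from someI_ex[OF this] show "est n \<in> Pi\<^sub>M (J n) (\<lambda>_. F0) \<rightarrow>\<^sub>M E"
    "\<omega> \<in> space M \<Longrightarrow> \<beta>h n \<omega> = est n (obs (J n) \<omega>)"
    by (auto simp: est_def)
qed

lemma estimate_in_space: "\<omega> \<in> space M \<Longrightarrow> \<beta>h n \<omega> \<in> space E"
  using est(2)[of \<omega> n] measurable_space[OF est(1)] measurable_space[OF measurable_obs[OF J_sub]] by metis

lemma measurable_comp_est:
  "h \<in> measurable (F0 \<Otimes>\<^sub>M E) N \<Longrightarrow> (\<lambda>p. h (fst p, est n (snd p))) \<in> measurable (F0 \<Otimes>\<^sub>M Pi\<^sub>M (J n) (\<lambda>_. F0)) N"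
  by (rule measurable_compose[where N = "F0 \<Otimes>\<^sub>M E"])
     (auto intro!: measurable_Pair measurable_compose[OF measurable_snd est(1)])

lemma measurable_slice:
  "h \<in> measurable (F0 \<Otimes>\<^sub>M E) N \<Longrightarrow> \<omega> \<in> space M \<Longrightarrow> (\<lambda>w. h (w, \<beta>h n \<omega>)) \<in> measurable F0 N"
  by (rule measurable_compose[where N = "F0 \<Otimes>\<^sub>M E"])
     (auto intro!: measurable_Pair measurable_const estimate_in_space)

lemma estimated_centered_sum_tends_0:
  fixes h :: "'w \<times> 'e \<Rightarrow> 'c::euclidean_space"
  assumes h: "h \<in> borel_measurable (F0 \<Otimes>\<^sub>M E)"
    and lim: "tends_in_prob M (\<lambda>n \<omega>. \<integral>\<^sup>+w. ennreal ((norm (h (w, \<beta>h n \<omega>)))\<^sup>2) \<partial>F0) 0"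
  shows "tends_in_prob M (\<lambda>n \<omega>. (\<Sum>i\<in>I n. h (W i \<omega>, \<beta>h n \<omega>)
      - (\<integral>w. h (w, \<beta>h n \<omega>) \<partial>F0)) /\<^sub>R sqrt (real n)) 0"
proof -
  define k where "k n p = h (fst p, est n (snd p))" for n p
  have eq: "h (w, \<beta>h n \<omega>) = k n (w, obs (J n) \<omega>)" if "\<omega> \<in> space M" for n \<omega> w
    using est(2)[OF that] by (simp add: k_def)
  have "tends_in_prob M (\<lambda>n \<omega>. (\<Sum>i\<in>I n. k n (W i \<omega>, obs (J n) \<omega>)
      - (\<integral>w. k n (w, obs (J n) \<omega>) \<partial>F0)) /\<^sub>R sqrt (real n)) 0"
  proof (rule centered_sum_tends_0)
    show "k n \<in> borel_measurable (F0 \<Otimes>\<^sub>M Pi\<^sub>M (J n) (\<lambda>_. F0))" for n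
      unfolding k_def by (rule measurable_comp_est[OF h])
    show "tends_in_prob M (\<lambda>n \<omega>. \<integral>\<^sup>+w. ennreal ((norm (k n (w, obs (J n) \<omega>)))\<^sup>2) \<partial>F0) 0"
      by (rule tends_in_prob_cong[OF lim]) (auto intro!: wpa1_always simp: eq)
  qed
  then show ?thesis by (rule tends_in_prob_cong) (auto intro!: wpa1_always simp: eq)
qed

lemma estimated_sum_tends_0:
  fixes h :: "'w \<times> 'e \<Rightarrow> 'c::euclidean_space"
  assumes h: "h \<in> borel_measurable (F0 \<Otimes>\<^sub>M E)"
    and lim: "tends_in_prob M (\<lambda>n \<omega>. \<integral>\<^sup>+w. ennreal ((norm (h (w, \<beta>h n \<omega>)))\<^sup>2) \<partial>F0) 0"
    and mean: "tends_in_prob M (\<lambda>n \<omega>. sqrt (real n) *\<^sub>R (\<integral>w. h (w, \<beta>h n \<omega>) \<partial>F0)) 0"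
  shows "tends_in_prob M (\<lambda>n \<omega>. (\<Sum>i\<in>I n. h (W i \<omega>, \<beta>h n \<omega>)) /\<^sub>R sqrt (real n)) 0"
proof -
  define m where "m n \<omega> = (\<integral>w. h (w, \<beta>h n \<omega>) \<partial>F0)" for n \<omega>
  \<comment> \<open>Undoing the centering adds \<open>card (I n)\<close> copies of the conditional
    mean. As \<open>card (I n) \<le> n\<close>, after normalization this is at most the square root
    of n times that mean.\<close>
  have "tends_in_prob M (\<lambda>n \<omega>. (real (card (I n)) / sqrt (real n)) *\<^sub>R m n \<omega>) 0"
  proof (rule tends_in_prob_squeeze)
    show "tends_in_prob M (\<lambda>n \<omega>. norm (sqrt (real n) *\<^sub>R m n \<omega>)) 0"
      using mean tends_in_prob_norm_iff[of "\<lambda>n \<omega>. sqrt (real n) *\<^sub>R m n \<omega>" 0] by (simp add: m_def)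
    show "wpa1 M (\<lambda>n \<omega>. norm ((real (card (I n)) / sqrt (real n)) *\<^sub>R m n \<omega> - 0)
        \<le> norm (sqrt (real n) *\<^sub>R m n \<omega>))"
    proof (rule wpa1_always)
      fix n \<omega>
      have "real (card (I n)) / sqrt (real n) \<le> real n / sqrt (real n)"
        using card_I[of n] by (intro divide_right_mono) auto
      then have "real (card (I n)) / sqrt (real n) \<le> sqrt (real n)"
        by (simp add: real_div_sqrt)
      then show "norm ((real (card (I n)) / sqrt (real n)) *\<^sub>R m n \<omega> - 0) \<le> norm (sqrt (real n) *\<^sub>R m n \<omega>)"
        using mult_right_mono[of "real (card (I n)) / sqrt (real n)" "sqrt (real n)" "norm (m n \<omega>)"] by simp
    qed
  qed
  from tends_in_prob_add[OF estimated_centered_sum_tends_0[OF h lim] this]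
  have "tends_in_prob M (\<lambda>n \<omega>. (\<Sum>i\<in>I n. h (W i \<omega>, \<beta>h n \<omega>) - m n \<omega>) /\<^sub>R sqrt (real n)
      + (real (card (I n)) / sqrt (real n)) *\<^sub>R m n \<omega>) 0"
    by (simp add: m_def)
  moreover have "(\<Sum>i\<in>I n. h (W i \<omega>, \<beta>h n \<omega>) - m n \<omega>) /\<^sub>R sqrt (real n)
      + (real (card (I n)) / sqrt (real n)) *\<^sub>R m n \<omega> = (\<Sum>i\<in>I n. h (W i \<omega>, \<beta>h n \<omega>)) /\<^sub>R sqrt (real n)" for n \<omega>
    by (simp add: sum_subtractf sum_constant_scaleR scaleR_diff_right divide_inverse mult.commute)
  ultimately show ?thesis by simp
qed

lemma estimated_mean_tends_0:
  fixes h :: "'w \<times> 'e \<Rightarrow> real"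
  assumes h: "h \<in> borel_measurable (F0 \<Otimes>\<^sub>M E)" and h0: "\<And>p. 0 \<le> h p"
    and lim: "tends_in_prob M (\<lambda>n \<omega>. \<integral>\<^sup>+w. ennreal (h (w, \<beta>h n \<omega>)) \<partial>F0) 0"
  shows "tends_in_prob M (\<lambda>n \<omega>. (\<Sum>i\<in>I n. h (W i \<omega>, \<beta>h n \<omega>)) / real n) 0"
proof -
  define k where "k n p = h (fst p, est n (snd p))" for n p
  have eq: "h (w, \<beta>h n \<omega>) = k n (w, obs (J n) \<omega>)" if "\<omega> \<in> space M" for n \<omega> w
    using est(2)[OF that] by (simp add: k_def)
  have "tends_in_prob M (\<lambda>n \<omega>. (\<Sum>i\<in>I n. k n (W i \<omega>, obs (J n) \<omega>)) / real n) 0"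
  proof (rule mean_tends_0)
    show "k n \<in> borel_measurable (F0 \<Otimes>\<^sub>M Pi\<^sub>M (J n) (\<lambda>_. F0))" for n
      unfolding k_def by (rule measurable_comp_est[OF h])
    show "tends_in_prob M (\<lambda>n \<omega>. \<integral>\<^sup>+w. ennreal (k n (w, obs (J n) \<omega>)) \<partial>F0) 0"
      by (rule tends_in_prob_cong[OF lim]) (auto intro!: wpa1_always simp: eq)
  qed (simp add: k_def h0)
  then show ?thesis by (rule tends_in_prob_cong) (auto intro!: wpa1_always simp: eq)
qed

lemma estimated_mean_bounded:
  fixes h :: "'w \<times> 'e \<Rightarrow> real"
  assumes h: "h \<in> borel_measurable (F0 \<Otimes>\<^sub>M E)" and h0: "\<And>p. 0 \<le> h p" and c: "c \<ge> 0"
    and le: "wpa1 M (\<lambda>n \<omega>. (\<integral>\<^sup>+w. ennreal (h (w, \<beta>h n \<omega>)) \<partial>F0) \<le> ennreal c)"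
  shows "bounded_in_prob M (\<lambda>n \<omega>. (\<Sum>i\<in>I n. h (W i \<omega>, \<beta>h n \<omega>)) / real n)"
proof -
  define k where "k n p = h (fst p, est n (snd p))" for n p
  have eq: "h (w, \<beta>h n \<omega>) = k n (w, obs (J n) \<omega>)" if "\<omega> \<in> space M" for n \<omega> w
    using est(2)[OF that] by (simp add: k_def)
  have "bounded_in_prob M (\<lambda>n \<omega>. (\<Sum>i\<in>I n. k n (W i \<omega>, obs (J n) \<omega>)) / real n)"
  proof (rule mean_bounded[OF _ _ c])
    show "k n \<in> borel_measurable (F0 \<Otimes>\<^sub>M Pi\<^sub>M (J n) (\<lambda>_. F0))" for n
      unfolding k_def by (rule measurable_comp_est[OF h])
    show "wpa1 M (\<lambda>n \<omega>. (\<integral>\<^sup>+w. ennreal (k n (w, obs (J n) \<omega>)) \<partial>F0) \<le> ennreal c)"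
      by (rule wpa1_space_mono[OF le]) (simp add: eq)
  qed (simp add: k_def h0)
  then show ?thesis
    by (rule bounded_in_prob_wpa1[where f = "\<lambda>B. B"]) (auto intro!: wpa1_always simp: eq)
qed

lemma estimated_wpa1_AE:
  assumes D: "D \<in> sets (F0 \<Otimes>\<^sub>M E)"
    and ae: "wpa1 M (\<lambda>n \<omega>. AE w in F0. (w, \<beta>h n \<omega>) \<in> D)"
  shows "wpa1 M (\<lambda>n \<omega>. \<forall>i\<in>I n. (W i \<omega>, \<beta>h n \<omega>) \<in> D)"
proof -
  define D' where "D' n = (\<lambda>p. (fst p, est n (snd p))) -` D \<inter> space (F0 \<Otimes>\<^sub>M Pi\<^sub>M (J n) (\<lambda>_. F0))" for n
  have D': "D' n \<in> sets (F0 \<Otimes>\<^sub>M Pi\<^sub>M (J n) (\<lambda>_. F0))" for n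
    unfolding D'_def using measurable_comp_est[OF measurable_ident] D
    by (intro measurable_sets[where A = "F0 \<Otimes>\<^sub>M E"]) (auto simp: id_def)
  have "wpa1 M (\<lambda>n \<omega>. \<forall>i\<in>I n. (W i \<omega>, obs (J n) \<omega>) \<in> D' n)"
  proof (rule wpa1_AE_fold[OF D'])
    show "wpa1 M (\<lambda>n \<omega>. AE w in F0. (w, obs (J n) \<omega>) \<in> D' n)"
    proof (rule wpa1_space_mono[OF ae])
      fix n \<omega> assume \<omega>: "\<omega> \<in> space M" and ae: "AE w in F0. (w, \<beta>h n \<omega>) \<in> D"
      from ae AE_space show "AE w in F0. (w, obs (J n) \<omega>) \<in> D' n"
      proof eventually_elim
        case (elim w)
        then show ?case
          using est(2)[OF \<omega>] measurable_space[OF measurable_obs[OF J_sub] \<omega>]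
          by (simp add: D'_def space_pair_measure)
      qed
    qed
  qed
  then show ?thesis
    by (rule wpa1_space_mono) (auto simp: D'_def est(2))
qed

end

section \<open>Measurable versions of Jacobians\<close>

lemma directional_limit_eq_jacobian:
  fixes f :: "real^'p \<Rightarrow> real^'m"
  assumes f: "f differentiable (at x)" and h: "h \<longlonglongrightarrow> 0" "\<And>k. h k \<noteq> (0::real)"
  shows "(\<lambda>k. (f (x + h k *\<^sub>R axis j 1) $ i - f x $ i) / h k) \<longlonglongrightarrow> jacobian f (at x) $ i $ j"
proof -
  define A where "A = jacobian f (at x)"
  have "(f has_derivative (*v) A) (at (x + 0 *\<^sub>R axis j 1))"
    using f unfolding A_def jacobian_works by simp
  moreover have "((\<lambda>t. x + t *\<^sub>R axis j 1) has_derivative (\<lambda>t. t *\<^sub>R axis j 1)) (at 0)"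
    by (auto intro!: derivative_eq_intros)
  ultimately have "((\<lambda>t. f (x + t *\<^sub>R axis j 1)) has_derivative (\<lambda>t. A *v (t *\<^sub>R axis j 1))) (at 0)"
    by (rule has_derivative_compose[rotated])
  then have "((\<lambda>t. f (x + t *\<^sub>R axis j 1) $ i) has_derivative (\<lambda>t. (A *v (t *\<^sub>R axis j 1)) $ i)) (at 0)"
    by (rule bounded_linear.has_derivative[OF bounded_linear_vec_nth])
  moreover have "(\<lambda>t. (A *v (t *\<^sub>R axis j 1)) $ i) = (*) (A $ i $ j)"
    by (auto simp: matrix_vector_mult_scaleR matrix_vector_mult_basis column_def fun_eq_iff mult.commute)
  ultimately have "((\<lambda>t. f (x + t *\<^sub>R axis j 1) $ i) has_field_derivative A $ i $ j) (at 0)"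
    by (simp add: has_field_derivative_def)
  then have "((\<lambda>t. (f (x + (0 + t) *\<^sub>R axis j 1) $ i - f (x + 0 *\<^sub>R axis j 1) $ i) / t) \<longlongrightarrow> A $ i $ j) (at 0)"
    unfolding DERIV_def .
  moreover have "filterlim h (at 0) sequentially"
    using h by (simp add: filterlim_at)
  ultimately have "(\<lambda>k. (f (x + (0 + h k) *\<^sub>R axis j 1) $ i - f (x + 0 *\<^sub>R axis j 1) $ i) / h k) \<longlonglongrightarrow> A $ i $ j"
    by (rule filterlim_compose)
  then show ?thesis by (simp add: A_def)
qed

lemma jacobian_eqI: "(f has_derivative (\<lambda>h. A *v h)) (at x) \<Longrightarrow> jacobian f (at x) = A"
  for f :: "real^'p \<Rightarrow> real^'m"
  unfolding jacobian_def by (metis frechet_derivative_at matrix_of_matrix_vector_mul)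

text \<open>The Jacobian itself has unspecified values where \<open>g w \<gamma>\<close> is not differentiable and need not be
  measurable; the limit of its difference quotients is, and replaces it in conditional arguments.\<close>

lemma measurable_jacobian_version:
  fixes g :: "'w \<Rightarrow> 'g \<Rightarrow> real^'p \<Rightarrow> real^'m"
  assumes g: "(\<lambda>(w, \<gamma>, \<theta>). g w \<gamma> \<theta>) \<in> borel_measurable (F0 \<Otimes>\<^sub>M \<G> \<Otimes>\<^sub>M restrict_space borel \<Theta>)"
    and N: "open N" "\<theta>0 \<in> N" "N \<subseteq> \<Theta>"
  obtains Jm :: "'w \<times> 'g \<Rightarrow> real^'p^'m"
  where "\<And>j k. (\<lambda>p. Jm p $ j $ k) \<in> borel_measurable (F0 \<Otimes>\<^sub>M \<G>)"
    and "\<And>w \<gamma>. g w \<gamma> differentiable (at \<theta>0) \<Longrightarrow> Jm (w, \<gamma>) = jacobian (g w \<gamma>) (at \<theta>0)"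
proof -
  obtain r where r: "r > 0" "ball \<theta>0 r \<subseteq> N" using N open_contains_ball by blast
  \<comment> \<open>Nonzero increments tending to 0; the shift by 2 keeps even the one for
    \<open>k = 0\<close> strictly inside the open ball, hence all evaluation points in
    \<open>\<Theta>\<close>, where \<open>g\<close> is jointly measurable.\<close>
  define h where "h k = r / (real k + 2)" for k
  have h0: "h k \<noteq> 0" for k using r by (simp add: h_def)
  have hlim: "h \<longlonglongrightarrow> 0" unfolding h_def by real_asymp
  have hr: "\<theta>0 + h k *\<^sub>R axis j 1 \<in> \<Theta>" for k j
  proof -
    have "0 < r + r * real k" using r by (simp add: add_pos_nonneg)
    then have "\<bar>h k\<bar> < r" using r by (simp add: h_def field_simps)
    then have "\<theta>0 + h k *\<^sub>R axis j 1 \<in> ball \<theta>0 r" by (simp add: dist_norm)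
    then show ?thesis using r N by blast
  qed
  have gm: "(\<lambda>p. g (fst p) (snd p) \<theta>) \<in> borel_measurable (F0 \<Otimes>\<^sub>M \<G>)" if "\<theta> \<in> \<Theta>" for \<theta>
  proof -
    have "(\<lambda>p. (fst p, snd p, \<theta>)) \<in> measurable (F0 \<Otimes>\<^sub>M \<G>) (F0 \<Otimes>\<^sub>M \<G> \<Otimes>\<^sub>M restrict_space borel \<Theta>)"
      using that by (intro measurable_Pair measurable_const) (auto simp: space_restrict_space)
    from measurable_compose[OF this g] show ?thesis by simp
  qed
  define Jm :: "'w \<times> 'g \<Rightarrow> real^'p^'m" where "Jm p = (\<chi> i j. lim (\<lambda>k.
    (g (fst p) (snd p) (\<theta>0 + h k *\<^sub>R axis j 1) $ i - g (fst p) (snd p) \<theta>0 $ i) / h k))" for p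
  show ?thesis
  proof (rule that)
    have \<theta>0: "\<theta>0 \<in> \<Theta>" using N by blast
    show "(\<lambda>p. Jm p $ i $ j) \<in> borel_measurable (F0 \<Otimes>\<^sub>M \<G>)" for i j
      unfolding Jm_def using gm[OF hr] gm[OF \<theta>0]
      by (auto intro!: borel_measurable_lim_metric borel_measurable_divide borel_measurable_diff
          measurable_compose[OF _ borel_measurable_nth])
    show "Jm (w, \<gamma>) = jacobian (g w \<gamma>) (at \<theta>0)" if "g w \<gamma> differentiable (at \<theta>0)" for w \<gamma>
      using limI[OF directional_limit_eq_jacobian[OF that hlim h0]] by (simp add: Jm_def vec_eq_iff)
  qed
qed

section \<open>Orthogonality and the fold-wise expansion\<close>

text \<open>In the affine case the moment along the segment to \<open>\<gamma>\<close> is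
  \<open>\<tau> *\<^sub>R \<psi>bar \<gamma>\<close>, so its derivative is
  \<open>\<psi>bar \<gamma>\<close> and orthogonality makes \<open>\<psi>bar\<close> vanish on all
  of \<open>\<Gamma>\<close>. In the quadratic case the square root of n is the square of n^(1/4),
  which the rate of the first step absorbs. The third alternative is the conclusion.\<close>

lemma (in prob_space) neyman_bias_negligible:
  fixes \<gamma>h :: "nat \<Rightarrow> 'a \<Rightarrow> 'g::real_vector" and \<psi>bar :: "'g \<Rightarrow> 'b::real_normed_vector"
  assumes \<Gamma>: "subspace \<Gamma>" "\<gamma>0 \<in> \<Gamma>" "\<And>n \<omega>. \<omega> \<in> space M \<Longrightarrow> \<gamma>h n \<omega> \<in> \<Gamma>"
    and zero: "\<psi>bar \<gamma>0 = 0"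
    and neyman: "\<And>\<gamma>. \<gamma> \<in> \<Gamma> \<Longrightarrow>
      ((\<lambda>\<tau>. \<psi>bar ((1 - \<tau>) *\<^sub>R \<gamma>0 + \<tau> *\<^sub>R \<gamma>)) has_vector_derivative 0) (at 0)"
    and alt: "(\<forall>\<gamma>1\<in>\<Gamma>. \<forall>\<gamma>2\<in>\<Gamma>. \<forall>s::real. \<psi>bar ((1 - s) *\<^sub>R \<gamma>1 + s *\<^sub>R \<gamma>2)
            = (1 - s) *\<^sub>R \<psi>bar \<gamma>1 + s *\<^sub>R \<psi>bar \<gamma>2)
        \<or> (\<exists>nrm. norm_on \<Gamma> nrm \<and>
             tends_in_prob M (\<lambda>n \<omega>. real n powr (1/4) * nrm (\<gamma>h n \<omega> - \<gamma>0)) 0 \<and>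
             (\<exists>C. \<exists>\<delta>>0. \<forall>\<gamma>\<in>\<Gamma>. nrm (\<gamma> - \<gamma>0) < \<delta> \<longrightarrow>
                norm (\<psi>bar \<gamma>) \<le> C * (nrm (\<gamma> - \<gamma>0))\<^sup>2))
        \<or> tends_in_prob M (\<lambda>n \<omega>. sqrt (real n) *\<^sub>R \<psi>bar (\<gamma>h n \<omega>)) 0"
  shows "tends_in_prob M (\<lambda>n \<omega>. sqrt (real n) *\<^sub>R \<psi>bar (\<gamma>h n \<omega>)) 0"
  using alt
proof (elim disjE)
  assume aff: "\<forall>\<gamma>1\<in>\<Gamma>. \<forall>\<gamma>2\<in>\<Gamma>. \<forall>s::real. \<psi>bar ((1 - s) *\<^sub>R \<gamma>1 + s *\<^sub>R \<gamma>2)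
            = (1 - s) *\<^sub>R \<psi>bar \<gamma>1 + s *\<^sub>R \<psi>bar \<gamma>2"
  have "\<psi>bar \<gamma> = 0" if \<gamma>: "\<gamma> \<in> \<Gamma>" for \<gamma>
  proof -
    have "(\<lambda>\<tau>. \<psi>bar ((1 - \<tau>) *\<^sub>R \<gamma>0 + \<tau> *\<^sub>R \<gamma>)) = (\<lambda>\<tau>. \<tau> *\<^sub>R \<psi>bar \<gamma>)"
      using aff \<Gamma>(2) \<gamma> zero by (auto simp: fun_eq_iff)
    then have "((\<lambda>\<tau>. \<tau> *\<^sub>R \<psi>bar \<gamma>) has_vector_derivative 0) (at 0)"
      using neyman[OF \<gamma>] by simp
    moreover have "((\<lambda>\<tau>. \<tau> *\<^sub>R \<psi>bar \<gamma>) has_vector_derivative \<psi>bar \<gamma>) (at 0)"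
      by (auto intro!: derivative_eq_intros)
    ultimately show ?thesis by (metis vector_derivative_unique_at)
  qed
  then have "wpa1 M (\<lambda>n \<omega>. 0 = sqrt (real n) *\<^sub>R \<psi>bar (\<gamma>h n \<omega>))"
    using \<Gamma>(3) by (intro wpa1_always) simp
  with tends_in_prob_const[of 0] show ?thesis by (rule tends_in_prob_cong)
next
  assume "\<exists>nrm. norm_on \<Gamma> nrm \<and>
             tends_in_prob M (\<lambda>n \<omega>. real n powr (1/4) * nrm (\<gamma>h n \<omega> - \<gamma>0)) 0 \<and>
             (\<exists>C. \<exists>\<delta>>0. \<forall>\<gamma>\<in>\<Gamma>. nrm (\<gamma> - \<gamma>0) < \<delta> \<longrightarrow> norm (\<psi>bar \<gamma>) \<le> C * (nrm (\<gamma> - \<gamma>0))\<^sup>2)"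
  then obtain nrm C \<delta> where nrm: "norm_on \<Gamma> nrm"
    and lim: "tends_in_prob M (\<lambda>n \<omega>. real n powr (1/4) * nrm (\<gamma>h n \<omega> - \<gamma>0)) 0"
    and \<delta>: "\<delta> > 0" and C: "\<And>\<gamma>. \<gamma> \<in> \<Gamma> \<Longrightarrow> nrm (\<gamma> - \<gamma>0) < \<delta> \<Longrightarrow> norm (\<psi>bar \<gamma>) \<le> C * (nrm (\<gamma> - \<gamma>0))\<^sup>2"
    by blast
  define q where "q n \<omega> = real n powr (1/4) * nrm (\<gamma>h n \<omega> - \<gamma>0)" for n \<omega>
  have lim: "tends_in_prob M q 0" using lim by (simp add: q_def[abs_def])
  have "isCont (\<lambda>x::real. C * x\<^sup>2) 0" by simp
  from tends_in_prob_isCont[OF lim this] have Y: "tends_in_prob M (\<lambda>n \<omega>. C * (q n \<omega>)\<^sup>2) 0" by simp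
  \<comment> \<open>For \<open>n \<ge> 1\<close> the factor n^(1/4) is at least 1, so a small
    \<open>q n \<omega>\<close> also places \<open>\<gamma>h n \<omega>\<close> in the neighborhood
    where the quadratic bound is valid.\<close>
  have "wpa1 M (\<lambda>n \<omega>. \<bar>q n \<omega>\<bar> < \<delta>)"
    using lim \<delta> unfolding tends_in_prob_iff_norm by simp
  then have "wpa1 M (\<lambda>n \<omega>. norm (sqrt (real n) *\<^sub>R \<psi>bar (\<gamma>h n \<omega>) - 0) \<le> C * (q n \<omega>)\<^sup>2)"
  proof (rule wpa1_mp, intro eventually_mono[OF eventually_ge_at_top[of 1]] ballI impI)
    fix n \<omega> assume n: "1 \<le> n" and \<omega>: "\<omega> \<in> space M" and small: "\<bar>q n \<omega>\<bar> < \<delta>"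
    have "\<gamma>h n \<omega> - \<gamma>0 \<in> \<Gamma>" using \<Gamma> \<omega> by (simp add: subspace_diff)
    then have x0: "0 \<le> nrm (\<gamma>h n \<omega> - \<gamma>0)" using nrm by (simp add: norm_on_def)
    have "1 \<le> real n powr (1/4)" using n by (simp add: ge_one_powr_ge_zero)
    then have "nrm (\<gamma>h n \<omega> - \<gamma>0) \<le> q n \<omega>"
      unfolding q_def using x0 mult_right_mono[of 1 "real n powr (1/4)" "nrm (\<gamma>h n \<omega> - \<gamma>0)"] by simp
    then have "norm (\<psi>bar (\<gamma>h n \<omega>)) \<le> C * (nrm (\<gamma>h n \<omega> - \<gamma>0))\<^sup>2"
      using small \<Gamma>(3)[OF \<omega>] by (intro C) auto
    then have "sqrt (real n) * norm (\<psi>bar (\<gamma>h n \<omega>)) \<le> sqrt (real n) * (C * (nrm (\<gamma>h n \<omega> - \<gamma>0))\<^sup>2)"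
      by (rule mult_left_mono) simp
    also have "(real n powr (1/4))\<^sup>2 = sqrt (real n)"
      using n by (simp add: powr_power powr_half_sqrt)
    then have "sqrt (real n) * (C * (nrm (\<gamma>h n \<omega> - \<gamma>0))\<^sup>2) = C * (q n \<omega>)\<^sup>2"
      by (simp add: q_def power_mult_distrib)
    finally show "norm (sqrt (real n) *\<^sub>R \<psi>bar (\<gamma>h n \<omega>) - 0) \<le> C * (q n \<omega>)\<^sup>2" by simp
  qed
  with Y show ?thesis by (rule tends_in_prob_squeeze)
qed

section \<open>Remainders of the debiased moments on one fold\<close>

locale dml_fold = fitted_fold M F0 W I J "\<G> \<Otimes>\<^sub>M \<A> \<Otimes>\<^sub>M restrict_space borel \<Theta>" "\<lambda>n \<omega>. (\<gamma>h n \<omega>, \<alpha>h n \<omega>, \<theta>t n \<omega>)"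
  for M :: "'o measure" and F0 :: "'w measure" and W I J
    and \<G> :: "'g measure" and \<A> :: "'a measure" and \<Theta> :: "(real^'p) set" and \<gamma>h \<alpha>h \<theta>t +
  fixes g :: "'w \<Rightarrow> 'g \<Rightarrow> real^'p \<Rightarrow> real^'m" and \<phi> :: "'w \<Rightarrow> 'g \<Rightarrow> 'a \<Rightarrow> real^'p \<Rightarrow> real^'m"
    and \<gamma>0 :: 'g and \<alpha>0 :: 'a and \<theta>0 :: "real^'p"
  assumes true_values: "\<gamma>0 \<in> space \<G>" "\<alpha>0 \<in> space \<A>" "\<theta>0 \<in> \<Theta>"
    and g_meas: "(\<lambda>(w, \<gamma>, \<theta>). g w \<gamma> \<theta>) \<in> borel_measurable (F0 \<Otimes>\<^sub>M \<G> \<Otimes>\<^sub>M restrict_space borel \<Theta>)"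
    and phi_meas: "(\<lambda>(w, \<gamma>, \<alpha>, \<theta>). \<phi> w \<gamma> \<alpha> \<theta>)
        \<in> borel_measurable (F0 \<Otimes>\<^sub>M \<G> \<Otimes>\<^sub>M \<A> \<Otimes>\<^sub>M restrict_space borel \<Theta>)"
    and g_mean: "has_bochner_integral F0 (\<lambda>w. g w \<gamma>0 \<theta>0) 0"
    and phi_mean: "has_bochner_integral F0 (\<lambda>w. \<phi> w \<gamma>0 \<alpha>0 \<theta>0) 0"
begin

abbreviation "R\<Theta> \<equiv> restrict_space borel \<Theta>"
abbreviation "E \<equiv> \<G> \<Otimes>\<^sub>M \<A> \<Otimes>\<^sub>M R\<Theta>"

lemma measurable_g [measurable (raw)]:
  assumes "X \<in> measurable N F0" "Y \<in> measurable N \<G>" "Z \<in> measurable N R\<Theta>"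
  shows "(\<lambda>x. g (X x) (Y x) (Z x)) \<in> borel_measurable N"
  using measurable_compose[OF measurable_Pair[OF assms(1) measurable_Pair[OF assms(2,3)]] g_meas] by simp

lemma measurable_phi [measurable (raw)]:
  assumes "X \<in> measurable N F0" "Y \<in> measurable N \<G>" "A \<in> measurable N \<A>" "Z \<in> measurable N R\<Theta>"
  shows "(\<lambda>x. \<phi> (X x) (Y x) (A x) (Z x)) \<in> borel_measurable N"
  using measurable_compose[OF measurable_Pair[OF assms(1) measurable_Pair[OF assms(2)
      measurable_Pair[OF assms(3,4)]]] phi_meas] by simp

lemma true_values_measurable [measurable]: "\<gamma>0 \<in> space \<G>" "\<alpha>0 \<in> space \<A>" "\<theta>0 \<in> space R\<Theta>"
  using true_values by (simp_all add: space_restrict_space)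

text \<open>All remainders take the full triple of first steps as argument. They share one domain,
  so they can be added and evaluated at the estimates by the same lemmas.\<close>

definition R_g :: "'w \<times> 'g \<times> 'a \<times> (real^'p) \<Rightarrow> real^'m" where
  "R_g = (\<lambda>(w, \<gamma>, \<alpha>, \<theta>). g w \<gamma> \<theta>0 - g w \<gamma>0 \<theta>0)"

definition R_phi :: "'w \<times> 'g \<times> 'a \<times> (real^'p) \<Rightarrow> real^'m" where
  "R_phi = (\<lambda>(w, \<gamma>, \<alpha>, \<theta>). \<phi> w \<gamma> \<alpha>0 \<theta>0 - \<phi> w \<gamma>0 \<alpha>0 \<theta>0)"

definition R_alpha :: "'w \<times> 'g \<times> 'a \<times> (real^'p) \<Rightarrow> real^'m" where
  "R_alpha = (\<lambda>(w, \<gamma>, \<alpha>, \<theta>). \<phi> w \<gamma>0 \<alpha> \<theta> - \<phi> w \<gamma>0 \<alpha>0 \<theta>0)"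

definition R_theta :: "'w \<times> 'g \<times> 'a \<times> (real^'p) \<Rightarrow> real^'m" where
  "R_theta = (\<lambda>(w, \<gamma>, \<alpha>, \<theta>). g w \<gamma> \<theta> - g w \<gamma> \<theta>0)"

definition \<Delta> :: "'w \<times> 'g \<times> 'a \<times> (real^'p) \<Rightarrow> real^'m" where
  "\<Delta> = (\<lambda>(w, \<gamma>, \<alpha>, \<theta>). \<phi> w \<gamma> \<alpha> \<theta> - \<phi> w \<gamma>0 \<alpha> \<theta> - \<phi> w \<gamma> \<alpha>0 \<theta>0 + \<phi> w \<gamma>0 \<alpha>0 \<theta>0)"

lemma remainder_measurable [measurable]:
  "R_g \<in> borel_measurable (F0 \<Otimes>\<^sub>M E)" "R_phi \<in> borel_measurable (F0 \<Otimes>\<^sub>M E)"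
  "R_alpha \<in> borel_measurable (F0 \<Otimes>\<^sub>M E)" "R_theta \<in> borel_measurable (F0 \<Otimes>\<^sub>M E)"
  "\<Delta> \<in> borel_measurable (F0 \<Otimes>\<^sub>M E)"
  unfolding R_g_def R_phi_def R_alpha_def R_theta_def \<Delta>_def case_prod_beta' by measurable

abbreviation \<beta>h :: "nat \<Rightarrow> 'o \<Rightarrow> 'g \<times> 'a \<times> (real^'p)" where
  "\<beta>h n \<omega> \<equiv> (\<gamma>h n \<omega>, \<alpha>h n \<omega>, \<theta>t n \<omega>)"

lemma mean_square_add:
  fixes h k :: "_ \<Rightarrow> 'c::euclidean_space"
  assumes h: "h \<in> borel_measurable (F0 \<Otimes>\<^sub>M E)" and k: "k \<in> borel_measurable (F0 \<Otimes>\<^sub>M E)"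
    and "tends_in_prob M (\<lambda>n \<omega>. \<integral>\<^sup>+w. ennreal ((norm (h (w, \<beta>h n \<omega>)))\<^sup>2) \<partial>F0) 0"
    and "tends_in_prob M (\<lambda>n \<omega>. \<integral>\<^sup>+w. ennreal ((norm (k (w, \<beta>h n \<omega>)))\<^sup>2) \<partial>F0) 0"
  shows "tends_in_prob M (\<lambda>n \<omega>. \<integral>\<^sup>+w. ennreal ((norm (h (w, \<beta>h n \<omega>) + k (w, \<beta>h n \<omega>)))\<^sup>2) \<partial>F0) 0"
  by (rule tends_in_prob_mean_square_add[OF measurable_slice[OF h] measurable_slice[OF k] assms(3,4)])

text \<open>The error of a summand is \<open>R + R_alpha + \<Delta>\<close>. The normalized sum of
  \<open>R\<close> is small because its mean is the orthogonal moment at the estimated first step,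
  that of \<open>R_alpha\<close> because its mean is 0, and that of \<open>\<Delta>\<close> by one
  of the three alternatives, of which the first also goes through the mean and the mean
  square.\<close>

lemma score_negligible:
  assumes A1: "tends_in_prob M (\<lambda>n \<omega>. \<integral>\<^sup>+w. ennreal ((norm (R_g (w, \<beta>h n \<omega>)))\<^sup>2) \<partial>F0) 0"
    "tends_in_prob M (\<lambda>n \<omega>. \<integral>\<^sup>+w. ennreal ((norm (R_phi (w, \<beta>h n \<omega>)))\<^sup>2) \<partial>F0) 0"
    "tends_in_prob M (\<lambda>n \<omega>. \<integral>\<^sup>+w. ennreal ((norm (R_alpha (w, \<beta>h n \<omega>)))\<^sup>2) \<partial>F0) 0"
    and A2: "(tends_in_prob M (\<lambda>n \<omega>. sqrt (real n) *\<^sub>R (\<integral>w. \<Delta> (w, \<beta>h n \<omega>) \<partial>F0)) 0 \<and>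
         tends_in_prob M (\<lambda>n \<omega>. \<integral>\<^sup>+w. ennreal ((norm (\<Delta> (w, \<beta>h n \<omega>)))\<^sup>2) \<partial>F0) 0)
        \<or> tends_in_prob M (\<lambda>n \<omega>. (\<Sum>i\<in>I n. norm (\<Delta> (W i \<omega>, \<beta>h n \<omega>))) / sqrt (real n)) 0
        \<or> tends_in_prob M (\<lambda>n \<omega>. (\<Sum>i\<in>I n. \<Delta> (W i \<omega>, \<beta>h n \<omega>)) /\<^sub>R sqrt (real n)) 0"
    and A3_i: "\<And>n. n \<ge> 1 \<Longrightarrow>
        AE \<omega> in M. has_bochner_integral F0 (\<lambda>w. \<phi> w \<gamma>0 (\<alpha>h n \<omega>) (\<theta>t n \<omega>)) 0"
    and bias: "tends_in_prob M (\<lambda>n \<omega>. sqrt (real n) *\<^sub>R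
        (\<integral>w. g w (\<gamma>h n \<omega>) \<theta>0 + \<phi> w (\<gamma>h n \<omega>) \<alpha>0 \<theta>0 \<partial>F0)) 0"
  shows "tends_in_prob M (\<lambda>n \<omega>. (\<Sum>i\<in>I n. (g (W i \<omega>) (\<gamma>h n \<omega>) \<theta>0
      + \<phi> (W i \<omega>) (\<gamma>h n \<omega>) (\<alpha>h n \<omega>) (\<theta>t n \<omega>))
      - (g (W i \<omega>) \<gamma>0 \<theta>0 + \<phi> (W i \<omega>) \<gamma>0 \<alpha>0 \<theta>0)) /\<^sub>R sqrt (real n)) 0"
proof -
  \<comment> \<open>These two are treated together because orthogonality concerns the mean of their
    sum, not each mean by itself.\<close>
  define R where "R p = R_g p + R_phi p" for p
  have [measurable]: "R \<in> borel_measurable (F0 \<Otimes>\<^sub>M E)" unfolding R_def by measurable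
  have Rsq: "tends_in_prob M (\<lambda>n \<omega>. \<integral>\<^sup>+w. ennreal ((norm (R (w, \<beta>h n \<omega>)))\<^sup>2) \<partial>F0) 0"
    unfolding R_def by (rule mean_square_add[OF _ _ A1(1,2)]) measurable
  \<comment> \<open>On this event \<open>R\<close> is integrable, so the Bochner integral of the
    moment at the estimate splits into that of \<open>R\<close> and that of the true moment, which
    is 0.\<close>
  have fin: "wpa1 M (\<lambda>n \<omega>. (\<integral>\<^sup>+w. ennreal ((norm (R (w, \<beta>h n \<omega>)))\<^sup>2) \<partial>F0) < ennreal 1)"
    by (rule Rsq[unfolded tends_in_prob_ennreal_0_iff, rule_format]) simp
  have "wpa1 M (\<lambda>n \<omega>. sqrt (real n) *\<^sub>R (\<integral>w. g w (\<gamma>h n \<omega>) \<theta>0 + \<phi> w (\<gamma>h n \<omega>) \<alpha>0 \<theta>0 \<partial>F0)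
      = sqrt (real n) *\<^sub>R (\<integral>w. R (w, \<beta>h n \<omega>) \<partial>F0))"
  proof (rule wpa1_space_mono[OF fin])
    fix n \<omega> assume \<omega>: "\<omega> \<in> space M"
      and f: "(\<integral>\<^sup>+w. ennreal ((norm (R (w, \<beta>h n \<omega>)))\<^sup>2) \<partial>F0) < ennreal 1"
    have intR: "integrable F0 (\<lambda>w. R (w, \<beta>h n \<omega>))"
    proof (rule F0.square_integrable_norm_imp_integrable(1))
      show "(\<lambda>w. R (w, \<beta>h n \<omega>)) \<in> borel_measurable F0" by (rule measurable_slice[OF _ \<omega>]) measurable
      show "(\<integral>\<^sup>+w. ennreal ((norm (R (w, \<beta>h n \<omega>)))\<^sup>2) \<partial>F0) < \<infinity>"
        using f by (rule less_trans) simp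
    qed
    have int0: "integrable F0 (\<lambda>w. g w \<gamma>0 \<theta>0 + \<phi> w \<gamma>0 \<alpha>0 \<theta>0)"
      "(\<integral>w. g w \<gamma>0 \<theta>0 + \<phi> w \<gamma>0 \<alpha>0 \<theta>0 \<partial>F0) = 0"
      using has_bochner_integral_add[OF g_mean phi_mean]
      by (simp_all add: has_bochner_integral_iff)
    have "g w (\<gamma>h n \<omega>) \<theta>0 + \<phi> w (\<gamma>h n \<omega>) \<alpha>0 \<theta>0
        = R (w, \<beta>h n \<omega>) + (g w \<gamma>0 \<theta>0 + \<phi> w \<gamma>0 \<alpha>0 \<theta>0)" for w
      by (simp add: R_def R_g_def R_phi_def)
    then have "(\<integral>w. g w (\<gamma>h n \<omega>) \<theta>0 + \<phi> w (\<gamma>h n \<omega>) \<alpha>0 \<theta>0 \<partial>F0) = (\<integral>w. R (w, \<beta>h n \<omega>) \<partial>F0)"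
      using Bochner_Integration.integral_add[OF intR int0(1)] int0(2) by simp
    then show "sqrt (real n) *\<^sub>R (\<integral>w. g w (\<gamma>h n \<omega>) \<theta>0 + \<phi> w (\<gamma>h n \<omega>) \<alpha>0 \<theta>0 \<partial>F0)
      = sqrt (real n) *\<^sub>R (\<integral>w. R (w, \<beta>h n \<omega>) \<partial>F0)" by simp
  qed
  from tends_in_prob_cong[OF bias this]
  have S1: "tends_in_prob M (\<lambda>n \<omega>. (\<Sum>i\<in>I n. R (W i \<omega>, \<beta>h n \<omega>)) /\<^sub>R sqrt (real n)) 0"
    by (intro estimated_sum_tends_0 Rsq) measurable
  have S2: "tends_in_prob M (\<lambda>n \<omega>. (\<Sum>i\<in>I n. R_alpha (W i \<omega>, \<beta>h n \<omega>)) /\<^sub>R sqrt (real n)) 0"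
  proof (rule estimated_sum_tends_0[OF _ A1(3)])
    have "wpa1 M (\<lambda>n \<omega>. has_bochner_integral F0 (\<lambda>w. \<phi> w \<gamma>0 (\<alpha>h n \<omega>) (\<theta>t n \<omega>)) 0)"
      by (rule wpa1_AE, rule eventually_mono[OF eventually_ge_at_top[of 1]], rule A3_i)
    then have "wpa1 M (\<lambda>n \<omega>. 0 = sqrt (real n) *\<^sub>R (\<integral>w. R_alpha (w, \<beta>h n \<omega>) \<partial>F0))"
    proof (rule wpa1_mono)
      fix n \<omega> assume "has_bochner_integral F0 (\<lambda>w. \<phi> w \<gamma>0 (\<alpha>h n \<omega>) (\<theta>t n \<omega>)) 0"
      from has_bochner_integral_diff[OF this phi_mean]
      show "0 = sqrt (real n) *\<^sub>R (\<integral>w. R_alpha (w, \<beta>h n \<omega>) \<partial>F0)"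
        by (simp add: has_bochner_integral_iff R_alpha_def)
    qed
    with tends_in_prob_const[of 0]
    show "tends_in_prob M (\<lambda>n \<omega>. sqrt (real n) *\<^sub>R (\<integral>w. R_alpha (w, \<beta>h n \<omega>) \<partial>F0)) 0"
      by (rule tends_in_prob_cong)
  qed measurable
  have S3: "tends_in_prob M (\<lambda>n \<omega>. (\<Sum>i\<in>I n. \<Delta> (W i \<omega>, \<beta>h n \<omega>)) /\<^sub>R sqrt (real n)) 0"
    using A2
  proof (elim disjE conjE)
    assume "tends_in_prob M (\<lambda>n \<omega>. sqrt (real n) *\<^sub>R (\<integral>w. \<Delta> (w, \<beta>h n \<omega>) \<partial>F0)) 0"
      "tends_in_prob M (\<lambda>n \<omega>. \<integral>\<^sup>+w. ennreal ((norm (\<Delta> (w, \<beta>h n \<omega>)))\<^sup>2) \<partial>F0) 0"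
    then show ?thesis by (intro estimated_sum_tends_0) measurable
  next
    assume "tends_in_prob M (\<lambda>n \<omega>. (\<Sum>i\<in>I n. norm (\<Delta> (W i \<omega>, \<beta>h n \<omega>))) / sqrt (real n)) 0"
    then show ?thesis
    proof (rule tends_in_prob_squeeze, intro wpa1_always)
      fix n \<omega>
      have "norm (\<Sum>i\<in>I n. \<Delta> (W i \<omega>, \<beta>h n \<omega>)) / sqrt (real n)
          \<le> (\<Sum>i\<in>I n. norm (\<Delta> (W i \<omega>, \<beta>h n \<omega>))) / sqrt (real n)"
        by (intro divide_right_mono norm_sum) simp
      then show "norm ((\<Sum>i\<in>I n. \<Delta> (W i \<omega>, \<beta>h n \<omega>)) /\<^sub>R sqrt (real n) - 0)
          \<le> (\<Sum>i\<in>I n. norm (\<Delta> (W i \<omega>, \<beta>h n \<omega>))) / sqrt (real n)"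
        by (simp add: inverse_eq_divide)
    qed
  qed
  have "(g (W i \<omega>) (\<gamma>h n \<omega>) \<theta>0 + \<phi> (W i \<omega>) (\<gamma>h n \<omega>) (\<alpha>h n \<omega>) (\<theta>t n \<omega>))
      - (g (W i \<omega>) \<gamma>0 \<theta>0 + \<phi> (W i \<omega>) \<gamma>0 \<alpha>0 \<theta>0)
      = R (W i \<omega>, \<beta>h n \<omega>) + R_alpha (W i \<omega>, \<beta>h n \<omega>) + \<Delta> (W i \<omega>, \<beta>h n \<omega>)" for n \<omega> i
    by (simp add: R_def R_g_def R_phi_def R_alpha_def \<Delta>_def)
  then show ?thesis
    using tends_in_prob_add[OF tends_in_prob_add[OF S1 S2] S3]
    by (simp add: sum.distrib scaleR_add_right)
qed

text \<open>Evaluating \<open>g\<close> at the preliminary estimate \<open>\<theta>t\<close> adds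
  the remainder \<open>R_theta\<close>; the five mean squares control that of the sum.\<close>

lemma moment_error_mean_square:
  assumes A1: "tends_in_prob M (\<lambda>n \<omega>. \<integral>\<^sup>+w. ennreal ((norm (R_g (w, \<beta>h n \<omega>)))\<^sup>2) \<partial>F0) 0"
    "tends_in_prob M (\<lambda>n \<omega>. \<integral>\<^sup>+w. ennreal ((norm (R_phi (w, \<beta>h n \<omega>)))\<^sup>2) \<partial>F0) 0"
    "tends_in_prob M (\<lambda>n \<omega>. \<integral>\<^sup>+w. ennreal ((norm (R_alpha (w, \<beta>h n \<omega>)))\<^sup>2) \<partial>F0) 0"
    "tends_in_prob M (\<lambda>n \<omega>. \<integral>\<^sup>+w. ennreal ((norm (R_theta (w, \<beta>h n \<omega>)))\<^sup>2) \<partial>F0) 0"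
    "tends_in_prob M (\<lambda>n \<omega>. \<integral>\<^sup>+w. ennreal ((norm (\<Delta> (w, \<beta>h n \<omega>)))\<^sup>2) \<partial>F0) 0"
  shows "tends_in_prob M (\<lambda>n \<omega>. (\<Sum>i\<in>I n. (norm ((g (W i \<omega>) (\<gamma>h n \<omega>) (\<theta>t n \<omega>)
      + \<phi> (W i \<omega>) (\<gamma>h n \<omega>) (\<alpha>h n \<omega>) (\<theta>t n \<omega>))
      - (g (W i \<omega>) \<gamma>0 \<theta>0 + \<phi> (W i \<omega>) \<gamma>0 \<alpha>0 \<theta>0)))\<^sup>2) / real n) 0"
proof -
  have "tends_in_prob M (\<lambda>n \<omega>. \<integral>\<^sup>+w. ennreal ((norm (R_g (w, \<beta>h n \<omega>) + R_phi (w, \<beta>h n \<omega>)))\<^sup>2) \<partial>F0) 0"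
    by (rule mean_square_add[OF _ _ A1(1,2)]) measurable
  from mean_square_add[OF _ _ this A1(3)]
  have "tends_in_prob M (\<lambda>n \<omega>. \<integral>\<^sup>+w. ennreal ((norm (R_g (w, \<beta>h n \<omega>) + R_phi (w, \<beta>h n \<omega>)
      + R_alpha (w, \<beta>h n \<omega>)))\<^sup>2) \<partial>F0) 0" by measurable
  from mean_square_add[OF _ _ this A1(4)]
  have "tends_in_prob M (\<lambda>n \<omega>. \<integral>\<^sup>+w. ennreal ((norm (R_g (w, \<beta>h n \<omega>) + R_phi (w, \<beta>h n \<omega>)
      + R_alpha (w, \<beta>h n \<omega>) + R_theta (w, \<beta>h n \<omega>)))\<^sup>2) \<partial>F0) 0" by measurable
  from mean_square_add[OF _ _ this A1(5)]
  have "tends_in_prob M (\<lambda>n \<omega>. \<integral>\<^sup>+w. ennreal ((norm (R_g (w, \<beta>h n \<omega>) + R_phi (w, \<beta>h n \<omega>)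
      + R_alpha (w, \<beta>h n \<omega>) + R_theta (w, \<beta>h n \<omega>) + \<Delta> (w, \<beta>h n \<omega>)))\<^sup>2) \<partial>F0) 0" by measurable
  then have "tends_in_prob M (\<lambda>n \<omega>. (\<Sum>i\<in>I n. (norm (R_g (W i \<omega>, \<beta>h n \<omega>) + R_phi (W i \<omega>, \<beta>h n \<omega>)
      + R_alpha (W i \<omega>, \<beta>h n \<omega>) + R_theta (W i \<omega>, \<beta>h n \<omega>) + \<Delta> (W i \<omega>, \<beta>h n \<omega>)))\<^sup>2) / real n) 0"
    by (intro estimated_mean_tends_0[where h = "\<lambda>p. (norm (R_g p + R_phi p + R_alpha p + R_theta p + \<Delta> p))\<^sup>2"])
       auto
  moreover have "R_g (W i \<omega>, \<beta>h n \<omega>) + R_phi (W i \<omega>, \<beta>h n \<omega>)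
      + R_alpha (W i \<omega>, \<beta>h n \<omega>) + R_theta (W i \<omega>, \<beta>h n \<omega>) + \<Delta> (W i \<omega>, \<beta>h n \<omega>)
      = (g (W i \<omega>) (\<gamma>h n \<omega>) (\<theta>t n \<omega>) + \<phi> (W i \<omega>) (\<gamma>h n \<omega>) (\<alpha>h n \<omega>) (\<theta>t n \<omega>))
      - (g (W i \<omega>) \<gamma>0 \<theta>0 + \<phi> (W i \<omega>) \<gamma>0 \<alpha>0 \<theta>0)" for n \<omega> i
    by (simp add: R_g_def R_phi_def R_alpha_def R_theta_def \<Delta>_def)
  ultimately show ?thesis by simp
qed

lemma gamma_hat_in_space: "\<omega> \<in> space M \<Longrightarrow> \<gamma>h n \<omega> \<in> space \<G>"
  using estimate_in_space by (auto simp: space_pair_measure)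

lemma measurable_proj: "(\<lambda>p. (fst p, fst (snd p))) \<in> measurable (F0 \<Otimes>\<^sub>M E) (F0 \<Otimes>\<^sub>M \<G>)"
  by measurable

lemma smooth_on_fold:
  assumes D: "D \<in> sets (F0 \<Otimes>\<^sub>M \<G>)"
    and ae: "wpa1 M (\<lambda>n \<omega>. AE w in F0. (w, \<gamma>h n \<omega>) \<in> D)"
  shows "wpa1 M (\<lambda>n \<omega>. \<forall>i\<in>I n. (W i \<omega>, \<gamma>h n \<omega>) \<in> D)"
proof -
  define D' where "D' = (\<lambda>p. (fst p, fst (snd p))) -` D \<inter> space (F0 \<Otimes>\<^sub>M E)"
  have "D' \<in> sets (F0 \<Otimes>\<^sub>M E)" unfolding D'_def by (rule measurable_sets[OF measurable_proj D])
  moreover have "wpa1 M (\<lambda>n \<omega>. AE w in F0. (w, \<beta>h n \<omega>) \<in> D')"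
  proof (rule wpa1_space_mono[OF ae])
    fix n \<omega> assume \<omega>: "\<omega> \<in> space M" and "AE w in F0. (w, \<gamma>h n \<omega>) \<in> D"
    from this(2) AE_space show "AE w in F0. (w, \<beta>h n \<omega>) \<in> D'"
    proof eventually_elim
      case (elim w)
      then show ?case using estimate_in_space[OF \<omega>, of n] by (simp add: D'_def space_pair_measure)
    qed
  qed
  ultimately have "wpa1 M (\<lambda>n \<omega>. \<forall>i\<in>I n. (W i \<omega>, \<beta>h n \<omega>) \<in> D')" by (rule estimated_wpa1_AE)
  then show ?thesis by (rule wpa1_mono) (auto simp: D'_def)
qed

lemma lipschitz_mean_bounded:
  fixes d :: "'w \<Rightarrow> 'g \<Rightarrow> real"
  assumes d: "(\<lambda>(w, \<gamma>). d w \<gamma>) \<in> borel_measurable (F0 \<Otimes>\<^sub>M \<G>)" and c: "c \<ge> 0"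
    and le: "wpa1 M (\<lambda>n \<omega>. (\<integral>\<^sup>+w. ennreal \<bar>d w (\<gamma>h n \<omega>)\<bar> \<partial>F0) \<le> ennreal c)"
  shows "bounded_in_prob M (\<lambda>n \<omega>. (\<Sum>i\<in>I n. \<bar>d (W i \<omega>) (\<gamma>h n \<omega>)\<bar>) / real n)"
proof -
  have "(\<lambda>p. d (fst p) (fst (snd p))) \<in> borel_measurable (F0 \<Otimes>\<^sub>M E)"
    using measurable_compose[OF measurable_proj d] by simp
  then have "(\<lambda>p. \<bar>d (fst p) (fst (snd p))\<bar>) \<in> borel_measurable (F0 \<Otimes>\<^sub>M E)" by measurable
  from estimated_mean_bounded[OF this _ c] le show ?thesis by simp
qed

text \<open>For first steps near \<open>\<gamma>0\<close> the Jacobian agrees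
  \<open>F0\<close>-almost everywhere with its measurable version \<open>Jm\<close>. The integrated
  error passes to \<open>Jm\<close>, is turned into a fold average there, and returns to the
  Jacobians at the sample points, which lie in \<open>D\<close> for both
  \<open>\<gamma>h n \<omega>\<close> and \<open>\<gamma>0\<close> with probability tending to
  one.\<close>

lemma jacobian_error_on_fold:
  assumes N: "open N" "\<theta>0 \<in> N" "N \<subseteq> \<Theta>"
    and D: "D \<in> sets (F0 \<Otimes>\<^sub>M \<G>)" "\<And>\<gamma>. near \<gamma> \<Longrightarrow> AE w in F0. (w, \<gamma>) \<in> D"
    and diff: "\<And>\<gamma> w. near \<gamma> \<Longrightarrow> (w, \<gamma>) \<in> D \<Longrightarrow> g w \<gamma> differentiable (at \<theta>0)"
    and near: "near \<gamma>0" "wpa1 M (\<lambda>n \<omega>. near (\<gamma>h n \<omega>))"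
    and lim: "\<And>j k. tends_in_prob M (\<lambda>n \<omega>.
        \<integral>\<^sup>+w. ennreal \<bar>jacobian (g w (\<gamma>h n \<omega>)) (at \<theta>0) $ j $ k
                     - jacobian (g w \<gamma>0) (at \<theta>0) $ j $ k\<bar> \<partial>F0) 0"
  shows "tends_in_prob M (\<lambda>n \<omega>. (\<Sum>i\<in>I n. jacobian (g (W i \<omega>) (\<gamma>h n \<omega>)) (at \<theta>0)
      - jacobian (g (W i \<omega>) \<gamma>0) (at \<theta>0)) /\<^sub>R real n) 0"
proof -
  obtain Jm :: "'w \<times> 'g \<Rightarrow> real^'p^'m" where Jm: "\<And>j k. (\<lambda>p. Jm p $ j $ k) \<in> borel_measurable (F0 \<Otimes>\<^sub>M \<G>)"
    "\<And>w \<gamma>. g w \<gamma> differentiable (at \<theta>0) \<Longrightarrow> Jm (w, \<gamma>) = jacobian (g w \<gamma>) (at \<theta>0)"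
    using measurable_jacobian_version[OF g_meas N] by blast
  define e where "e j k w \<gamma> = \<bar>Jm (w, \<gamma>) $ j $ k - Jm (w, \<gamma>0) $ j $ k\<bar>" for j k w \<gamma>
  have em: "(\<lambda>p. e j k (fst p) (fst (snd p))) \<in> borel_measurable (F0 \<Otimes>\<^sub>M E)" for j k
  proof -
    have "(\<lambda>p. (fst p, \<gamma>0)) \<in> measurable (F0 \<Otimes>\<^sub>M E) (F0 \<Otimes>\<^sub>M \<G>)" by measurable
    from measurable_compose[OF this Jm(1)] measurable_compose[OF measurable_proj Jm(1)]
    show ?thesis unfolding e_def by measurable
  qed
  have "tends_in_prob M (\<lambda>n \<omega>. \<integral>\<^sup>+w. ennreal (e j k w (\<gamma>h n \<omega>)) \<partial>F0) 0" for j k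
  proof (rule tends_in_prob_cong[OF lim[of j k]], rule wpa1_mono[OF near(2)])
    fix n \<omega> assume nr: "near (\<gamma>h n \<omega>)"
    show "(\<integral>\<^sup>+w. ennreal \<bar>jacobian (g w (\<gamma>h n \<omega>)) (at \<theta>0) $ j $ k
        - jacobian (g w \<gamma>0) (at \<theta>0) $ j $ k\<bar> \<partial>F0) = (\<integral>\<^sup>+w. ennreal (e j k w (\<gamma>h n \<omega>)) \<partial>F0)"
    proof (rule nn_integral_cong_AE)
      from D(2)[OF nr] D(2)[OF near(1)]
      show "AE w in F0. ennreal \<bar>jacobian (g w (\<gamma>h n \<omega>)) (at \<theta>0) $ j $ k
        - jacobian (g w \<gamma>0) (at \<theta>0) $ j $ k\<bar> = ennreal (e j k w (\<gamma>h n \<omega>))"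
        by eventually_elim (simp add: e_def Jm(2) diff nr near(1))
    qed
  qed
  then have "tends_in_prob M (\<lambda>n \<omega>. (\<Sum>i\<in>I n. e j k (W i \<omega>) (\<gamma>h n \<omega>)) / real n) 0" for j k
    using estimated_mean_tends_0[OF em[of j k]] by (simp add: e_def)
  then have Y: "tends_in_prob M (\<lambda>n \<omega>. \<Sum>j\<in>UNIV. \<Sum>k\<in>UNIV. (\<Sum>i\<in>I n. e j k (W i \<omega>) (\<gamma>h n \<omega>)) / real n) 0"
    by (intro tends_in_prob_sum_0)
  have s1: "wpa1 M (\<lambda>n \<omega>. \<forall>i\<in>I n. (W i \<omega>, \<gamma>h n \<omega>) \<in> D)"
    by (rule smooth_on_fold[OF D(1)], rule wpa1_mono[OF near(2)], rule D(2))
  have s0: "wpa1 M (\<lambda>n \<omega>. \<forall>i\<in>I n. (W i \<omega>, \<gamma>0) \<in> D)"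
  proof -
    have "AE w in distr M F0 (W i). (w, \<gamma>0) \<in> D" if "i \<ge> 1" for i
      using D(2)[OF near(1)] by (simp only: ident[OF that])
    then have "AE \<omega> in M. (W i \<omega>, \<gamma>0) \<in> D" if "i \<ge> 1" for i
      by (rule AE_distrD[OF measurable_W[OF that]]) (rule that)
    then have "AE \<omega> in M. \<forall>i\<in>I n. (W i \<omega>, \<gamma>0) \<in> D" for n
      using I_ge_1 finite_I by (intro AE_finite_allI) auto
    then show ?thesis by (rule wpa1_AE[OF always_eventually, OF allI])
  qed
  show ?thesis
  proof (rule tends_in_prob_squeeze[OF Y], rule wpa1_mono[OF wpa1_conj[OF near(2) wpa1_conj[OF s1 s0]]])
    fix n \<omega>
    assume *: "near (\<gamma>h n \<omega>) \<and> (\<forall>i\<in>I n. (W i \<omega>, \<gamma>h n \<omega>) \<in> D) \<and> (\<forall>i\<in>I n. (W i \<omega>, \<gamma>0) \<in> D)"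
    define A where "A i = jacobian (g (W i \<omega>) (\<gamma>h n \<omega>)) (at \<theta>0) - jacobian (g (W i \<omega>) \<gamma>0) (at \<theta>0)" for i
    have A: "norm (A i) \<le> (\<Sum>j\<in>UNIV. \<Sum>k\<in>UNIV. e j k (W i \<omega>) (\<gamma>h n \<omega>))" if "i \<in> I n" for i
    proof -
      have "A i = Jm (W i \<omega>, \<gamma>h n \<omega>) - Jm (W i \<omega>, \<gamma>0)"
        using * that near(1) by (simp add: A_def Jm(2) diff)
      then have "e j k (W i \<omega>) (\<gamma>h n \<omega>) = \<bar>A i $ j $ k\<bar>" for j k by (simp add: e_def)
      moreover have "norm (A i) \<le> (\<Sum>j\<in>UNIV. norm (A i $ j))"
        unfolding norm_vec_def[of "A i"] by (rule L2_set_le_sum) simp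
      moreover have "(\<Sum>j\<in>UNIV. norm (A i $ j)) \<le> (\<Sum>j\<in>UNIV. \<Sum>k\<in>UNIV. \<bar>A i $ j $ k\<bar>)"
        by (intro sum_mono norm_le_l1_cart)
      ultimately show ?thesis by simp
    qed
    have "norm ((\<Sum>i\<in>I n. A i) /\<^sub>R real n) \<le> (\<Sum>i\<in>I n. norm (A i)) / real n"
      using divide_right_mono[OF norm_sum[of A "I n"], of "real n"] by (simp add: inverse_eq_divide)
    also have "\<dots> \<le> (\<Sum>i\<in>I n. \<Sum>j\<in>UNIV. \<Sum>k\<in>UNIV. e j k (W i \<omega>) (\<gamma>h n \<omega>)) / real n"
      by (intro divide_right_mono sum_mono A) auto
    also have "(\<Sum>i\<in>I n. \<Sum>j\<in>UNIV. \<Sum>k\<in>UNIV. e j k (W i \<omega>) (\<gamma>h n \<omega>))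
        = (\<Sum>j\<in>UNIV. \<Sum>k\<in>UNIV. \<Sum>i\<in>I n. e j k (W i \<omega>) (\<gamma>h n \<omega>))"
      by (subst sum.swap) (intro sum.cong refl sum.swap)
    finally show "norm ((\<Sum>i\<in>I n. jacobian (g (W i \<omega>) (\<gamma>h n \<omega>)) (at \<theta>0)
        - jacobian (g (W i \<omega>) \<gamma>0) (at \<theta>0)) /\<^sub>R real n - 0)
        \<le> (\<Sum>j\<in>UNIV. \<Sum>k\<in>UNIV. (\<Sum>i\<in>I n. e j k (W i \<omega>) (\<gamma>h n \<omega>)) / real n)"
      by (simp add: A_def sum_divide_distrib)
  qed
qed

end

text \<open>The event for the whole sample contains the event for \<open>W 1\<close>, whose
  probability does not depend on n. A constant sequence tending to 1 equals 1, and
  \<open>W 1\<close> has law \<open>F0\<close>.\<close>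

lemma (in iid_sample) AE_if_wpa1_sample:
  assumes D: "D \<in> sets (F0 \<Otimes>\<^sub>M \<G>)" and \<gamma>: "\<gamma> \<in> space \<G>"
    and wpa1: "wpa1 M (\<lambda>n \<omega>. \<forall>i\<in>{1..n}. (W i \<omega>, \<gamma>) \<in> D)"
  shows "AE w in F0. (w, \<gamma>) \<in> D"
proof -
  define B where "B = (\<lambda>w. (w, \<gamma>)) -` D \<inter> space F0"
  have B[measurable]: "B \<in> sets F0"
    unfolding B_def using \<gamma> by (intro measurable_sets[OF _ D] measurable_Pair) auto
  have "wpa1 M (\<lambda>n \<omega>. W 1 \<omega> \<in> B)"
  proof (rule wpa1_mp[OF wpa1], intro eventually_mono[OF eventually_ge_at_top[of 1]] ballI impI)
    fix n \<omega> assume "1 \<le> n" "\<omega> \<in> space M" "\<forall>i\<in>{1..n}. (W i \<omega>, \<gamma>) \<in> D"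
    then show "W 1 \<omega> \<in> B" using measurable_space[OF measurable_W[of 1]] by (auto simp: B_def)
  qed
  moreover have "{\<omega>\<in>space M. W 1 \<omega> \<in> B} = W 1 -` B \<inter> space M" by auto
  ultimately have "(\<lambda>n::nat. prob (W 1 -` B \<inter> space M)) \<longlonglongrightarrow> 1"
    using wpa1_iff[OF prob_space_axioms, of "\<lambda>n \<omega>. W 1 \<omega> \<in> B"] measurable_sets[OF measurable_W[of 1] B]
    by simp
  then have "prob (W 1 -` B \<inter> space M) = 1" by (simp add: LIMSEQ_const_iff)
  then have "F0.prob B = 1"
    using measure_distr[OF measurable_W[of 1] B] ident[of 1] by simp
  then have "AE w in F0. w \<in> B" by (rule F0.AE_prob_1)
  then show ?thesis by eventually_elim (simp add: B_def)
qed

section \<open>Second moment matrices\<close>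

text \<open>With \<open>d = a - b\<close> the difference is the sum of the rank one matrices d d', d
  b' and b d', whose norms factor.\<close>

lemma norm_outer_square_diff_le:
  "norm (outer_square a - outer_square b) \<le> (norm (a - b))\<^sup>2 + 2 * (norm b * norm (a - b))"
proof -
  define d where "d = a - b"
  have "outer_square a - outer_square b
      = (\<chi> i j. d $ i * d $ j) + (\<chi> i j. d $ i * b $ j) + (\<chi> i j. b $ i * d $ j)"
    by (simp add: outer_square_def d_def vec_eq_iff algebra_simps)
  also have "norm \<dots> \<le> norm d * norm d + norm d * norm b + norm b * norm d"
    by (intro norm_triangle_le add_mono) (simp_all add: norm_rank_one)
  finally show ?thesis by (simp add: d_def power2_eq_square mult.commute)
qed

text \<open>The quadratic part of the error is the average \<open>D\<close>. By Cauchy-Schwarz the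
  cross part is at most twice the square root of \<open>T\<close> times \<open>D\<close>, with
  \<open>T\<close> stochastically bounded.\<close>

lemma (in prob_space) outer_square_average_error:
  fixes a b :: "nat \<Rightarrow> nat \<Rightarrow> 'a \<Rightarrow> real^'m"
  assumes d: "tends_in_prob M (\<lambda>n \<omega>. (\<Sum>i\<in>K n. (norm (a n i \<omega> - b n i \<omega>))\<^sup>2) / real n) 0"
    and b: "bounded_in_prob M (\<lambda>n \<omega>. (\<Sum>i\<in>K n. (norm (b n i \<omega>))\<^sup>2) / real n)"
  shows "tends_in_prob M (\<lambda>n \<omega>. (\<Sum>i\<in>K n. outer_square (a n i \<omega>) - outer_square (b n i \<omega>)) /\<^sub>R real n) 0"
proof -
  define D where "D n \<omega> = (\<Sum>i\<in>K n. (norm (a n i \<omega> - b n i \<omega>))\<^sup>2) / real n" for n \<omega>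
  define T where "T n \<omega> = (\<Sum>i\<in>K n. (norm (b n i \<omega>))\<^sup>2) / real n" for n \<omega>
  have D0: "0 \<le> D n \<omega>" and T0: "0 \<le> T n \<omega>" for n \<omega>
    by (auto simp: D_def T_def intro!: divide_nonneg_nonneg sum_nonneg)
  have D: "tends_in_prob M D 0" using d by (simp add: D_def[abs_def])
  have "bounded_in_prob M (\<lambda>n \<omega>. 2 * sqrt (T n \<omega>))"
  proof (rule bounded_in_prob_wpa1[OF b, where f = "\<lambda>B. 2 * sqrt B"], intro wpa1_always impI)
    fix B n \<omega> assume "norm ((\<Sum>i\<in>K n. (norm (b n i \<omega>))\<^sup>2) / real n) \<le> B"
    then have "T n \<omega> \<le> B" using T0[of n \<omega>] by (simp add: T_def[symmetric])
    then show "norm (2 * sqrt (T n \<omega>)) \<le> 2 * sqrt B" using T0[of n \<omega>] by simp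
  qed
  moreover have "tends_in_prob M (\<lambda>n \<omega>. sqrt (D n \<omega>)) 0"
    using tends_in_prob_isCont[OF D, of sqrt] by (simp add: isCont_real_sqrt)
  ultimately have "tends_in_prob M (\<lambda>n \<omega>. 2 * sqrt (T n \<omega>) * sqrt (D n \<omega>)) 0"
    by (rule bounded_in_prob_mult)
  from tends_in_prob_add[OF D this]
  have Y: "tends_in_prob M (\<lambda>n \<omega>. D n \<omega> + 2 * sqrt (T n \<omega>) * sqrt (D n \<omega>)) 0" by simp
  show ?thesis
  proof (rule tends_in_prob_squeeze[OF Y], rule wpa1_always)
    fix n \<omega>
    have "(\<Sum>i\<in>K n. norm (b n i \<omega>) * norm (a n i \<omega> - b n i \<omega>))
        \<le> L2_set (\<lambda>i. norm (b n i \<omega>)) (K n) * L2_set (\<lambda>i. norm (a n i \<omega> - b n i \<omega>)) (K n)"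
      using L2_set_mult_ineq[of "\<lambda>i. norm (b n i \<omega>)" "\<lambda>i. norm (a n i \<omega> - b n i \<omega>)" "K n"] by simp
    then have "(\<Sum>i\<in>K n. norm (b n i \<omega>) * norm (a n i \<omega> - b n i \<omega>)) / real n
        \<le> L2_set (\<lambda>i. norm (b n i \<omega>)) (K n) * L2_set (\<lambda>i. norm (a n i \<omega> - b n i \<omega>)) (K n) / real n"
      by (rule divide_right_mono) simp
    also have "\<dots> = sqrt (T n \<omega>) * sqrt (D n \<omega>)"
      by (simp add: T_def D_def L2_set_def real_sqrt_divide)
    finally have CS: "(\<Sum>i\<in>K n. norm (b n i \<omega>) * norm (a n i \<omega> - b n i \<omega>)) / real n
        \<le> sqrt (T n \<omega>) * sqrt (D n \<omega>)" .
    have "norm ((\<Sum>i\<in>K n. outer_square (a n i \<omega>) - outer_square (b n i \<omega>)) /\<^sub>R real n)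
        \<le> (\<Sum>i\<in>K n. norm (outer_square (a n i \<omega>) - outer_square (b n i \<omega>))) / real n"
      using divide_right_mono[OF norm_sum[of "\<lambda>i. outer_square (a n i \<omega>) - outer_square (b n i \<omega>)" "K n"],
          of "real n"] by (simp add: inverse_eq_divide)
    also have "\<dots> \<le> (\<Sum>i\<in>K n. (norm (a n i \<omega> - b n i \<omega>))\<^sup>2
        + 2 * (norm (b n i \<omega>) * norm (a n i \<omega> - b n i \<omega>))) / real n"
      by (intro divide_right_mono sum_mono norm_outer_square_diff_le) simp
    also have "\<dots> = D n \<omega> + 2 * ((\<Sum>i\<in>K n. norm (b n i \<omega>) * norm (a n i \<omega> - b n i \<omega>)) / real n)"
      by (simp add: D_def sum.distrib add_divide_distrib sum_distrib_left)
    also have "\<dots> \<le> D n \<omega> + 2 * sqrt (T n \<omega>) * sqrt (D n \<omega>)" using CS by simp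
    finally show "norm ((\<Sum>i\<in>K n. outer_square (a n i \<omega>) - outer_square (b n i \<omega>)) /\<^sub>R real n - 0)
        \<le> D n \<omega> + 2 * sqrt (T n \<omega>) * sqrt (D n \<omega>)" by simp
  qed
qed

text \<open>Quadratic forms and transposition are linear in the matrix, so they pass through the
  Bochner integral.\<close>

lemma
  fixes f :: "'w \<Rightarrow> real^'m"
  assumes f[measurable]: "f \<in> borel_measurable F" and sq: "integrable F (\<lambda>w. (norm (f w))\<^sup>2)"
  shows integrable_outer_square: "integrable F (\<lambda>w. outer_square (f w))"
    and outer_square_integral_quadratic: "x \<bullet> ((\<integral>w. outer_square (f w) \<partial>F) *v x) = (\<integral>w. (x \<bullet> f w)\<^sup>2 \<partial>F)"
    and transpose_outer_square_integral: "transpose (\<integral>w. outer_square (f w) \<partial>F) = (\<integral>w. outer_square (f w) \<partial>F)"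
proof -
  have "continuous_on UNIV (outer_square :: real^'m \<Rightarrow> _)"
    unfolding outer_square_def by (intro continuous_intros)
  then have [measurable]: "outer_square \<in> borel_measurable (borel :: (real^'m) measure)"
    by (rule borel_measurable_continuous_onI)
  have "norm (outer_square v) = (norm v)\<^sup>2" for v :: "real^'m"
    using norm_rank_one[of v v] by (simp add: outer_square_def power2_eq_square)
  then show int: "integrable F (\<lambda>w. outer_square (f w))"
    using sq by (intro Bochner_Integration.integrable_bound[OF sq]) auto
  have "linear (\<lambda>A::real^'m^'m. x \<bullet> (A *v x))"
    by (rule linearI) (simp_all add: matrix_vector_mult_add_rdistrib inner_add_right
        scaleR_matrix_vector_assoc[symmetric])
  then have "bounded_linear (\<lambda>A::real^'m^'m. x \<bullet> (A *v x))" by (simp add: linear_conv_bounded_linear)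
  from integral_bounded_linear[OF this int]
  show "x \<bullet> ((\<integral>w. outer_square (f w) \<partial>F) *v x) = (\<integral>w. (x \<bullet> f w)\<^sup>2 \<partial>F)"
    by (simp add: outer_square_mult power2_eq_square inner_commute)
  have "linear (transpose :: real^'m^'m \<Rightarrow> _)"
    by (rule linearI) (simp_all add: transpose_def vec_eq_iff)
  then have "bounded_linear (transpose :: real^'m^'m \<Rightarrow> _)" by (simp add: linear_conv_bounded_linear)
  from integral_bounded_linear[OF this int]
  show "transpose (\<integral>w. outer_square (f w) \<partial>F) = (\<integral>w. outer_square (f w) \<partial>F)"
    by (simp add: outer_square_def transpose_def mult.commute)
qed

lemma transpose_matrix_inv:
  fixes A :: "real^'n^'n"
  assumes A: "invertible A" and sym: "transpose A = A"
  shows "transpose (matrix_inv A) = matrix_inv A"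
proof -
  have "transpose (matrix_inv A) ** A = mat 1"
    using arg_cong[OF matrix_inv_right[OF A], of transpose] sym by (simp add: matrix_transpose_mul)
  then have "transpose (matrix_inv A) ** (A ** matrix_inv A) = matrix_inv A"
    by (simp add: matrix_mul_assoc)
  then show ?thesis by (simp add: matrix_inv_right[OF A])
qed

lemma transpose_uminus: "transpose (- A) = - transpose (A :: real^'n^'m)"
  by (simp add: transpose_def vec_eq_iff)

lemma matrix_mult_minus_left: "(- A) ** B = - (A ** B)" for A :: "real^'n^'m" and B :: "real^'k^'n"
  by (simp add: matrix_matrix_mult_def vec_eq_iff sum_negf)

lemma matrix_mult_minus_right: "A ** (- B) = - (A ** B)" for A :: "real^'n^'m" and B :: "real^'k^'n"
  by (simp add: matrix_matrix_mult_def vec_eq_iff sum_negf)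

text \<open>Presents the asymptotic variance as that of the moments mapped by \<open>B\<close>, the
  matrix of the linearization; this shows it to be positive semidefinite and matches it with the
  limit theorem.\<close>

lemma gmm_variance_eq_sandwich:
  fixes G :: "real^'p^'m"
  assumes sym: "transpose \<Upsilon> = \<Upsilon>" and inv: "invertible (transpose G ** \<Upsilon> ** G)"
  defines "B \<equiv> - (matrix_inv (transpose G ** \<Upsilon> ** G) ** transpose G ** \<Upsilon>)"
  shows "gmm_variance G \<Upsilon> \<Psi> = B ** \<Psi> ** transpose B"
proof -
  have "transpose (transpose G ** \<Upsilon> ** G) = transpose G ** \<Upsilon> ** G"
    by (simp add: matrix_transpose_mul sym matrix_mul_assoc)
  from transpose_matrix_inv[OF inv this]
  have "transpose B = - (\<Upsilon> ** G ** matrix_inv (transpose G ** \<Upsilon> ** G))"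
    by (simp add: B_def transpose_uminus matrix_transpose_mul sym matrix_mul_assoc)
  then show ?thesis
    by (simp add: gmm_variance_def B_def matrix_mult_minus_left matrix_mult_minus_right matrix_mul_assoc)
qed

text \<open>The constants \<open>c l i\<close> stand for the influence function terms, which sit at
  the preliminary estimate and do not move with \<open>\<theta>\<close>.\<close>

lemma jacobian_average:
  fixes f :: "'i \<Rightarrow> 'j \<Rightarrow> real^'p \<Rightarrow> real^'m"
  assumes "\<And>l i. l \<in> S \<Longrightarrow> i \<in> T l \<Longrightarrow> f l i differentiable (at \<theta>)"
  shows "(\<lambda>\<theta>. r *\<^sub>R (\<Sum>l\<in>S. \<Sum>i\<in>T l. f l i \<theta> + c l i)) differentiable (at \<theta>)"
    and "jacobian (\<lambda>\<theta>. r *\<^sub>R (\<Sum>l\<in>S. \<Sum>i\<in>T l. f l i \<theta> + c l i)) (at \<theta>)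
      = r *\<^sub>R (\<Sum>l\<in>S. \<Sum>i\<in>T l. jacobian (f l i) (at \<theta>))"
proof -
  have lin: "linear (\<lambda>A::real^'p^'m. A *v h)" for h
    by (rule linearI) (simp_all add: matrix_vector_mult_add_rdistrib scaleR_matrix_vector_assoc[symmetric])
  have "((\<lambda>\<theta>. r *\<^sub>R (\<Sum>l\<in>S. \<Sum>i\<in>T l. f l i \<theta> + c l i)) has_derivative
      (\<lambda>h. r *\<^sub>R (\<Sum>l\<in>S. \<Sum>i\<in>T l. jacobian (f l i) (at \<theta>) *v h + 0))) (at \<theta>)"
    using assms unfolding jacobian_works
    by (intro has_derivative_scaleR_right has_derivative_sum has_derivative_add has_derivative_const)
  also have "(\<lambda>h. r *\<^sub>R (\<Sum>l\<in>S. \<Sum>i\<in>T l. jacobian (f l i) (at \<theta>) *v h + 0))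
      = (\<lambda>h. (r *\<^sub>R (\<Sum>l\<in>S. \<Sum>i\<in>T l. jacobian (f l i) (at \<theta>))) *v h)"
    by (simp add: linear_scale[OF lin] linear_sum[OF lin] fun_eq_iff)
  finally have D: "((\<lambda>\<theta>. r *\<^sub>R (\<Sum>l\<in>S. \<Sum>i\<in>T l. f l i \<theta> + c l i)) has_derivative
      (\<lambda>h. (r *\<^sub>R (\<Sum>l\<in>S. \<Sum>i\<in>T l. jacobian (f l i) (at \<theta>))) *v h)) (at \<theta>)" .
  then show "(\<lambda>\<theta>. r *\<^sub>R (\<Sum>l\<in>S. \<Sum>i\<in>T l. f l i \<theta> + c l i)) differentiable (at \<theta>)"
    by (rule differentiableI)
  from D show "jacobian (\<lambda>\<theta>. r *\<^sub>R (\<Sum>l\<in>S. \<Sum>i\<in>T l. f l i \<theta> + c l i)) (at \<theta>)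
      = r *\<^sub>R (\<Sum>l\<in>S. \<Sum>i\<in>T l. jacobian (f l i) (at \<theta>))"
    by (rule jacobian_eqI)
qed

section \<open>Asymptotic normality of the debiased GMM estimator\<close>

theorem theorem18:
  fixes M :: "'o measure"
    and F0 :: "'w measure"
    and W :: "nat \<Rightarrow> 'o \<Rightarrow> 'w"
    and \<Gamma> :: "'g::real_vector set"
    and \<G> :: "'g measure"
    and \<A> :: "'a measure"
    and \<Theta> :: "(real^'p) set"
    and g :: "'w \<Rightarrow> 'g \<Rightarrow> real^'p \<Rightarrow> real^'m"
    and \<phi> :: "'w \<Rightarrow> 'g \<Rightarrow> 'a \<Rightarrow> real^'p \<Rightarrow> real^'m"
    and \<gamma>0 :: 'g and \<alpha>0 :: 'a and \<theta>0 :: "real^'p"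
    and \<H> :: "'w measure set"
    and step :: "nat \<Rightarrow> (nat \<Rightarrow> 'w) \<Rightarrow> 'g"
    and \<gamma>lim :: "'w measure \<Rightarrow> 'g"
    and L :: nat
    and I :: "nat \<Rightarrow> nat \<Rightarrow> nat set"
    and \<gamma>h :: "nat \<Rightarrow> nat \<Rightarrow> 'o \<Rightarrow> 'g"
    and \<alpha>h :: "nat \<Rightarrow> nat \<Rightarrow> 'o \<Rightarrow> 'a"
    and \<theta>t :: "nat \<Rightarrow> nat \<Rightarrow> 'o \<Rightarrow> real^'p"
    and \<theta>h :: "nat \<Rightarrow> 'o \<Rightarrow> real^'p"
    and \<Upsilon>h :: "nat \<Rightarrow> 'o \<Rightarrow> real^'m^'m"
    and \<Upsilon> :: "real^'m^'m"
    and G :: "real^'p^'m"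
    and \<psi> :: "'w \<Rightarrow> 'g \<Rightarrow> 'a \<Rightarrow> real^'p \<Rightarrow> real^'m"
    and \<psi>bar :: "'g \<Rightarrow> 'a \<Rightarrow> real^'p \<Rightarrow> real^'m"
    and \<Psi> :: "real^'m^'m"
    and \<Delta>h :: "nat \<Rightarrow> nat \<Rightarrow> 'o \<Rightarrow> 'w \<Rightarrow> real^'m"
    and \<psi>h :: "nat \<Rightarrow> 'o \<Rightarrow> real^'p \<Rightarrow> real^'m"
    and Gh :: "nat \<Rightarrow> 'o \<Rightarrow> real^'p^'m"
    and \<psi>hi :: "nat \<Rightarrow> nat \<Rightarrow> nat \<Rightarrow> 'o \<Rightarrow> real^'m"
    and \<Psi>h :: "nat \<Rightarrow> 'o \<Rightarrow> real^'m^'m"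
  \<comment> \<open>the i.i.d. sample\<close>
  assumes prob_M: "prob_space M" and prob_F0: "prob_space F0"
    and indep: "prob_space.indep_vars M (\<lambda>_. F0) W {1..}"
    and ident: "\<And>i. i \<ge> 1 \<Longrightarrow> distr M F0 (W i) = F0"
  \<comment> \<open>parameter spaces, true values and measurability conventions\<close>
    and Gamma: "subspace \<Gamma>" "space \<G> = \<Gamma>"
    and true_values: "\<gamma>0 \<in> \<Gamma>" "\<alpha>0 \<in> space \<A>" "\<theta>0 \<in> \<Theta>"
    and g_meas: "(\<lambda>(w, \<gamma>, \<theta>). g w \<gamma> \<theta>)
        \<in> borel_measurable (F0 \<Otimes>\<^sub>M \<G> \<Otimes>\<^sub>M restrict_space borel \<Theta>)"
    and phi_meas: "(\<lambda>(w, \<gamma>, \<alpha>, \<theta>). \<phi> w \<gamma> \<alpha> \<theta>)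
        \<in> borel_measurable (F0 \<Otimes>\<^sub>M \<G> \<Otimes>\<^sub>M \<A> \<Otimes>\<^sub>M restrict_space borel \<Theta>)"
  \<comment> \<open>identifying moments, influence function, debiased moments\<close>
    and moments: "has_bochner_integral F0 (\<lambda>w. g w \<gamma>0 \<theta>0) 0"
    and influence: "influence_function F0 \<Gamma> \<Theta> \<H> step \<gamma>lim g \<phi> \<gamma>0 \<alpha>0"
    and psi_def: "\<psi> = (\<lambda>w \<gamma> \<alpha> \<theta>. g w \<gamma> \<theta> + \<phi> w \<gamma> \<alpha> \<theta>)"
    and psibar_def: "\<psi>bar = (\<lambda>\<gamma> \<alpha> \<theta>. \<integral>w. \<psi> w \<gamma> \<alpha> \<theta> \<partial>F0)"
    and Psi_def: "\<Psi> = (\<integral>w. outer_square (\<psi> w \<gamma>0 \<alpha>0 \<theta>0) \<partial>F0)"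
    and neyman: "\<And>\<gamma>. \<gamma> \<in> \<Gamma> \<Longrightarrow>
        (\<forall>\<^sub>F \<tau> in nhds 0. integrable F0 (\<lambda>w. \<psi> w ((1 - \<tau>) *\<^sub>R \<gamma>0 + \<tau> *\<^sub>R \<gamma>) \<alpha>0 \<theta>0)) \<and>
        ((\<lambda>\<tau>. \<psi>bar ((1 - \<tau>) *\<^sub>R \<gamma>0 + \<tau> *\<^sub>R \<gamma>) \<alpha>0 \<theta>0) has_vector_derivative 0) (at 0)"
  \<comment> \<open>cross-fitting\<close>
    and folds: "\<And>n. disjoint_family_on (I n) {1..L}" "\<And>n. (\<Union>l\<in>{1..L}. I n l) = {1..n}"
    and gamma_hat: "\<And>n l. l \<in> {1..L} \<Longrightarrow> uses_only M F0 W ({1..n} - I n l) (\<gamma>h n l) \<G>"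
    and alpha_hat: "\<And>n l. l \<in> {1..L} \<Longrightarrow> uses_only M F0 W ({1..n} - I n l) (\<alpha>h n l) \<A>"
    and theta_tilde: "\<And>n l. l \<in> {1..L} \<Longrightarrow>
        uses_only M F0 W ({1..n} - I n l) (\<theta>t n l) (restrict_space borel \<Theta>)"
    and Delta_def: "\<Delta>h = (\<lambda>n l \<omega> w.
        \<phi> w (\<gamma>h n l \<omega>) (\<alpha>h n l \<omega>) (\<theta>t n l \<omega>) - \<phi> w \<gamma>0 (\<alpha>h n l \<omega>) (\<theta>t n l \<omega>)
        - \<phi> w (\<gamma>h n l \<omega>) \<alpha>0 \<theta>0 + \<phi> w \<gamma>0 \<alpha>0 \<theta>0)"
    and psihat_def: "\<psi>h = (\<lambda>n \<omega> \<theta>. (1 / real n) *\<^sub>R (\<Sum>l\<in>{1..L}. \<Sum>i\<in>I n l.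
        g (W i \<omega>) (\<gamma>h n l \<omega>) \<theta> + \<phi> (W i \<omega>) (\<gamma>h n l \<omega>) (\<alpha>h n l \<omega>) (\<theta>t n l \<omega>)))"
  \<comment> \<open>the debiased GMM estimator and the variance ingredients\<close>
    and weights: "\<And>n \<omega>. \<omega> \<in> space M \<Longrightarrow> pos_semidef (\<Upsilon>h n \<omega>)"
    and theta_hat_meas: "\<And>n. \<theta>h n \<in> borel_measurable M"
    and theta_hat: "\<And>n \<omega>. \<omega> \<in> space M \<Longrightarrow>
        is_arg_min (\<lambda>\<theta>. \<psi>h n \<omega> \<theta> \<bullet> (\<Upsilon>h n \<omega> *v \<psi>h n \<omega> \<theta>)) (\<lambda>\<theta>. \<theta> \<in> \<Theta>) (\<theta>h n \<omega>)"
    and Ghat_def: "Gh = (\<lambda>n \<omega>. jacobian (\<psi>h n \<omega>) (at (\<theta>h n \<omega>)))"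
    and psihati_def: "\<psi>hi = (\<lambda>n l i \<omega>. g (W i \<omega>) (\<gamma>h n l \<omega>) (\<theta>t n l \<omega>)
        + \<phi> (W i \<omega>) (\<gamma>h n l \<omega>) (\<alpha>h n l \<omega>) (\<theta>t n l \<omega>))"
    and Psihat_def: "\<Psi>h = (\<lambda>n \<omega>. (1 / real n) *\<^sub>R
        (\<Sum>l\<in>{1..L}. \<Sum>i\<in>I n l. outer_square (\<psi>hi n l i \<omega>)))"
  \<comment> \<open>Assumption 1\<close>
    and A1: "integrable F0 (\<lambda>w. (norm (\<psi> w \<gamma>0 \<alpha>0 \<theta>0))\<^sup>2)"
    and A1_i: "\<And>l. l \<in> {1..L} \<Longrightarrow> tends_in_prob M (\<lambda>n \<omega>.
        \<integral>\<^sup>+w. ennreal ((norm (g w (\<gamma>h n l \<omega>) \<theta>0 - g w \<gamma>0 \<theta>0))\<^sup>2) \<partial>F0) 0"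
    and A1_ii: "\<And>l. l \<in> {1..L} \<Longrightarrow> tends_in_prob M (\<lambda>n \<omega>.
        \<integral>\<^sup>+w. ennreal ((norm (\<phi> w (\<gamma>h n l \<omega>) \<alpha>0 \<theta>0 - \<phi> w \<gamma>0 \<alpha>0 \<theta>0))\<^sup>2) \<partial>F0) 0"
    and A1_iii: "\<And>l. l \<in> {1..L} \<Longrightarrow> tends_in_prob M (\<lambda>n \<omega>.
        \<integral>\<^sup>+w. ennreal ((norm (\<phi> w \<gamma>0 (\<alpha>h n l \<omega>) (\<theta>t n l \<omega>) - \<phi> w \<gamma>0 \<alpha>0 \<theta>0))\<^sup>2) \<partial>F0) 0"
  \<comment> \<open>Assumption 2\<close>
    and A2: "\<And>l. l \<in> {1..L} \<Longrightarrow>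
        (tends_in_prob M (\<lambda>n \<omega>. sqrt (real n) *\<^sub>R (\<integral>w. \<Delta>h n l \<omega> w \<partial>F0)) 0 \<and>
         tends_in_prob M (\<lambda>n \<omega>. \<integral>\<^sup>+w. ennreal ((norm (\<Delta>h n l \<omega> w))\<^sup>2) \<partial>F0) 0)
        \<or> tends_in_prob M (\<lambda>n \<omega>. (\<Sum>i\<in>I n l. norm (\<Delta>h n l \<omega> (W i \<omega>))) / sqrt (real n)) 0
        \<or> tends_in_prob M (\<lambda>n \<omega>. (\<Sum>i\<in>I n l. \<Delta>h n l \<omega> (W i \<omega>)) /\<^sub>R sqrt (real n)) 0"
  \<comment> \<open>Assumption 3\<close>
    and A3_i: "\<And>n l. n \<ge> 1 \<Longrightarrow> l \<in> {1..L} \<Longrightarrow>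
        AE \<omega> in M. has_bochner_integral F0 (\<lambda>w. \<phi> w \<gamma>0 (\<alpha>h n l \<omega>) (\<theta>t n l \<omega>)) 0"
    and A3: "\<And>l. l \<in> {1..L} \<Longrightarrow>
        ((\<forall>\<gamma>\<in>\<Gamma>. integrable F0 (\<lambda>w. \<psi> w \<gamma> \<alpha>0 \<theta>0)) \<and>
         (\<forall>\<gamma>1\<in>\<Gamma>. \<forall>\<gamma>2\<in>\<Gamma>. \<forall>s::real. \<psi>bar ((1 - s) *\<^sub>R \<gamma>1 + s *\<^sub>R \<gamma>2) \<alpha>0 \<theta>0
            = (1 - s) *\<^sub>R \<psi>bar \<gamma>1 \<alpha>0 \<theta>0 + s *\<^sub>R \<psi>bar \<gamma>2 \<alpha>0 \<theta>0))
        \<or> (\<exists>nrm. norm_on \<Gamma> nrm \<and>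
             tends_in_prob M (\<lambda>n \<omega>. real n powr (1/4) * nrm (\<gamma>h n l \<omega> - \<gamma>0)) 0 \<and>
             (\<exists>C. \<exists>\<delta>>0. \<forall>\<gamma>\<in>\<Gamma>. nrm (\<gamma> - \<gamma>0) < \<delta> \<longrightarrow>
                integrable F0 (\<lambda>w. \<psi> w \<gamma> \<alpha>0 \<theta>0) \<and>
                norm (\<psi>bar \<gamma> \<alpha>0 \<theta>0) \<le> C * (nrm (\<gamma> - \<gamma>0))\<^sup>2))
        \<or> tends_in_prob M (\<lambda>n \<omega>. sqrt (real n) *\<^sub>R \<psi>bar (\<gamma>h n l \<omega>) \<alpha>0 \<theta>0) 0"
  \<comment> \<open>Assumption 4; \<open>D\<close> is a jointly measurable set of \<open>(w, \<gamma>)\<close> at which \<open>g w \<gamma>\<close> is smooth\<close>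
    and G_def: "has_bochner_integral F0 (\<lambda>w. jacobian (g w \<gamma>0) (at \<theta>0)) G"
    and A4: "\<exists>N nrm. open N \<and> \<theta>0 \<in> N \<and> N \<subseteq> \<Theta> \<and> norm_on \<Gamma> nrm \<and>
        (\<forall>l\<in>{1..L}. tends_in_prob M (\<lambda>n \<omega>. nrm (\<gamma>h n l \<omega> - \<gamma>0)) 0) \<and>
        (\<exists>\<delta>>0. \<exists>C>0. \<exists>d :: 'w \<Rightarrow> 'g \<Rightarrow> real. \<exists>D\<in>sets (F0 \<Otimes>\<^sub>M \<G>).
           (\<lambda>(w, \<gamma>). d w \<gamma>) \<in> borel_measurable (F0 \<Otimes>\<^sub>M \<G>) \<and>
           (\<forall>\<gamma>\<in>\<Gamma>. nrm (\<gamma> - \<gamma>0) < \<delta> \<longrightarrow>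
              wpa1 M (\<lambda>n \<omega>. \<forall>i\<in>{1..n}. (W i \<omega>, \<gamma>) \<in> D) \<and>
              integrable F0 (\<lambda>w. d w \<gamma>) \<and> (\<integral>w. d w \<gamma> \<partial>F0) < C \<and>
              (\<forall>w. (w, \<gamma>) \<in> D \<longrightarrow> (\<forall>\<theta>\<in>N. g w \<gamma> differentiable (at \<theta>) \<and>
                 norm (jacobian (g w \<gamma>) (at \<theta>) - jacobian (g w \<gamma>) (at \<theta>0))
                   \<le> d w \<gamma> * norm (\<theta> - \<theta>0) powr (1 / C)))))"
    and A4_iii: "\<And>l j k. l \<in> {1..L} \<Longrightarrow> tends_in_prob M (\<lambda>n \<omega>.
        \<integral>\<^sup>+w. ennreal \<bar>jacobian (g w (\<gamma>h n l \<omega>)) (at \<theta>0) $ j $ k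
                     - jacobian (g w \<gamma>0) (at \<theta>0) $ j $ k\<bar> \<partial>F0) 0"
  \<comment> \<open>consistency and rank conditions\<close>
    and theta_hat_cons: "tends_in_prob M \<theta>h \<theta>0"
    and Upsilon_cons: "tends_in_prob M \<Upsilon>h \<Upsilon>"
    and nonsing: "invertible (transpose G ** \<Upsilon> ** G)"
  shows "(\<exists>N. is_multivariate_normal N 0 (gmm_variance G \<Upsilon> \<Psi>) \<and>
            converges_weakly
              (\<lambda>n. distr M borel (\<lambda>\<omega>. sqrt (real n) *\<^sub>R (\<theta>h n \<omega> - \<theta>0))) N)
      \<and> ((\<forall>l\<in>{1..L}.
             tends_in_prob M (\<lambda>n \<omega>. \<integral>\<^sup>+w. ennreal ((norm
               (g w (\<gamma>h n l \<omega>) (\<theta>t n l \<omega>) - g w (\<gamma>h n l \<omega>) \<theta>0))\<^sup>2) \<partial>F0) 0 \<and>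
             tends_in_prob M (\<lambda>n \<omega>. \<integral>\<^sup>+w. ennreal ((norm (\<Delta>h n l \<omega> w))\<^sup>2) \<partial>F0) 0)
         \<longrightarrow> tends_in_prob M (\<lambda>n \<omega>. gmm_variance (Gh n \<omega>) (\<Upsilon>h n \<omega>) (\<Psi>h n \<omega>))
               (gmm_variance G \<Upsilon> \<Psi>))"
proof -

  \<comment> \<open>The folds and the moments at the true values\<close>
  interpret S: iid_sample M F0 W
    by (intro iid_sample.intro iid_sample_axioms.intro prob_M prob_F0 indep ident)
  have phi0: "has_bochner_integral F0 (\<lambda>w. \<phi> w \<gamma>0 \<alpha>0 \<theta>0) 0"
    using influence true_values(3) unfolding influence_function_def by blast
  have gm0: "\<gamma>0 \<in> space \<G>" using true_values(1) Gamma(2) by simp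
  have sub_nat: "I n l \<subseteq> {1..n}" if "l \<in> {1..L}" for n l using folds(2)[of n] that by blast
  have fold: "dml_fold M F0 W (\<lambda>n. I n l) (\<lambda>n. {1..n} - I n l) \<G> \<A> \<Theta>
      (\<lambda>n. \<gamma>h n l) (\<lambda>n. \<alpha>h n l) (\<lambda>n. \<theta>t n l) g \<phi> \<gamma>0 \<alpha>0 \<theta>0" if l: "l \<in> {1..L}" for l
  proof (intro dml_fold.intro fitted_fold.intro cross_fit.intro cross_fit_axioms.intro
      fitted_fold_axioms.intro dml_fold_axioms.intro)
    show "iid_sample M F0 W" by (rule S.iid_sample_axioms)
    show "uses_only M F0 W ({1..n} - I n l) (\<lambda>\<omega>. (\<gamma>h n l \<omega>, \<alpha>h n l \<omega>, \<theta>t n l \<omega>))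
        (\<G> \<Otimes>\<^sub>M \<A> \<Otimes>\<^sub>M restrict_space borel \<Theta>)" for n
      by (intro uses_only_Pair gamma_hat alpha_hat theta_tilde l)
  qed (use sub_nat[OF l] gm0 true_values g_meas phi_meas moments phi0 in auto)
  have gh\<Gamma>: "\<gamma>h n l \<omega> \<in> \<Gamma>" if "l \<in> {1..L}" "\<omega> \<in> space M" for n l \<omega>
    using dml_fold.gamma_hat_in_space[OF fold[OF that(1)] that(2)] Gamma(2) by simp
  have sum_folds: "(\<Sum>l\<in>{1..L}. \<Sum>i\<in>I n l. f i) = (\<Sum>i\<in>{1..n}. f i)" for n and f :: "nat \<Rightarrow> 'z::comm_monoid_add"
  proof -
    have "finite (I n l)" if "l \<in> {1..L}" for l using sub_nat[OF that] finite_subset by blast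
    then show ?thesis
      unfolding folds(2)[of n, symmetric] using folds(1)[of n]
      by (intro sum.UNION_disjoint[symmetric]) (auto simp: disjoint_family_on_def)
  qed

  define \<psi>0 where "\<psi>0 w = g w \<gamma>0 \<theta>0 + \<phi> w \<gamma>0 \<alpha>0 \<theta>0" for w
  define S where "S n \<omega> = (\<Sum>i\<in>{1..n}. \<psi>0 (W i \<omega>)) /\<^sub>R sqrt (real n)" for n \<omega>
  have psi0_int: "has_bochner_integral F0 \<psi>0 0"
    using has_bochner_integral_add[OF moments phi0] by (simp add: \<psi>0_def[abs_def])
  then have psi0_meas[measurable]: "\<psi>0 \<in> borel_measurable F0" and psi0_mean: "(\<integral>w. \<psi>0 w \<partial>F0) = 0"
    by (auto simp: has_bochner_integral_iff)
  have psi0_sq: "integrable F0 (\<lambda>w. (norm (\<psi>0 w))\<^sup>2)" using A1 by (simp add: psi_def \<psi>0_def)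
  have S_bdd: "bounded_in_prob M S"
    unfolding S_def by (rule S.normalized_sum_bounded[OF psi0_meas psi0_sq psi0_mean])

  \<comment> \<open>Expansion of the moments\<close>
  have score_fold: "tends_in_prob M (\<lambda>n \<omega>. (\<Sum>i\<in>I n l. (g (W i \<omega>) (\<gamma>h n l \<omega>) \<theta>0
      + \<phi> (W i \<omega>) (\<gamma>h n l \<omega>) (\<alpha>h n l \<omega>) (\<theta>t n l \<omega>)) - \<psi>0 (W i \<omega>)) /\<^sub>R sqrt (real n)) 0"
    if l: "l \<in> {1..L}" for l
  proof -
    interpret F: dml_fold M F0 W "\<lambda>n. I n l" "\<lambda>n. {1..n} - I n l" \<G> \<A> \<Theta>
      "\<lambda>n. \<gamma>h n l" "\<lambda>n. \<alpha>h n l" "\<lambda>n. \<theta>t n l" g \<phi> \<gamma>0 \<alpha>0 \<theta>0 by (rule fold[OF l])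
    have "tends_in_prob M (\<lambda>n \<omega>. sqrt (real n) *\<^sub>R \<psi>bar (\<gamma>h n l \<omega>) \<alpha>0 \<theta>0) 0"
    proof (rule S.neyman_bias_negligible[OF Gamma(1) true_values(1), where \<psi>bar = "\<lambda>\<gamma>. \<psi>bar \<gamma> \<alpha>0 \<theta>0"])
      show "\<psi>bar \<gamma>0 \<alpha>0 \<theta>0 = 0" using psi0_mean by (simp add: psibar_def psi_def \<psi>0_def)
      show "((\<lambda>\<tau>. \<psi>bar ((1 - \<tau>) *\<^sub>R \<gamma>0 + \<tau> *\<^sub>R \<gamma>) \<alpha>0 \<theta>0) has_vector_derivative 0) (at 0)"
        if "\<gamma> \<in> \<Gamma>" for \<gamma> using neyman[OF that] by blast
      show "(\<forall>\<gamma>1\<in>\<Gamma>. \<forall>\<gamma>2\<in>\<Gamma>. \<forall>s::real. \<psi>bar ((1 - s) *\<^sub>R \<gamma>1 + s *\<^sub>R \<gamma>2) \<alpha>0 \<theta>0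
            = (1 - s) *\<^sub>R \<psi>bar \<gamma>1 \<alpha>0 \<theta>0 + s *\<^sub>R \<psi>bar \<gamma>2 \<alpha>0 \<theta>0)
        \<or> (\<exists>nrm. norm_on \<Gamma> nrm \<and>
             tends_in_prob M (\<lambda>n \<omega>. real n powr (1/4) * nrm (\<gamma>h n l \<omega> - \<gamma>0)) 0 \<and>
             (\<exists>C. \<exists>\<delta>>0. \<forall>\<gamma>\<in>\<Gamma>. nrm (\<gamma> - \<gamma>0) < \<delta> \<longrightarrow>
                norm (\<psi>bar \<gamma> \<alpha>0 \<theta>0) \<le> C * (nrm (\<gamma> - \<gamma>0))\<^sup>2))
        \<or> tends_in_prob M (\<lambda>n \<omega>. sqrt (real n) *\<^sub>R \<psi>bar (\<gamma>h n l \<omega>) \<alpha>0 \<theta>0) 0"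
        using A3[OF l] by (elim disjE) blast+
    qed (rule gh\<Gamma>[OF l])
    then have bias: "tends_in_prob M (\<lambda>n \<omega>. sqrt (real n) *\<^sub>R
        (\<integral>w. g w (\<gamma>h n l \<omega>) \<theta>0 + \<phi> w (\<gamma>h n l \<omega>) \<alpha>0 \<theta>0 \<partial>F0)) 0"
      by (simp add: psibar_def psi_def)
    show ?thesis
      unfolding \<psi>0_def
      by (rule F.score_negligible[OF _ _ _ _ A3_i[OF _ l] bias])
         (use A1_i[OF l] A1_ii[OF l] A1_iii[OF l] A2[OF l] in
           \<open>simp_all add: F.R_g_def F.R_phi_def F.R_alpha_def F.\<Delta>_def Delta_def\<close>)
  qed
  have score: "tends_in_prob M (\<lambda>n \<omega>. sqrt (real n) *\<^sub>R \<psi>h n \<omega> \<theta>0 - S n \<omega>) 0"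
  proof -
    have eq: "(\<Sum>l\<in>{1..L}. (\<Sum>i\<in>I n l. (g (W i \<omega>) (\<gamma>h n l \<omega>) \<theta>0
        + \<phi> (W i \<omega>) (\<gamma>h n l \<omega>) (\<alpha>h n l \<omega>) (\<theta>t n l \<omega>)) - \<psi>0 (W i \<omega>)) /\<^sub>R sqrt (real n))
        = sqrt (real n) *\<^sub>R \<psi>h n \<omega> \<theta>0 - S n \<omega>" for n \<omega>
    proof -
      \<comment> \<open>For \<open>n = 0\<close> both sides are 0 by the convention on division, so
        the identity \<open>eq\<close> holds for every n.\<close>
      have "sqrt (real n) * (1 / real n) = inverse (sqrt (real n))"
        by (cases "n = 0") (simp_all add: field_simps)
      then show ?thesis
        unfolding psihat_def S_def sum_subtractf scaleR_diff_right scaleR_sum_right[symmetric] sum_folds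
          scaleR_scaleR by (simp only:)
    qed
    show ?thesis unfolding eq[symmetric] by (intro S.tends_in_prob_sum_0 score_fold)
  qed

  \<comment> \<open>Smoothness near the true first step\<close>
  obtain N nrm \<delta> C and d :: "'w \<Rightarrow> 'g \<Rightarrow> real" and D where N: "open N" "\<theta>0 \<in> N" "N \<subseteq> \<Theta>"
    and nrm: "norm_on \<Gamma> nrm"
    and nrm_cons: "\<forall>l\<in>{1..L}. tends_in_prob M (\<lambda>n \<omega>. nrm (\<gamma>h n l \<omega> - \<gamma>0)) 0"
    and \<delta>: "\<delta> > 0" and C: "C > 0"
    and D: "D \<in> sets (F0 \<Otimes>\<^sub>M \<G>)" and d_meas: "(\<lambda>(w, \<gamma>). d w \<gamma>) \<in> borel_measurable (F0 \<Otimes>\<^sub>M \<G>)"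
    and loc_all: "\<forall>\<gamma>\<in>\<Gamma>. nrm (\<gamma> - \<gamma>0) < \<delta> \<longrightarrow>
              wpa1 M (\<lambda>n \<omega>. \<forall>i\<in>{1..n}. (W i \<omega>, \<gamma>) \<in> D) \<and>
              integrable F0 (\<lambda>w. d w \<gamma>) \<and> (\<integral>w. d w \<gamma> \<partial>F0) < C \<and>
              (\<forall>w. (w, \<gamma>) \<in> D \<longrightarrow> (\<forall>\<theta>\<in>N. g w \<gamma> differentiable (at \<theta>) \<and>
                 norm (jacobian (g w \<gamma>) (at \<theta>) - jacobian (g w \<gamma>) (at \<theta>0))
                   \<le> d w \<gamma> * norm (\<theta> - \<theta>0) powr (1 / C)))"
    using A4 by (elim exE conjE bexE) (rule that)
  note loc = bspec[OF loc_all, THEN mp]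
  define near where "near \<gamma> \<longleftrightarrow> \<gamma> \<in> \<Gamma> \<and> nrm (\<gamma> - \<gamma>0) < \<delta>" for \<gamma>
  have near_ae: "AE w in F0. (w, \<gamma>) \<in> D" if "near \<gamma>" for \<gamma>
    using that loc[of \<gamma>] Gamma(2) by (intro S.AE_if_wpa1_sample[OF D]) (auto simp: near_def)
  have near_diff: "g w \<gamma> differentiable (at \<theta>)"
    and near_lip: "norm (jacobian (g w \<gamma>) (at \<theta>) - jacobian (g w \<gamma>) (at \<theta>0)) \<le> d w \<gamma> * norm (\<theta> - \<theta>0) powr (1 / C)"
    if "near \<gamma>" "(w, \<gamma>) \<in> D" "\<theta> \<in> N" for \<gamma> w \<theta>
    using that loc[of \<gamma>] by (auto simp: near_def)
  have near_wpa1: "wpa1 M (\<lambda>n \<omega>. near (\<gamma>h n l \<omega>))" if l: "l \<in> {1..L}" for l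
  proof -
    have "wpa1 M (\<lambda>n \<omega>. norm (nrm (\<gamma>h n l \<omega> - \<gamma>0) - 0) < \<delta>)"
      using bspec[OF nrm_cons l] \<delta> unfolding S.tends_in_prob_iff_norm by blast
    then show ?thesis by (rule S.wpa1_space_mono) (use gh\<Gamma>[OF l] in \<open>auto simp: near_def\<close>)
  qed
  have near0: "near \<gamma>0"
  proof -
    have "nrm 0 = 0" using nrm subspace_0[OF Gamma(1)] by (auto simp: norm_on_def)
    then show ?thesis using true_values(1) \<delta> by (simp add: near_def)
  qed
  \<comment> \<open>The Hoelder bound at some point of \<open>N\<close> other than
    \<open>\<theta>0\<close> forces \<open>d\<close> to be nonnegative on \<open>D\<close>. The
    bound on the mean of \<open>d\<close> is thereby one on the mean of its absolute value.\<close>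
  obtain \<theta>1 where \<theta>1: "\<theta>1 \<in> N" "\<theta>1 \<noteq> \<theta>0"
  proof -
    obtain r where r: "r > 0" "ball \<theta>0 r \<subseteq> N" using N open_contains_ball by blast
    fix k :: 'p
    have "\<theta>0 + (r / 2) *\<^sub>R axis k 1 \<in> N" using r by (intro subsetD[OF r(2)]) (simp add: dist_norm)
    moreover have "\<theta>0 + (r / 2) *\<^sub>R axis k 1 \<noteq> \<theta>0" using r by (simp add: axis_eq_0_iff)
    ultimately show ?thesis by (rule that)
  qed
  have d_nonneg: "0 \<le> d w \<gamma>" if "near \<gamma>" "(w, \<gamma>) \<in> D" for w \<gamma>
  proof -
    have "0 \<le> d w \<gamma> * norm (\<theta>1 - \<theta>0) powr (1 / C)"
      using near_lip[OF that \<theta>1(1)] norm_ge_zero order_trans by blast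
    moreover have "0 < norm (\<theta>1 - \<theta>0) powr (1 / C)" using \<theta>1(2) by simp
    ultimately show ?thesis by (simp add: zero_le_mult_iff)
  qed
  have d_mean: "(\<integral>\<^sup>+w. ennreal \<bar>d w \<gamma>\<bar> \<partial>F0) \<le> ennreal C" if "near \<gamma>" for \<gamma>
  proof -
    have ae: "AE w in F0. 0 \<le> d w \<gamma>" using near_ae[OF that] by eventually_elim (rule d_nonneg[OF that])
    have "(\<integral>\<^sup>+w. ennreal \<bar>d w \<gamma>\<bar> \<partial>F0) = (\<integral>\<^sup>+w. ennreal (d w \<gamma>) \<partial>F0)"
      by (rule nn_integral_cong_AE) (use ae in eventually_elim, simp)
    also have "\<dots> = ennreal (\<integral>w. d w \<gamma> \<partial>F0)"
      using loc[of \<gamma>] that ae by (intro nn_integral_eq_integral) (auto simp: near_def)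
    also have "\<dots> \<le> ennreal C" using loc[of \<gamma>] that by (intro ennreal_leI) (auto simp: near_def)
    finally show ?thesis .
  qed

  \<comment> \<open>The sample Jacobian\<close>
  define K where "K n \<omega> = (\<Sum>l\<in>{1..L}. (\<Sum>i\<in>I n l. \<bar>d (W i \<omega>) (\<gamma>h n l \<omega>)\<bar>) / real n)" for n \<omega>
  \<comment> \<open>\<open>K\<close> is the random Hoelder constant of the sample Jacobian. The
    absolute values make its terms nonnegative everywhere, as averaging over a fold requires; off
    \<open>D\<close> the sign of \<open>d\<close> is arbitrary.\<close>
  have K: "bounded_in_prob M K"
    unfolding K_def
    by (intro S.bounded_in_prob_sum dml_fold.lipschitz_mean_bounded[OF fold d_meas less_imp_le[OF C]]
        wpa1_mono[OF near_wpa1] d_mean)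
  have all_smooth: "wpa1 M (\<lambda>n \<omega>. \<forall>l\<in>{1..L}. near (\<gamma>h n l \<omega>) \<and> (\<forall>i\<in>I n l. (W i \<omega>, \<gamma>h n l \<omega>) \<in> D))"
    by (intro S.wpa1_ball S.wpa1_conj near_wpa1 dml_fold.smooth_on_fold[OF fold D] finite_atLeastAtMost
        wpa1_mono[OF near_wpa1] near_ae)
  have psih_eq: "\<psi>h n \<omega> = (\<lambda>\<theta>. (1 / real n) *\<^sub>R (\<Sum>l\<in>{1..L}. \<Sum>i\<in>I n l.
        g (W i \<omega>) (\<gamma>h n l \<omega>) \<theta> + \<phi> (W i \<omega>) (\<gamma>h n l \<omega>) (\<alpha>h n l \<omega>) (\<theta>t n l \<omega>)))" for n \<omega>
    by (simp add: psihat_def)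
  have psih_jac: "\<psi>h n \<omega> differentiable (at \<theta>)"
      "jacobian (\<psi>h n \<omega>) (at \<theta>) = (1 / real n) *\<^sub>R (\<Sum>l\<in>{1..L}. \<Sum>i\<in>I n l. jacobian (g (W i \<omega>) (\<gamma>h n l \<omega>)) (at \<theta>))"
    if sm: "\<forall>l\<in>{1..L}. near (\<gamma>h n l \<omega>) \<and> (\<forall>i\<in>I n l. (W i \<omega>, \<gamma>h n l \<omega>) \<in> D)" and \<theta>: "\<theta> \<in> N" for n \<omega> \<theta>
  proof -
    have df: "g (W i \<omega>) (\<gamma>h n l \<omega>) differentiable (at \<theta>)" if "l \<in> {1..L}" "i \<in> I n l" for l i
      using sm that \<theta> by (intro near_diff) auto
    show "\<psi>h n \<omega> differentiable (at \<theta>)"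
      unfolding psih_eq by (rule jacobian_average(1)[where f = "\<lambda>l i. g (W i \<omega>) (\<gamma>h n l \<omega>)"]) (rule df)
    show "jacobian (\<psi>h n \<omega>) (at \<theta>) = (1 / real n) *\<^sub>R (\<Sum>l\<in>{1..L}. \<Sum>i\<in>I n l. jacobian (g (W i \<omega>) (\<gamma>h n l \<omega>)) (at \<theta>))"
      unfolding psih_eq by (rule jacobian_average(2)[where f = "\<lambda>l i. g (W i \<omega>) (\<gamma>h n l \<omega>)"]) (rule df)
  qed
  have smooth: "wpa1 M (\<lambda>n \<omega>. \<forall>\<theta>\<in>N. \<psi>h n \<omega> differentiable (at \<theta>) \<and>
        norm (jacobian (\<psi>h n \<omega>) (at \<theta>) - jacobian (\<psi>h n \<omega>) (at \<theta>0)) \<le> K n \<omega> * norm (\<theta> - \<theta>0) powr (1 / C))"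
  proof (rule wpa1_mono[OF all_smooth], intro ballI conjI)
    fix n \<omega> \<theta>
    assume sm: "\<forall>l\<in>{1..L}. near (\<gamma>h n l \<omega>) \<and> (\<forall>i\<in>I n l. (W i \<omega>, \<gamma>h n l \<omega>) \<in> D)" and \<theta>: "\<theta> \<in> N"
    show "\<psi>h n \<omega> differentiable (at \<theta>)" by (rule psih_jac(1)[OF sm \<theta>])
    define e where "e l i = jacobian (g (W i \<omega>) (\<gamma>h n l \<omega>)) (at \<theta>)
      - jacobian (g (W i \<omega>) (\<gamma>h n l \<omega>)) (at \<theta>0)" for l i
    have "norm (jacobian (\<psi>h n \<omega>) (at \<theta>) - jacobian (\<psi>h n \<omega>) (at \<theta>0))
        = (1 / real n) * norm (\<Sum>l\<in>{1..L}. \<Sum>i\<in>I n l. e l i)"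
      unfolding psih_jac(2)[OF sm \<theta>] psih_jac(2)[OF sm N(2)] scaleR_diff_right[symmetric]
        sum_subtractf[symmetric] e_def by simp
    also have "\<dots> \<le> (1 / real n) * (\<Sum>l\<in>{1..L}. \<Sum>i\<in>I n l. \<bar>d (W i \<omega>) (\<gamma>h n l \<omega>)\<bar> * norm (\<theta> - \<theta>0) powr (1 / C))"
    proof (intro mult_left_mono sum_norm_le)
      fix l i assume "l \<in> {1..L}" "i \<in> I n l"
      then have "norm (e l i) \<le> d (W i \<omega>) (\<gamma>h n l \<omega>) * norm (\<theta> - \<theta>0) powr (1 / C)"
        unfolding e_def using sm \<theta> by (intro near_lip) auto
      also have "\<dots> \<le> \<bar>d (W i \<omega>) (\<gamma>h n l \<omega>)\<bar> * norm (\<theta> - \<theta>0) powr (1 / C)"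
        by (intro mult_right_mono) auto
      finally show "norm (e l i) \<le> \<bar>d (W i \<omega>) (\<gamma>h n l \<omega>)\<bar> * norm (\<theta> - \<theta>0) powr (1 / C)" .
    qed simp
    also have "\<dots> = K n \<omega> * norm (\<theta> - \<theta>0) powr (1 / C)"
      by (simp add: K_def sum_distrib_right sum_divide_distrib sum_distrib_left)
    finally show "norm (jacobian (\<psi>h n \<omega>) (at \<theta>) - jacobian (\<psi>h n \<omega>) (at \<theta>0)) \<le> K n \<omega> * norm (\<theta> - \<theta>0) powr (1 / C)" .
  qed
  have J0: "tends_in_prob M (\<lambda>n \<omega>. jacobian (\<psi>h n \<omega>) (at \<theta>0)) G"
  proof -
    have "tends_in_prob M (\<lambda>n \<omega>. (\<Sum>i\<in>I n l. jacobian (g (W i \<omega>) (\<gamma>h n l \<omega>)) (at \<theta>0)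
        - jacobian (g (W i \<omega>) \<gamma>0) (at \<theta>0)) /\<^sub>R real n) 0" if l: "l \<in> {1..L}" for l
      by (rule dml_fold.jacobian_error_on_fold[OF fold[OF l] N D, where near = near])
         (use near_ae near_diff N(2) near0 near_wpa1[OF l] A4_iii[OF l] in auto)
    then have "tends_in_prob M (\<lambda>n \<omega>. \<Sum>l\<in>{1..L}. (\<Sum>i\<in>I n l. jacobian (g (W i \<omega>) (\<gamma>h n l \<omega>)) (at \<theta>0)
        - jacobian (g (W i \<omega>) \<gamma>0) (at \<theta>0)) /\<^sub>R real n) 0"
      by (rule S.tends_in_prob_sum_0)
    moreover have "tends_in_prob M (\<lambda>n \<omega>. (\<Sum>i\<in>{1..n}. jacobian (g (W i \<omega>) \<gamma>0) (at \<theta>0)) /\<^sub>R real n) G"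
      using S.weak_law_of_large_numbers[of "\<lambda>w. jacobian (g w \<gamma>0) (at \<theta>0)"] G_def
      by (simp add: has_bochner_integral_iff)
    ultimately have "tends_in_prob M (\<lambda>n \<omega>. (\<Sum>l\<in>{1..L}. (\<Sum>i\<in>I n l. jacobian (g (W i \<omega>) (\<gamma>h n l \<omega>)) (at \<theta>0)
        - jacobian (g (W i \<omega>) \<gamma>0) (at \<theta>0)) /\<^sub>R real n)
        + (\<Sum>i\<in>{1..n}. jacobian (g (W i \<omega>) \<gamma>0) (at \<theta>0)) /\<^sub>R real n) (0 + G)"
      by (rule S.tends_in_prob_add)
    \<comment> \<open>The Jacobian of the average is evaluated as the average of the Jacobians on
      the event \<open>all_smooth\<close>, where every summand is differentiable at
      \<open>\<theta>0\<close>.\<close>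
    then have "tends_in_prob M (\<lambda>n \<omega>. jacobian (\<psi>h n \<omega>) (at \<theta>0)) (0 + G)"
    proof (rule S.tends_in_prob_cong, intro wpa1_mono[OF all_smooth])
      fix n \<omega>
      assume sm: "\<forall>l\<in>{1..L}. near (\<gamma>h n l \<omega>) \<and> (\<forall>i\<in>I n l. (W i \<omega>, \<gamma>h n l \<omega>) \<in> D)"
      show "(\<Sum>l\<in>{1..L}. (\<Sum>i\<in>I n l. jacobian (g (W i \<omega>) (\<gamma>h n l \<omega>)) (at \<theta>0)
        - jacobian (g (W i \<omega>) \<gamma>0) (at \<theta>0)) /\<^sub>R real n)
        + (\<Sum>i\<in>{1..n}. jacobian (g (W i \<omega>) \<gamma>0) (at \<theta>0)) /\<^sub>R real n = jacobian (\<psi>h n \<omega>) (at \<theta>0)"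
        unfolding psih_jac(2)[OF sm N(2)] sum_subtractf scaleR_diff_right scaleR_sum_right[symmetric] sum_folds
        by (simp add: inverse_eq_divide)
    qed
    then show ?thesis by simp
  qed

  \<comment> \<open>Limit law of the estimator\<close>
  have \<Upsilon>h_sym: "transpose (\<Upsilon>h n \<omega>) = \<Upsilon>h n \<omega>" if "\<omega> \<in> space M" for n \<omega>
    using weights[OF that] by (simp add: pos_semidef_def)
  \<comment> \<open>Symmetry is a closed condition: if the limit violated it, so would some
    \<open>\<Upsilon>h n \<omega>\<close>.\<close>
  have \<Upsilon>_sym: "transpose \<Upsilon> = \<Upsilon>"
  proof (rule ccontr)
    assume "transpose \<Upsilon> \<noteq> \<Upsilon>"
    have "isCont (\<lambda>U. transpose U - U) \<Upsilon>"
      unfolding isCont_def by (intro tendsto_intros)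
    from S.tends_in_prob_isCont[OF Upsilon_cons this]
    have "wpa1 M (\<lambda>n \<omega>. transpose (\<Upsilon>h n \<omega>) - \<Upsilon>h n \<omega> \<in> - {0})"
      unfolding tends_in_prob_def using \<open>transpose \<Upsilon> \<noteq> \<Upsilon>\<close> by (elim allE[of _ "- {0}"]) auto
    from S.wpa1_ex[OF this] \<Upsilon>h_sym show False by auto
  qed
  define B where "B = - (matrix_inv (transpose G ** \<Upsilon> ** G) ** transpose G ** \<Upsilon>)"
  have inv_C: "0 < 1 / C" using C by simp
  note lin = S.gmm_linearization[OF N inv_C smooth K J0 score S_bdd \<Upsilon>h_sym theta_hat theta_hat_cons
      Upsilon_cons nonsing]
  have Gh_lim: "tends_in_prob M Gh G" using lin(1) by (simp add: Ghat_def)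
  have \<Psi>: "\<Psi> = (\<integral>w. outer_square (\<psi>0 w) \<partial>F0)" by (simp add: Psi_def psi_def \<psi>0_def)
  note quad = outer_square_integral_quadratic[OF psi0_meas psi0_sq, folded \<Psi>]
  define V where "V = gmm_variance G \<Upsilon> \<Psi>"
  have V: "V = B ** \<Psi> ** transpose B"
    unfolding V_def B_def by (rule gmm_variance_eq_sandwich[OF \<Upsilon>_sym nonsing])
  have quadV: "t \<bullet> (V *v t) = (\<integral>w. (t \<bullet> (B *v \<psi>0 w))\<^sup>2 \<partial>F0)" for t
  proof -
    have "t \<bullet> (V *v t) = (transpose B *v t) \<bullet> (\<Psi> *v (transpose B *v t))"
      unfolding V by (simp add: matrix_vector_mul_assoc[symmetric] dot_lmul_matrix)
    also have "\<dots> = (\<integral>w. ((transpose B *v t) \<bullet> \<psi>0 w)\<^sup>2 \<partial>F0)" by (rule quad)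
    finally show ?thesis by (simp add: dot_lmul_matrix)
  qed
  have "pos_semidef V"
    unfolding pos_semidef_def
  proof (intro conjI allI)
    show "transpose V = V"
      using transpose_outer_square_integral[OF psi0_meas psi0_sq]
      by (simp add: V matrix_transpose_mul \<Psi> matrix_mul_assoc)
    show "0 \<le> x \<bullet> (V *v x)" for x unfolding quadV by simp
  qed
  then obtain Z where Z: "is_multivariate_normal Z 0 V" using multivariate_normal_exists by blast
  have "converges_weakly (\<lambda>n. distr M borel (\<lambda>\<omega>. sqrt (real n) *\<^sub>R (\<theta>h n \<omega> - \<theta>0))) Z"
  proof (rule S.asymptotically_linear_converges_weakly[OF _ _ _ quadV Z])
    have BL: "bounded_linear ((*v) B)" by (rule matrix_vector_mul_bounded_linear)
    show meas: "(\<lambda>w. B *v \<psi>0 w) \<in> borel_measurable F0"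
      using borel_measurable_continuous_onI[OF linear_continuous_on[OF BL]] psi0_meas
      by (rule measurable_compose[rotated])
    show "integrable F0 (\<lambda>w. (norm (B *v \<psi>0 w))\<^sup>2)"
    proof (rule Bochner_Integration.integrable_bound)
      show "integrable F0 (\<lambda>w. (norm B)\<^sup>2 * (norm (\<psi>0 w))\<^sup>2)" using psi0_sq by simp
      have "(norm (B *v \<psi>0 w))\<^sup>2 \<le> (norm B * norm (\<psi>0 w))\<^sup>2" for w
        by (intro power_mono norm_matrix_vector_mult_le) simp
      then show "AE w in F0. norm ((norm (B *v \<psi>0 w))\<^sup>2) \<le> norm ((norm B)\<^sup>2 * (norm (\<psi>0 w))\<^sup>2)"
        by (simp add: power_mult_distrib)
    qed (use meas in measurable)
    show "(\<integral>w. B *v \<psi>0 w \<partial>F0) = 0"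
      using integral_bounded_linear[OF BL, of F0 \<psi>0] psi0_int by (simp add: has_bochner_integral_iff)
    show "(\<lambda>\<omega>. sqrt (real n) *\<^sub>R (\<theta>h n \<omega> - \<theta>0)) \<in> borel_measurable M" for n
      using theta_hat_meas[of n] by measurable
    have "B *v S n \<omega> = (\<Sum>i\<in>{1..n}. B *v \<psi>0 (W i \<omega>)) /\<^sub>R sqrt (real n)" for n \<omega>
      unfolding S_def by (simp add: linear_scale linear_sum matrix_vector_mul_linear)
    then show "tends_in_prob M (\<lambda>n \<omega>. sqrt (real n) *\<^sub>R (\<theta>h n \<omega> - \<theta>0)
        - (\<Sum>i\<in>{1..n}. B *v \<psi>0 (W i \<omega>)) /\<^sub>R sqrt (real n)) 0"
      using lin(2) by (simp add: B_def)
  qed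
  then have part1: "\<exists>N. is_multivariate_normal N 0 (gmm_variance G \<Upsilon> \<Psi>) \<and>
            converges_weakly (\<lambda>n. distr M borel (\<lambda>\<omega>. sqrt (real n) *\<^sub>R (\<theta>h n \<omega> - \<theta>0))) N"
    using Z by (auto simp: V_def)

  \<comment> \<open>Consistency of the variance estimator\<close>
  have part2: "tends_in_prob M (\<lambda>n \<omega>. gmm_variance (Gh n \<omega>) (\<Upsilon>h n \<omega>) (\<Psi>h n \<omega>)) (gmm_variance G \<Upsilon> \<Psi>)"
    if extra: "\<forall>l\<in>{1..L}.
             tends_in_prob M (\<lambda>n \<omega>. \<integral>\<^sup>+w. ennreal ((norm
               (g w (\<gamma>h n l \<omega>) (\<theta>t n l \<omega>) - g w (\<gamma>h n l \<omega>) \<theta>0))\<^sup>2) \<partial>F0) 0 \<and>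
             tends_in_prob M (\<lambda>n \<omega>. \<integral>\<^sup>+w. ennreal ((norm (\<Delta>h n l \<omega> w))\<^sup>2) \<partial>F0) 0"
  proof -
    have psi_avg: "bounded_in_prob M (\<lambda>n \<omega>. (\<Sum>i\<in>{1..n}. (norm (\<psi>0 (W i \<omega>)))\<^sup>2) /\<^sub>R real n)"
      by (rule S.tends_in_prob_bounded[OF S.weak_law_of_large_numbers[OF psi0_sq]])
    have "tends_in_prob M (\<lambda>n \<omega>. (\<Sum>i\<in>I n l. outer_square (\<psi>hi n l i \<omega>) - outer_square (\<psi>0 (W i \<omega>))) /\<^sub>R real n) 0"
      if l: "l \<in> {1..L}" for l
    proof (rule S.outer_square_average_error)
      interpret F: dml_fold M F0 W "\<lambda>n. I n l" "\<lambda>n. {1..n} - I n l" \<G> \<A> \<Theta>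
        "\<lambda>n. \<gamma>h n l" "\<lambda>n. \<alpha>h n l" "\<lambda>n. \<theta>t n l" g \<phi> \<gamma>0 \<alpha>0 \<theta>0 by (rule fold[OF l])
      show "tends_in_prob M (\<lambda>n \<omega>. (\<Sum>i\<in>I n l. (norm (\<psi>hi n l i \<omega> - \<psi>0 (W i \<omega>)))\<^sup>2) / real n) 0"
        unfolding psihati_def \<psi>0_def
        by (rule F.moment_error_mean_square)
           (use A1_i[OF l] A1_ii[OF l] A1_iii[OF l] extra l in
             \<open>simp_all add: F.R_g_def F.R_phi_def F.R_alpha_def F.R_theta_def F.\<Delta>_def Delta_def\<close>)
      \<comment> \<open>A fold average of nonnegative terms divided by n is at most the average over
        the whole sample, which converges by the weak law.\<close>
      show "bounded_in_prob M (\<lambda>n \<omega>. (\<Sum>i\<in>I n l. (norm (\<psi>0 (W i \<omega>)))\<^sup>2) / real n)"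
      proof (rule S.bounded_in_prob_wpa1[OF psi_avg, where f = "\<lambda>B. B"], intro S.wpa1_always impI)
        fix B n \<omega> assume *: "norm ((\<Sum>i\<in>{1..n}. (norm (\<psi>0 (W i \<omega>)))\<^sup>2) /\<^sub>R real n) \<le> B"
        have "(\<Sum>i\<in>I n l. (norm (\<psi>0 (W i \<omega>)))\<^sup>2) / real n \<le> (\<Sum>i\<in>{1..n}. (norm (\<psi>0 (W i \<omega>)))\<^sup>2) / real n"
          using sub_nat[OF l, of n] by (intro divide_right_mono sum_mono2) auto
        then show "norm ((\<Sum>i\<in>I n l. (norm (\<psi>0 (W i \<omega>)))\<^sup>2) / real n) \<le> B"
          using * by (simp add: sum_nonneg inverse_eq_divide)
      qed
    qed
    then have "tends_in_prob M (\<lambda>n \<omega>. \<Sum>l\<in>{1..L}. (\<Sum>i\<in>I n l. outer_square (\<psi>hi n l i \<omega>)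
        - outer_square (\<psi>0 (W i \<omega>))) /\<^sub>R real n) 0"
      by (rule S.tends_in_prob_sum_0)
    from S.tends_in_prob_add[OF this
        S.weak_law_of_large_numbers[OF integrable_outer_square[OF psi0_meas psi0_sq]]]
    have "tends_in_prob M (\<lambda>n \<omega>. (\<Sum>l\<in>{1..L}. (\<Sum>i\<in>I n l. outer_square (\<psi>hi n l i \<omega>)
        - outer_square (\<psi>0 (W i \<omega>))) /\<^sub>R real n)
        + (\<Sum>i\<in>{1..n}. outer_square (\<psi>0 (W i \<omega>))) /\<^sub>R real n) \<Psi>"
      by (simp add: \<Psi>)
    also have "(\<lambda>n \<omega>. (\<Sum>l\<in>{1..L}. (\<Sum>i\<in>I n l. outer_square (\<psi>hi n l i \<omega>)
        - outer_square (\<psi>0 (W i \<omega>))) /\<^sub>R real n)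
        + (\<Sum>i\<in>{1..n}. outer_square (\<psi>0 (W i \<omega>))) /\<^sub>R real n) = \<Psi>h"
      unfolding Psihat_def sum_subtractf scaleR_diff_right scaleR_sum_right[symmetric] sum_folds
      by (simp add: inverse_eq_divide)
    finally have \<Psi>h_lim: "tends_in_prob M \<Psi>h \<Psi>" .
    have "isCont (\<lambda>(a, u, p). gmm_variance a u p) (G, \<Upsilon>, \<Psi>)"
      unfolding isCont_def case_prod_beta' using nonsing
      by (auto intro!: tendsto_gmm_variance tendsto_fst[OF tendsto_ident_at, THEN tendsto_eq_rhs]
          tendsto_fst[OF tendsto_snd[OF tendsto_ident_at], THEN tendsto_eq_rhs]
          tendsto_snd[OF tendsto_snd[OF tendsto_ident_at], THEN tendsto_eq_rhs])
    from S.tends_in_prob_isCont[OF S.tends_in_prob_Pair[OF Gh_lim S.tends_in_prob_Pair[OF Upsilon_cons \<Psi>h_lim]] this]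
    show ?thesis by simp
  qed
  show ?thesis using part1 part2 by blast
qed

end
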